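(* Let $0<\omega<\tfrac3{16}$ and let $\delta$ be the solution to $$-\delta''(r)-\tfrac2r\delta'(r)+[5P_\omega^4(r)-3P_\omega^2(r)+\omega]\,\delta(r)=0,\qquad r>0,$$ obeying $\delta(0)=1$. Then $\delta(r)\to-\infty$ as $r\to\infty$. Correspondingly, zero is not an eigenvalue of $\mathcal{L}_\omega=-\Delta+5P_\omega^4-3P_\omega^2+\omega$ restricted to radial functions.
   Context: For $0<\omega<\tfrac3{16}$, $P_\omega\in H^1(\mathbb{R}^3)$ denotes the unique non-zero non-negative radially symmetric solution of $-\Delta P_\omega+P_\omega^5-P_\omega^3+\omega P_\omega=0$; it is regarded as a function of $r=|x|$ where convenient. The solution $\delta$ is uniquely determined: $\sigma(r)=r\delta(r)$ is the solution of $-\sigma''+[5P_\omega^4-3P_\omega^2+\omega]\sigma=0$ with $\sigma(0)=0$, $\sigma'(0)=1$. The operator $\mathcal{L}_\omega$ acts on $L^2(\mathbb{R}^3)$. *)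

theory Defs
  imports "HOL-Analysis.Analysis"
begin

definition partial_deriv :: "'a::euclidean_space \<Rightarrow> ('a \<Rightarrow> real) \<Rightarrow> 'a \<Rightarrow> real" where
  "partial_deriv b \<phi> x = frechet_derivative \<phi> (at x) b"

definition laplacian :: "('a::euclidean_space \<Rightarrow> real) \<Rightarrow> 'a \<Rightarrow> real" where
  "laplacian \<phi> x = (\<Sum>b\<in>Basis. partial_deriv b (partial_deriv b \<phi>) x)"

primrec Ck :: "nat \<Rightarrow> ('a::euclidean_space \<Rightarrow> real) \<Rightarrow> bool" where
  "Ck 0 \<phi> \<longleftrightarrow> continuous_on UNIV \<phi>"
| "Ck (Suc k) \<phi> \<longleftrightarrow> (\<forall>x. \<phi> differentiable (at x)) \<and> (\<forall>b\<in>Basis. Ck k (partial_deriv b \<phi>))"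

definition test_function :: "('a::euclidean_space \<Rightarrow> real) \<Rightarrow> bool" where
  "test_function \<phi> \<longleftrightarrow> (\<forall>k. Ck k \<phi>) \<and> compact (closure {x. \<phi> x \<noteq> 0})"

(* The following notions concern functions rather than classes of functions modulo null
   sets; equality of classes is written explicitly with AE. *)

definition locally_integrable ::
    "('a::euclidean_space \<Rightarrow> 'b::{banach,second_countable_topology}) \<Rightarrow> bool" where
  "locally_integrable u \<longleftrightarrow> (\<forall>K. compact K \<longrightarrow> set_integrable lborel K u)"

definition square_integrable ::
    "('a::euclidean_space \<Rightarrow> 'b::{banach,second_countable_topology}) \<Rightarrow> bool" where
  "square_integrable u \<longleftrightarrow>
     u \<in> borel_measurable lborel \<and> integrable lborel (\<lambda>x. (norm (u x))\<^sup>2)"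

definition has_weak_partial ::
    "'a::euclidean_space \<Rightarrow> ('a \<Rightarrow> 'b::{banach,second_countable_topology}) \<Rightarrow> ('a \<Rightarrow> 'b) \<Rightarrow> bool" where
  "has_weak_partial b u v \<longleftrightarrow> locally_integrable u \<and> locally_integrable v \<and>
     (\<forall>\<phi>. test_function \<phi> \<longrightarrow>
        (\<integral>x. partial_deriv b \<phi> x *\<^sub>R u x \<partial>lborel) = - (\<integral>x. \<phi> x *\<^sub>R v x \<partial>lborel))"

definition has_weak_laplacian ::
    "('a::euclidean_space \<Rightarrow> 'b::{banach,second_countable_topology}) \<Rightarrow> ('a \<Rightarrow> 'b) \<Rightarrow> bool" where
  "has_weak_laplacian u w \<longleftrightarrow> locally_integrable u \<and> locally_integrable w \<and>
     (\<forall>\<phi>. test_function \<phi> \<longrightarrow>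
        (\<integral>x. laplacian \<phi> x *\<^sub>R u x \<partial>lborel) = (\<integral>x. \<phi> x *\<^sub>R w x \<partial>lborel))"

(* sobolev k u: membership of u in the L2-based Sobolev space H^k. *)
primrec sobolev ::
    "nat \<Rightarrow> ('a::euclidean_space \<Rightarrow> 'b::{banach,second_countable_topology}) \<Rightarrow> bool" where
  "sobolev 0 u \<longleftrightarrow> square_integrable u"
| "sobolev (Suc k) u \<longleftrightarrow> square_integrable u \<and>
     (\<forall>b\<in>Basis. \<exists>v. has_weak_partial b u v \<and> sobolev k v)"

(* P is the continuous representative of a non-zero, non-negative, radially symmetric H^1
   solution, in the sense of distributions, of
     - Laplace P + P^5 - P^3 + omega P = 0  on R^3. *)
definition is_soliton :: "real \<Rightarrow> (real^3 \<Rightarrow> real) \<Rightarrow> bool" where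
  "is_soliton \<omega> P \<longleftrightarrow>
     sobolev 1 P \<and> continuous_on UNIV P \<and>
     (\<forall>x y. norm x = norm y \<longrightarrow> P x = P y) \<and>
     (\<forall>x. 0 \<le> P x) \<and> (\<exists>x. P x \<noteq> 0) \<and>
     has_weak_laplacian P (\<lambda>x. P x ^ 5 - P x ^ 3 + \<omega> * P x)"

(* A radial function of x regarded as a function of r = |x|; the choice of the unit vector
   is immaterial. *)
definition radial_profile :: "(real^3 \<Rightarrow> real) \<Rightarrow> real \<Rightarrow> real" where
  "radial_profile f r = f (r *\<^sub>R axis 1 1)"

definition linearized_potential :: "real \<Rightarrow> (real^3 \<Rightarrow> real) \<Rightarrow> real^3 \<Rightarrow> real" where
  "linearized_potential \<omega> P x = 5 * P x ^ 4 - 3 * P x ^ 2 + \<omega>"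

(* The value at 0 is attained continuously. This excludes the solutions that behave like
   1/r at the origin, and it says exactly that s(r) = r d(r) has s(0) = 0 and s'(0) = 1. *)
definition is_regular_radial_solution :: "(real \<Rightarrow> real) \<Rightarrow> (real \<Rightarrow> real) \<Rightarrow> bool" where
  "is_regular_radial_solution V \<delta> \<longleftrightarrow>
     \<delta> 0 = 1 \<and> (\<delta> \<longlongrightarrow> 1) (at_right 0) \<and>
     (\<exists>\<delta>' \<delta>''. \<forall>r>0.
        (\<delta> has_real_derivative \<delta>' r) (at r) \<and>
        (\<delta>' has_real_derivative \<delta>'' r) (at r) \<and>
        - \<delta>'' r - 2 / r * \<delta>' r + V r * \<delta> r = 0)"

(* Graph of the operator - Laplace + V on complex L2(R^3) with domain H^2(R^3). *)
definition schroedinger_graph ::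
    "(real^3 \<Rightarrow> real) \<Rightarrow> (real^3 \<Rightarrow> complex) \<Rightarrow> (real^3 \<Rightarrow> complex) \<Rightarrow> bool" where
  "schroedinger_graph V u f \<longleftrightarrow> sobolev 2 u \<and> square_integrable f \<and>
     (\<exists>w. has_weak_laplacian u w \<and> (AE x in lborel. f x = - w x + V x *\<^sub>R u x))"

definition radial_ae :: "(real^3 \<Rightarrow> complex) \<Rightarrow> bool" where
  "radial_ae u \<longleftrightarrow> (\<exists>g. AE x in lborel. u x = g (norm x))"

definition is_radial_eigenvalue :: "(real^3 \<Rightarrow> real) \<Rightarrow> complex \<Rightarrow> bool" where
  "is_radial_eigenvalue V \<mu> \<longleftrightarrow>
     (\<exists>u. radial_ae u \<and> \<not> (AE x in lborel. u x = 0) \<and> schroedinger_graph V u (\<lambda>x. \<mu> * u x))"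

end

theory Submission
  imports Defs "HOL-Real_Asymp.Real_Asymp"
begin

text \<open>
Write f(x) = x^3 - x^5 - omega x, so that the soliton solves -Laplace P = f(P), and let p be its
radial profile, q = p^2, and L = -Laplace - f'(P) the linearized operator.  The proof is a
comparison argument with explicit functions v on which L acts simply:
  L p' = -(2 / r^2) p',   L p = f(p) - p f'(p) = 2 p^3 (2 q - 1),   L (r p') = 2 f(p).
For such a v the Wronskian W = r^2 (delta v' - delta' v) satisfies W' = - r^2 delta L v and
vanishes at the origin.

The comparison with p' shows that delta has a first zero r0, with delta'(r0) < 0
(\<open>\<sigma>_vanishes\<close>, \<open>first_zero\<close>).  The comparison with p shows q(r0) < 1/2.  Put
  v = r p' + c p,   L v = 2 p (g(q) - c q (1 - 2 q)),   g(q) = q - q^2 - omega,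
with c the value of g(q) / (q (1 - 2 q)) at r0, replaced by 0 if that value is negative.  This
quotient increases in q on (0, 1/2), so L v < 0 beyond r0; and if c > 0 then L v > 0 before r0.
Either way v(r0) < 0: for c = 0 because p' < 0, for c > 0 because W(r0) < 0.  The sign of v is the
sign of c - theta with theta = - r p' / p, and theta is increasing, so v stays negative beyond r0.
Hence W decreases from a negative value as long as delta < 0, while at a second zero of delta W
would be nonnegative.  So delta < 0 on all of (r0, infinity), and W stays away from 0 there.  Near
infinity the potential is positive, and a solution \<sigma> = r delta of constant sign either decays together
with its derivative, which would force W to tend to 0, or \<sigma> / r diverges
(\<open>growth_alternative\<close>); so delta tends to minus infinity (\<open>\<sigma>_over_r_at_bot\<close>).

The monotonicity of theta uses the soliton globally, from 0 to infinity.  It amounts to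
positivity of r^2 p^2 theta', whose derivative is positive where q > 1/2, and which elsewhere
dominates the Pohozaev expression r^3 (p'^2 + 2 F(p)) + r^2 p p'.  The latter vanishes at 0 and at
infinity, and its derivative r^2 q (q/2 - 2 omega) changes sign at most once, from plus to minus
(\<open>pohozaev_pos\<close>, \<open>\<theta>_flux_pos\<close>, \<open>\<theta>_strict_mono\<close>).

All of this is about ordinary differential equations.  The passage from distributions to them is
\<open>radial_weak_solution\<close>: a radial weak solution of Laplace u = c(|x|) u is almost everywhere
s(|x|) / |x| with s'' = c s and s(0+) = 0.  It is used twice, for the soliton itself and for the
real and imaginary parts of an eigenfunction.  For the latter, either s vanishes identically or
s / r is a multiple of a solution of the kind of delta, which diverges and so is not square integrable.
\<close>

section \<open>Smooth test functions\<close>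

lemma DERIV_at_imp_continuous_on:
  assumes "\<And>x. x \<in> S \<Longrightarrow> (f has_real_derivative f' x) (at x)"
  shows "continuous_on S f"
  using assms by (intro continuous_at_imp_continuous_on ballI DERIV_isCont)

text \<open>The relative version of \<open>Ck\<close> on an open set is needed because functions of the norm are composed
from pieces, such as the square root, that are smooth only away from a point.\<close>

primrec Ck_on :: "'a::euclidean_space set \<Rightarrow> nat \<Rightarrow> ('a \<Rightarrow> real) \<Rightarrow> bool" where
  "Ck_on S 0 \<phi> \<longleftrightarrow> continuous_on S \<phi>"
| "Ck_on S (Suc k) \<phi> \<longleftrightarrow> (\<forall>x\<in>S. \<phi> differentiable (at x)) \<and> (\<forall>b\<in>Basis. Ck_on S k (partial_deriv b \<phi>))"

lemma Ck_iff_Ck_on: "Ck k \<phi> \<longleftrightarrow> Ck_on UNIV k \<phi>"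
  by (induction k arbitrary: \<phi>) auto

lemma partial_deriv_eq: "(f has_derivative D) (at x) \<Longrightarrow> partial_deriv b f x = D b"
  unfolding partial_deriv_def by (metis frechet_derivative_at)

lemma Ck_on_cong:
  assumes "open S" "\<And>x. x \<in> S \<Longrightarrow> f x = g x" "Ck_on S k f"
  shows "Ck_on S k g"
  using assms(2,3)
proof (induction k arbitrary: f g)
  case 0
  then show ?case by (simp cong: continuous_on_cong)
next
  case (Suc k)
  have D: "(f has_derivative D) (at x) \<longleftrightarrow> (g has_derivative D) (at x)" if "x \<in> S" for x D
    using has_derivative_transform_within_open[OF _ assms(1) that] Suc.prems(1) by metis
  have "partial_deriv b f x = partial_deriv b g x" if "x \<in> S" for x b
    unfolding partial_deriv_def frechet_derivative_def using D[OF that] by simp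
  then have "Ck_on S k (partial_deriv b g)" if "b \<in> Basis" for b
    using Suc.IH[of "partial_deriv b f" "partial_deriv b g"] Suc.prems(2) that by auto
  moreover have "g differentiable at x" if "x \<in> S" for x
  proof -
    obtain D' where "(f has_derivative D') (at x)"
      using Suc.prems(2) \<open>x \<in> S\<close> by (auto simp: differentiable_def)
    then have "(g has_derivative D') (at x)" using D[OF \<open>x \<in> S\<close>] by blast
    then show ?thesis by (auto simp: differentiable_def)
  qed
  ultimately show ?case by simp
qed

text \<open>Reduces one degree of smoothness to a pointwise formula for the derivative, so that the
choice made by \<open>frechet_derivative\<close> never has to be inspected again.\<close>

lemma Ck_on_SucI:
  assumes "open S" "\<And>x. x \<in> S \<Longrightarrow> (f has_derivative D x) (at x)"
    and "\<And>b. b \<in> Basis \<Longrightarrow> Ck_on S k (\<lambda>x. D x b)"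
  shows "Ck_on S (Suc k) f"
proof -
  have "Ck_on S k (partial_deriv b f)" if "b \<in> Basis" for b
    by (rule Ck_on_cong[OF assms(1) _ assms(3)[OF that]]) (simp add: partial_deriv_eq[OF assms(2)])
  then show ?thesis using assms(2) by (auto simp: differentiable_def)
qed

lemma Ck_on_SucI_real:
  fixes f :: "real \<Rightarrow> real"
  assumes "open S" "\<And>x. x \<in> S \<Longrightarrow> (f has_real_derivative f' x) (at x)" "Ck_on S k f'"
  shows "Ck_on S (Suc k) f"
  by (rule Ck_on_SucI[OF assms(1), where D="\<lambda>x. (*) (f' x)"])
     (use assms in \<open>auto simp: has_field_derivative_def\<close>)

lemma Ck_on_Suc_D:
  assumes "Ck_on S (Suc k) f" "x \<in> S"
  shows "(f has_derivative (\<lambda>h. frechet_derivative f (at x) h)) (at x)"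
  using assms frechet_derivative_works by auto

lemma Ck_on_Suc_imp: "Ck_on S (Suc k) f \<Longrightarrow> Ck_on S k f"
proof (induction k arbitrary: f)
  case 0
  then show ?case
    by (auto intro!: continuous_at_imp_continuous_on differentiable_imp_continuous_within)
qed (metis Ck_on.simps(2))

lemma Ck_on_const: "Ck_on S k (\<lambda>x. c)"
proof (induction k arbitrary: c)
  case (Suc k)
  have "partial_deriv b (\<lambda>x. c) = (\<lambda>x. 0)" for b :: 'a
    by (rule ext, rule partial_deriv_eq) (rule has_derivative_const)
  then show ?case using Suc by simp
qed simp

lemma Ck_on_add:
  assumes "open S" "Ck_on S k f" "Ck_on S k g"
  shows "Ck_on S k (\<lambda>x. f x + g x)"
  using assms(2,3)
proof (induction k arbitrary: f g)
  case (Suc k)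
  show ?case
    by (rule Ck_on_SucI[OF assms(1) has_derivative_add[OF Ck_on_Suc_D[OF Suc.prems(1)] Ck_on_Suc_D[OF Suc.prems(2)]]])
       (use Suc in \<open>auto simp: partial_deriv_def[abs_def]\<close>)
qed (simp add: continuous_on_add)

lemma Ck_on_mult:
  assumes "open S" "Ck_on S k f" "Ck_on S k g"
  shows "Ck_on S k (\<lambda>x. f x * g x)"
  using assms(2,3)
proof (induction k arbitrary: f g)
  case (Suc k)
  show ?case
  proof (rule Ck_on_SucI[OF assms(1) has_derivative_mult[OF Ck_on_Suc_D[OF Suc.prems(1)] Ck_on_Suc_D[OF Suc.prems(2)]]])
    fix b :: 'a assume b: "b \<in> Basis"
    have "Ck_on S k f" "Ck_on S k g" using Suc.prems Ck_on_Suc_imp by blast+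
    moreover have "Ck_on S k (\<lambda>x. frechet_derivative f (at x) b)" "Ck_on S k (\<lambda>x. frechet_derivative g (at x) b)"
      using Suc.prems b by (auto simp: partial_deriv_def[abs_def])
    ultimately show "Ck_on S k (\<lambda>x. f x * frechet_derivative g (at x) b + frechet_derivative f (at x) b * g x)"
      using Suc.IH by (intro Ck_on_add assms)
  qed
qed (simp add: continuous_on_mult)

lemma Ck_on_compose:
  fixes g :: "real \<Rightarrow> real"
  assumes S: "open S" and T: "open T" and sub: "h ` S \<subseteq> T" and "Ck_on T k g" "Ck_on S k h"
  shows "Ck_on S k (\<lambda>x. g (h x))"
  using assms(4,5)
proof (induction k arbitrary: g)
  case 0
  then show ?case using sub by (auto intro: continuous_on_compose2)
next
  case (Suc k)
  show ?case
  proof (rule Ck_on_SucI[OF S has_derivative_compose[OF Ck_on_Suc_D[OF Suc.prems(2)] Ck_on_Suc_D[OF Suc.prems(1)]]])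
    show "h x \<in> T" if "x \<in> S" for x using sub that by auto
    fix b :: 'a assume b: "b \<in> Basis"
    have eq: "frechet_derivative g (at (h x)) (frechet_derivative h (at x) b)
        = partial_deriv 1 g (h x) * partial_deriv b h x" if "x \<in> S" for x
    proof -
      have "h x \<in> T" using sub that by auto
      then have "linear (frechet_derivative g (at (h x)))"
        using Suc.prems(1) by (intro linear_frechet_derivative) auto
      from linear_cmul[OF this, of "partial_deriv b h x" 1] show ?thesis by (simp add: partial_deriv_def)
    qed
    have "Ck_on S k (\<lambda>x. partial_deriv 1 g (h x))"
      using Suc.IH[of "partial_deriv 1 g"] Suc.prems Ck_on_Suc_imp[OF Suc.prems(2)] by auto
    moreover have "Ck_on S k (partial_deriv b h)" using Suc.prems b by auto
    ultimately have "Ck_on S k (\<lambda>x. partial_deriv 1 g (h x) * partial_deriv b h x)" by (rule Ck_on_mult[OF S])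
    then show "Ck_on S k (\<lambda>x. frechet_derivative g (at (h x)) (frechet_derivative h (at x) b))"
      by (rule Ck_on_cong[OF S, rotated]) (simp add: eq)
  qed auto
qed

lemma Ck_on_Un:
  assumes "open S" "open T" "Ck_on S k f" "Ck_on T k f"
  shows "Ck_on (S \<union> T) k f"
  using assms(3,4)
proof (induction k arbitrary: f)
  case 0 then show ?case using assms by (auto intro: continuous_on_open_Un)
qed auto

lemma Ck_on_inner: "Ck_on S k (\<lambda>x. x \<bullet> b)" if "open S"
proof (cases k)
  case (Suc m)
  show ?thesis unfolding Suc
    by (rule Ck_on_SucI[OF that, where D="\<lambda>x h. h \<bullet> b"]) (auto intro!: derivative_eq_intros Ck_on_const)
qed (auto intro!: continuous_intros)

lemma Ck_on_inner_self: "Ck_on S k (\<lambda>x. x \<bullet> x)" if "open S"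
proof (cases k)
  case (Suc m)
  show ?thesis unfolding Suc
  proof (rule Ck_on_SucI[OF that, where D="\<lambda>x h. 2 * (x \<bullet> h)"])
    show "((\<lambda>x. x \<bullet> x) has_derivative (\<lambda>h. 2 * (x \<bullet> h))) (at x)" for x :: 'a
      by (auto intro!: derivative_eq_intros simp: inner_commute)
  qed (intro Ck_on_mult Ck_on_const Ck_on_inner that)
qed (auto intro!: continuous_intros)

lemma Ck_on_ident: "Ck_on S k (\<lambda>x::real. x)" if "open S"
  using Ck_on_inner[OF that, of k "1::real"] by simp

lemma Ck_on_powr: "Ck_on {0<..} k (\<lambda>t::real. t powr a)"
proof (induction k arbitrary: a)
  case 0 then show ?case by (auto intro!: continuous_intros)
next
  case (Suc k)
  show ?case
    by (rule Ck_on_SucI_real[where f'="\<lambda>t. a * t powr (a - 1)"])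
       (auto intro!: derivative_eq_intros Ck_on_mult Ck_on_const Suc)
qed

text \<open>The family t^(-n) exp (-1/t), extended by 0 to t \<le> 0, is closed under differentiation up to linear
combinations; this makes the smoothness of its member n = 0 a one-line induction.\<close>

definition flat_exp :: "nat \<Rightarrow> real \<Rightarrow> real" where
  "flat_exp n t = (if t > 0 then (1/t)^n * exp (-(1/t)) else 0)"

lemma flat_exp_tendsto_0: "(flat_exp n \<longlongrightarrow> 0) (at 0)"
proof -
  have "((\<lambda>t::real. (1/t)^n * exp (-(1/t))) \<longlongrightarrow> 0) (at_right 0)"
  proof (rule filterlim_compose[of "\<lambda>u. u^n * exp (-u)" _ at_top])
    show "((\<lambda>u::real. u^n * exp (-u)) \<longlongrightarrow> 0) at_top"
      using tendsto_power_div_exp_0[of n] by (simp add: exp_minus divide_inverse)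
    show "filterlim (\<lambda>t::real. 1/t) at_top (at_right 0)" by real_asymp
  qed
  then have "(flat_exp n \<longlongrightarrow> 0) (at_right 0)"
    by (rule Lim_transform_eventually)
       (auto simp: flat_exp_def eventually_at_right_field intro!: exI[of _ 1])
  moreover have "(flat_exp n \<longlongrightarrow> 0) (at_left 0)"
    by (rule tendsto_eventually) (auto simp: flat_exp_def eventually_at_left_field intro!: exI[of _ "-1"])
  ultimately show ?thesis by (simp add: filterlim_at_split)
qed

lemma flat_exp_deriv:
  "(flat_exp n has_real_derivative (flat_exp (n+2) t - n * flat_exp (Suc n) t)) (at t)"
proof (cases "t = 0")
  case True
  have "((\<lambda>h. flat_exp (Suc n) h) \<longlongrightarrow> 0) (at 0)" by (rule flat_exp_tendsto_0)
  then have "((\<lambda>h. (flat_exp n (0 + h) - flat_exp n 0) / h) \<longlongrightarrow> 0) (at 0)"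
    by (rule Lim_transform_eventually) (auto simp: flat_exp_def intro!: always_eventually)
  then show ?thesis unfolding True DERIV_def by (simp add: flat_exp_def)
next
  case False
  then consider "t > 0" | "t < 0" by linarith
  then show ?thesis
  proof cases
    case 1
    have "((\<lambda>t. (1/t)^n * exp (-(1/t))) has_real_derivative
        (flat_exp (n+2) t - n * flat_exp (Suc n) t)) (at t)"
    proof -
      have u: "((\<lambda>t. 1/t) has_real_derivative - (1/t) * (1/t)) (at t)"
        using 1 by (auto intro!: derivative_eq_intros)
      have "((\<lambda>t. exp (-(1/t))) has_real_derivative exp (-(1/t)) * - (- (1/t) * (1/t))) (at t)"
        by (rule DERIV_chain2[OF DERIV_exp DERIV_minus[OF u]])
      from DERIV_mult[OF DERIV_power[OF u, of n] this] show ?thesis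
        by (rule DERIV_cong) (use 1 in \<open>cases n; simp add: flat_exp_def algebra_simps\<close>)
    qed
    then show ?thesis
      by (rule has_field_derivative_transform_within_open[where S="{0<..}"]) (use 1 in \<open>auto simp: flat_exp_def\<close>)
  next
    case 2
    have "((\<lambda>t::real. 0) has_real_derivative (flat_exp (n+2) t - n * flat_exp (Suc n) t)) (at t)"
      using 2 by (simp add: flat_exp_def)
    then show ?thesis
      by (rule has_field_derivative_transform_within_open[where S="{..<0}"]) (use 2 in \<open>auto simp: flat_exp_def\<close>)
  qed
qed

lemma Ck_on_flat_exp: "Ck_on UNIV k (flat_exp n)"
proof (induction k arbitrary: n)
  case 0
  show ?case by (auto intro!: continuous_at_imp_continuous_on DERIV_isCont[OF flat_exp_deriv])
next
  case (Suc k)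
  have "Ck_on UNIV k (\<lambda>t. flat_exp (n+2) t + (- real n) * flat_exp (Suc n) t)"
    by (intro Ck_on_add Ck_on_mult Ck_on_const Suc open_UNIV)
  then show ?case
    by (intro Ck_on_SucI_real[OF open_UNIV flat_exp_deriv]) simp
qed

text \<open>As n grows, \<open>n (t - a) (b - t)\<close> tends to infinity on (a, b), where exp (-1/x) therefore tends to 1; so these are
smooth approximations from below of the indicator function of the open interval.\<close>

definition bump :: "real \<Rightarrow> real \<Rightarrow> nat \<Rightarrow> real \<Rightarrow> real" where
  "bump a b n t = flat_exp 0 (real n * ((t - a) * (b - t)))"

lemma Ck_on_bump: "Ck_on UNIV k (bump a b n)"
proof -
  have "Ck_on UNIV k (\<lambda>t. real n * ((t + (- a)) * (b + (-1) * t)))"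
    by (intro Ck_on_add Ck_on_mult Ck_on_const Ck_on_ident open_UNIV)
  from Ck_on_compose[OF open_UNIV open_UNIV _ Ck_on_flat_exp this] show ?thesis
    by (simp add: bump_def[abs_def])
qed

lemma bump_outside: "t \<le> a \<or> b \<le> t \<Longrightarrow> a < b \<Longrightarrow> bump a b n t = 0"
  by (auto simp: bump_def flat_exp_def zero_less_mult_iff)

lemma bump_bounds: "0 \<le> bump a b n t" "bump a b n t \<le> 1"
  by (auto simp: bump_def flat_exp_def)

lemma bump_tendsto_indicator: "a < b \<Longrightarrow> (\<lambda>n. bump a b n t) \<longlonglongrightarrow> indicator {a<..<b} t"
proof (cases "a < t \<and> t < b")
  case True
  define c where "c = (t - a) * (b - t)"
  have c: "c > 0" using True by (simp add: c_def)
  have "(\<lambda>n. exp (-(1/(real n * c)))) \<longlonglongrightarrow> 1" using c by real_asymp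
  moreover have "\<forall>\<^sub>F n in sequentially. exp (-(1/(real n * c))) = bump a b n t"
    by (rule eventually_mono[OF eventually_gt_at_top[of 0]])
       (use c in \<open>simp add: bump_def flat_exp_def c_def\<close>)
  ultimately show ?thesis using True Lim_transform_eventually by (fastforce simp: indicator_def)
qed (auto simp: bump_outside indicator_def)

text \<open>Integrating from 0 gives an antiderivative on the whole line only because the integrand vanishes
to the right of 0 as well: the integral over {0..r} is 0 for negative r.\<close>

lemma antiderivative_vanishing:
  fixes \<beta> :: "real \<Rightarrow> real"
  assumes \<beta>: "continuous_on UNIV \<beta>" and a: "0 < a" "\<And>t. t \<le> a \<Longrightarrow> \<beta> t = 0"
  shows "((\<lambda>r. integral {0..r} \<beta>) has_real_derivative \<beta> r) (at r)"
    and "r \<le> a \<Longrightarrow> integral {0..r} \<beta> = 0"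
proof -
  show z: "integral {0..r} \<beta> = 0" if "r \<le> a" for r
  proof -
    have "integral {0..r} \<beta> = integral {0..r} (\<lambda>_. 0)"
      by (rule Henstock_Kurzweil_Integration.integral_cong) (use a that in auto)
    then show ?thesis by simp
  qed
  show "((\<lambda>r. integral {0..r} \<beta>) has_real_derivative \<beta> r) (at r)"
  proof (cases "0 < r")
    case True
    have "((\<lambda>u. integral {0..u} \<beta>) has_real_derivative \<beta> r) (at r within {0..r+1})"
      by (rule integral_has_real_derivative) (use True \<beta> in \<open>auto intro: continuous_on_subset\<close>)
    moreover have "at r within {0..r+1} = at r"
      by (rule at_within_interior) (use True in auto)
    ultimately show ?thesis by simp
  next
    case False
    have "((\<lambda>r. 0::real) has_real_derivative \<beta> r) (at r)" using a False by simp
    then show ?thesis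
      by (rule has_field_derivative_transform_within_open[where S="{..<a}"]) (use a False z in auto)
  qed
qed

text \<open>For a radial function k(|x|) the Laplacian is (r^2 k')' / r^2.  Prescribing r^2 k' as an
antiderivative B of a function beta with mean zero, supported in (a, b), gives a test function
that is constant near the origin.  Tests of this kind see the first integral of the equation,
r^2 u' = \<integral> t^2 w, together with its boundary value 0 at the origin; this excludes solutions that behave like
1/r there.  For the smoothness at 0 it is convenient to write k(|x|) as psi(x \<bullet> x).\<close>

lemma radial_test_function:
  fixes \<beta> :: "real \<Rightarrow> real"
  assumes smooth: "\<And>k. Ck_on UNIV k \<beta>" and ab: "0 < a" "a < b"
    and supp: "\<And>t. t \<le> a \<or> b \<le> t \<Longrightarrow> \<beta> t = 0" and mean: "integral {0..b} \<beta> = 0"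
  obtains \<phi> :: "real^3 \<Rightarrow> real" and \<kappa> where "test_function \<phi>"
    "\<And>x. \<phi> x = \<kappa> (norm x)" "continuous_on UNIV \<kappa>" "\<And>r. b \<le> r \<Longrightarrow> \<kappa> r = 0"
    "\<And>r. 0 < r \<Longrightarrow> (\<kappa> has_real_derivative integral {0..r} \<beta> / r\<^sup>2) (at r)"
    "\<And>x. x \<noteq> 0 \<Longrightarrow> laplacian \<phi> x = \<beta> (norm x) / (norm x)\<^sup>2"
proof -
  define B where "B r = integral {0..r} \<beta>" for r
  have \<beta>_cont: "continuous_on UNIV \<beta>" using smooth[of 0] by simp
  have DB: "(B has_real_derivative \<beta> r) (at r)" for r
    unfolding B_def[abs_def] by (rule antiderivative_vanishing(1)[OF \<beta>_cont ab(1)]) (use supp in auto)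
  have B0: "B r = 0" if "r \<le> a" for r
    unfolding B_def by (rule antiderivative_vanishing(2)[OF \<beta>_cont ab(1) _ that]) (use supp in auto)
  have Bb: "B r = 0" if "b \<le> r" for r
  proof -
    have "B r = B b"
    proof (cases "b < r")
      case True
      show ?thesis
      proof (rule DERIV_isconst_end[OF True])
        show "continuous_on {b..r} B"
          by (rule DERIV_at_imp_continuous_on) (rule DB)
        show "(B has_real_derivative 0) (at x)" if "b < x" "x < r" for x
          using DB[of x] supp[of x] that by simp
      qed
    qed (use that in simp)
    then show ?thesis using mean by (simp add: B_def)
  qed
  have Ck_B: "Ck_on UNIV k B" for k
    by (rule Ck_on_Suc_imp, rule Ck_on_SucI_real[OF open_UNIV DB smooth])
  \<comment> \<open>e (r^2) is B(r) / r^3, the derivative of k divided by r, as a function of the squared norm.\<close>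
  define e where "e t = (if t > 0 then B (t powr (1/2)) * t powr (-3/2) else 0)" for t
  have e_zero: "e t = 0" if "t < a\<^sup>2 \<or> b\<^sup>2 \<le> t" for t
  proof (cases "t > 0")
    case True
    have "sqrt t \<le> a \<or> b \<le> sqrt t"
      using that ab by (auto simp: real_le_rsqrt intro: less_imp_le real_less_lsqrt[THEN less_imp_le])
    then show ?thesis using True B0 Bb by (auto simp: e_def powr_half_sqrt)
  qed (simp add: e_def)
  have Ck_e: "Ck_on UNIV k e" for k
  proof -
    have "Ck_on {0<..} k (\<lambda>t. B (t powr (1/2)) * t powr (-3/2))"
      by (intro Ck_on_mult Ck_on_compose[OF _ open_UNIV _ Ck_B] Ck_on_powr) auto
    then have "Ck_on {0<..} k e"
      by (rule Ck_on_cong[rotated 2]) (auto simp: e_def)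
    moreover have "Ck_on {..<a\<^sup>2} k e"
      by (rule Ck_on_cong[OF _ _ Ck_on_const[of _ _ 0]]) (use e_zero in auto)
    ultimately have "Ck_on ({0<..} \<union> {..<a\<^sup>2}) k e" by (intro Ck_on_Un) auto
    moreover have "{0<..} \<union> {..<a\<^sup>2} = UNIV" using ab by (auto simp: not_less) (smt (verit) zero_less_power)
    ultimately show ?thesis by simp
  qed
  have e_cont: "continuous_on UNIV e" using Ck_e[of 0] by simp
  \<comment> \<open>Any positive threshold below the square of a serves here; e is known to vanish strictly below that square.\<close>
  define A where "A = a\<^sup>2/2"
  have A: "0 < A" "\<And>t. t \<le> A \<Longrightarrow> e t = 0" proof -
    have "0 < a\<^sup>2" using ab by simp
    then show "0 < A" by (simp add: A_def)
    show "e t = 0" if "t \<le> A" for t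
      by (rule e_zero) (use that \<open>0 < a\<^sup>2\<close> in \<open>unfold A_def, linarith\<close>)
  qed
  define \<psi> where "\<psi> t = (integral {0..t} e - integral {0..b\<^sup>2} e) / 2" for t
  have D\<psi>: "(\<psi> has_real_derivative e t / 2) (at t)" for t
    unfolding \<psi>_def[abs_def]
    by (auto intro!: derivative_eq_intros antiderivative_vanishing(1)[OF e_cont A])
  have \<psi>_zero: "\<psi> t = 0" if "b\<^sup>2 \<le> t" for t
  proof -
    have "\<psi> t = \<psi> (b\<^sup>2)"
    proof (cases "b\<^sup>2 < t")
      case True
      show ?thesis
      proof (rule DERIV_isconst_end[OF True])
        show "continuous_on {b\<^sup>2..t} \<psi>"
          by (rule DERIV_at_imp_continuous_on) (rule D\<psi>)
        show "(\<psi> has_real_derivative 0) (at x)" if "b\<^sup>2 < x" "x < t" for x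
          using D\<psi>[of x] e_zero[of x] that by simp
      qed
    qed (use that in simp)
    then show ?thesis by (simp add: \<psi>_def)
  qed
  define \<phi> :: "real^3 \<Rightarrow> real" where "\<phi> x = \<psi> (x \<bullet> x)" for x
  define \<kappa> where "\<kappa> r = \<psi> (r\<^sup>2)" for r
  have D\<phi>: "(\<phi> has_derivative (\<lambda>h. e (x \<bullet> x) * (x \<bullet> h))) (at x)" for x
  proof -
    have "((\<lambda>x. x \<bullet> x) has_derivative (\<lambda>h. 2 * (x \<bullet> h))) (at x)"
      by (auto intro!: derivative_eq_intros simp: inner_commute)
    from has_derivative_compose[OF this D\<psi>[of "x \<bullet> x", unfolded has_field_derivative_def]]
    show ?thesis by (simp add: \<phi>_def[abs_def] mult_ac)
  qed
  have p\<phi>: "partial_deriv c \<phi> = (\<lambda>x. e (x \<bullet> x) * (x \<bullet> c))" for c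
    by (rule ext, rule partial_deriv_eq[OF D\<phi>])
  have Ck_e2: "Ck_on UNIV k (\<lambda>x::real^3. e (x \<bullet> x))" for k
    by (rule Ck_on_compose[OF _ open_UNIV _ Ck_e Ck_on_inner_self]) auto
  have Ck_\<phi>: "Ck_on UNIV k \<phi>" for k
    by (rule Ck_on_Suc_imp, rule Ck_on_SucI[OF open_UNIV D\<phi>])
       (intro Ck_on_mult Ck_e2 Ck_on_inner open_UNIV)
  have "test_function \<phi>"
    unfolding test_function_def
  proof
    show "\<forall>k. Ck k \<phi>" using Ck_\<phi> by (simp add: Ck_iff_Ck_on)
    have "{x. \<phi> x \<noteq> 0} \<subseteq> cball 0 b"
    proof
      fix x :: "real^3" assume "x \<in> {x. \<phi> x \<noteq> 0}"
      then have "x \<bullet> x < b\<^sup>2" using \<psi>_zero[of "x \<bullet> x"] by (fastforce simp: \<phi>_def)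
      then have "(norm x)\<^sup>2 \<le> b\<^sup>2" by (simp add: power2_norm_eq_inner)
      then show "x \<in> cball 0 b" using ab abs_le_square_iff[of "norm x" b] by simp
    qed
    then have "bounded {x. \<phi> x \<noteq> 0}" by (rule bounded_subset[OF bounded_cball])
    then show "compact (closure {x. \<phi> x \<noteq> 0})" by simp
  qed
  moreover have "\<phi> x = \<kappa> (norm x)" for x
    by (simp add: \<phi>_def \<kappa>_def power2_norm_eq_inner)
  moreover have "continuous_on UNIV \<kappa>"
  proof -
    have "continuous_on UNIV \<psi>" by (rule DERIV_at_imp_continuous_on) (rule D\<psi>)
    then show ?thesis unfolding \<kappa>_def[abs_def]
      by (rule continuous_on_compose2) (auto intro!: continuous_intros)
  qed
  moreover have "\<kappa> r = 0" if "b \<le> r" for r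
    unfolding \<kappa>_def by (rule \<psi>_zero) (use that ab in \<open>auto intro!: power_mono\<close>)
  moreover have e_sq: "e (r\<^sup>2) = B r / r^3" if "0 < r" for r
  proof -
    have "(r\<^sup>2) powr (1/2) = r" "(r\<^sup>2) powr (-3/2) = 1 / r^3"
      using that by (simp_all add: powr_half_sqrt powr_powr powr_minus_divide flip: powr_numeral)
    then show ?thesis using that by (simp add: e_def)
  qed
  moreover have "(\<kappa> has_real_derivative integral {0..r} \<beta> / r\<^sup>2) (at r)" if "0 < r" for r
  proof -
    have "(\<kappa> has_real_derivative e (r\<^sup>2) / 2 * (2 * r)) (at r)"
      unfolding \<kappa>_def[abs_def] by (rule DERIV_chain2[OF D\<psi>]) (auto intro!: derivative_eq_intros)
    then show ?thesis unfolding e_sq[OF that] B_def using that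
      by (simp add: power2_eq_square power3_eq_cube)
  qed
  moreover have "laplacian \<phi> x = \<beta> (norm x) / (norm x)\<^sup>2" if x: "x \<noteq> 0" for x
  proof -
    define r where "r = norm x"
    have r: "r > 0" "x \<bullet> x = r\<^sup>2" using x by (auto simp: r_def power2_norm_eq_inner)
    define e1 where "e1 = \<beta> r / (2 * r^4) - 3 / 2 * B r / r^5"
    have De: "(e has_real_derivative e1) (at (r\<^sup>2))"
    proof -
      have sq: "(sqrt has_real_derivative 1 / (2 * r)) (at (r\<^sup>2))"
        using DERIV_real_sqrt[of "r\<^sup>2"] r by (simp add: field_simps)
      have "(sqrt (r\<^sup>2)) ^ 3 \<noteq> 0" using r by simp
      from DERIV_divide[OF DERIV_chain2[OF DB sq] DERIV_power[OF sq, of 3] this]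
      have "((\<lambda>t. B (sqrt t) / (sqrt t)^3) has_real_derivative e1) (at (r\<^sup>2))"
        by (rule DERIV_cong) (use r in \<open>simp add: e1_def field_simps power_numeral_reduce\<close>)
      then show ?thesis
      proof (rule has_field_derivative_transform_within_open[where S="{0<..}"])
        fix t :: real assume "t \<in> {0<..}"
        then show "B (sqrt t) / (sqrt t)^3 = e t" using e_sq[of "sqrt t"] by simp
      qed (use r in auto)
    qed
    have pp: "partial_deriv c (partial_deriv c \<phi>) x = e1 * 2 * (x \<bullet> c)\<^sup>2 + e (r\<^sup>2)" if "c \<in> Basis" for c
    proof -
      have "((\<lambda>x. x \<bullet> x) has_derivative (\<lambda>h. 2 * (x \<bullet> h))) (at x)"
        by (auto intro!: derivative_eq_intros simp: inner_commute)
      from has_derivative_compose[OF this De[folded r(2), unfolded has_field_derivative_def]]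
      have D: "((\<lambda>x. e (x \<bullet> x)) has_derivative (\<lambda>h. e1 * (2 * (x \<bullet> h)))) (at x)"
        by simp
      have "((\<lambda>x. x \<bullet> c) has_derivative (\<lambda>h. h \<bullet> c)) (at x)" by (auto intro!: derivative_eq_intros)
      from partial_deriv_eq[OF has_derivative_mult[OF D this], of c] that
      show ?thesis unfolding p\<phi> by (simp add: power2_eq_square r(2) algebra_simps)
    qed
    have "laplacian \<phi> x = (\<Sum>c\<in>Basis. e1 * 2 * (x \<bullet> c)\<^sup>2 + e (r\<^sup>2))"
      unfolding laplacian_def using pp by (intro sum.cong) auto
    also have "\<dots> = e1 * 2 * (\<Sum>c\<in>Basis. (x \<bullet> c)\<^sup>2) + 3 * e (r\<^sup>2)"
      by (simp add: sum.distrib sum_distrib_left)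
    also have "(\<Sum>c\<in>Basis. (x \<bullet> c)\<^sup>2) = r\<^sup>2"
      using r(2) euclidean_inner[of x x] by (simp add: power2_eq_square)
    finally show ?thesis using r(1) unfolding e_sq[OF r(1)] e1_def r_def[symmetric]
      by (simp add: field_simps power_numeral_reduce)
  qed
  ultimately show ?thesis using that by blast
qed

section \<open>Radial functions and the distribution of the norm\<close>

definition radial_weight :: "real \<Rightarrow> real" where
  "radial_weight r = (if r > 0 then 4 * pi * r\<^sup>2 else 0)"

lemma radial_weight_measurable [measurable]: "radial_weight \<in> borel_measurable borel"
  unfolding radial_weight_def[abs_def] by measurable

lemma radial_weight_nonneg: "0 \<le> radial_weight r"
  by (simp add: radial_weight_def)

text \<open>Integration in polar coordinates for radial functions: both measures agree on the half-lines
{..a}, by the volume of a ball.\<close>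

lemma distr_norm: "distr lborel borel (norm :: real^3 \<Rightarrow> real) = density lborel radial_weight"
proof (rule measure_eqI_generator_eq[where E="range (\<lambda>a::real. {..a})" and \<Omega>=UNIV and A="\<lambda>n. {..real n}"])
  show "Int_stable (range (\<lambda>a::real. {..a}))" by (auto simp: Int_stable_def)
  have borel: "sets borel = sigma_sets UNIV (range (\<lambda>a::real. {..a}))"
    by (subst borel_eq_atMost) simp
  then show "sets (distr lborel borel (norm :: real^3 \<Rightarrow> real)) = sigma_sets UNIV (range (\<lambda>a. {..a}))"
    by simp
  show "sets (density lborel radial_weight) = sigma_sets UNIV (range (\<lambda>a. {..a}))"
    using borel by simp
  show "(\<Union>i. {..real i}) = UNIV" by (auto intro: real_arch_simple)
  have L: "emeasure (distr lborel borel (norm :: real^3 \<Rightarrow> real)) {..a} = ennreal (4 / 3 * pi * (max 0 a)^3)" for a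
  proof (cases "a < 0")
    case True
    then have "\<not> norm x \<le> a" for x :: "real^3" using norm_ge_zero[of x] by linarith
    then have "(norm :: real^3 \<Rightarrow> real) -` {..a} = {}" by auto
    then show ?thesis using True by (simp add: emeasure_distr)
  next
    case False
    have "(norm :: real^3 \<Rightarrow> real) -` {..a} = cball 0 a" by auto
    then show ?thesis using False
      by (simp add: emeasure_distr emeasure_cball unit_ball_vol_3)
  qed
  have R: "emeasure (density lborel radial_weight) {..a} = ennreal (4 / 3 * pi * (max 0 a)^3)" for a
  proof -
    have "emeasure (density lborel radial_weight) {..a} = (\<integral>\<^sup>+ r. ennreal (radial_weight r) * indicator {..a} r \<partial>lborel)"
      by (simp add: emeasure_density)
    also have "\<dots> = (\<integral>\<^sup>+ r. ennreal (4 * pi * r\<^sup>2) * indicator {0..max 0 a} r \<partial>lborel)"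
      by (intro nn_integral_cong) (auto simp: radial_weight_def indicator_def not_less max_def)
    also have "\<dots> = ennreal (4 / 3 * pi * (max 0 a)^3 - 4 / 3 * pi * 0^3)"
      by (rule nn_integral_FTC_Icc) (auto intro!: derivative_eq_intros)
    finally show ?thesis by simp
  qed
  show "emeasure (distr lborel borel (norm :: real^3 \<Rightarrow> real)) X = emeasure (density lborel radial_weight) X"
    if "X \<in> range (\<lambda>a. {..a})" for X
    using that L R by auto
  show "emeasure (distr lborel borel (norm :: real^3 \<Rightarrow> real)) {..real i} \<noteq> \<infinity>" for i
    unfolding L by simp
qed auto

lemma integral_radial:
  fixes f :: "real \<Rightarrow> real"
  assumes [measurable]: "f \<in> borel_measurable borel"
  shows "integral\<^sup>L lborel (\<lambda>x::real^3. f (norm x)) = (\<integral>r. radial_weight r * f r \<partial>lborel)"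
proof -
  have "integral\<^sup>L lborel (\<lambda>x::real^3. f (norm x)) = integral\<^sup>L (distr lborel borel (norm :: real^3 \<Rightarrow> real)) f"
    by (subst integral_distr) auto
  then show ?thesis unfolding distr_norm
    by (subst (asm) integral_density) (auto simp: radial_weight_nonneg)
qed

lemma integrable_radial:
  fixes f :: "real \<Rightarrow> real"
  assumes [measurable]: "f \<in> borel_measurable borel"
  shows "integrable lborel (\<lambda>x::real^3. f (norm x)) \<longleftrightarrow> integrable lborel (\<lambda>r. radial_weight r * f r)"
proof -
  have "integrable lborel (\<lambda>x::real^3. f (norm x)) \<longleftrightarrow> integrable (distr lborel borel (norm :: real^3 \<Rightarrow> real)) f"
    by (subst integrable_distr_eq) auto
  then show ?thesis unfolding distr_norm
    by (subst (asm) integrable_density) (auto simp: radial_weight_nonneg)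
qed

lemma AE_radial_iff:
  assumes [measurable]: "Measurable.pred borel Q"
  shows "(AE x::real^3 in lborel. Q (norm x)) \<longleftrightarrow> (AE r in lborel. 0 < r \<longrightarrow> Q r)"
proof -
  have "(AE x::real^3 in lborel. Q (norm x)) \<longleftrightarrow> (AE r in distr lborel borel (norm :: real^3 \<Rightarrow> real). Q r)"
    by (subst AE_distr_iff) auto
  also have "\<dots> \<longleftrightarrow> (AE r in lborel. 0 < r \<longrightarrow> Q r)"
    unfolding distr_norm by (subst AE_density) (auto simp: radial_weight_def ennreal_zero_less_mult_iff split: if_splits intro!: AE_cong)
  finally show ?thesis .
qed

lemma AE_lborel_E:
  assumes "AE x in lborel. P x"
  obtains N where "N \<in> null_sets lborel" "\<And>x. x \<notin> N \<Longrightarrow> P x"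
proof (rule AE_E3[OF assms])
  fix N assume a: "\<And>x. x \<in> space lborel - N \<Longrightarrow> P x" and n: "N \<in> null_sets lborel"
  show thesis by (rule that[OF n]) (rule a, simp)
qed

lemma AE_radial:
  assumes "AE r in lborel. 0 < r \<longrightarrow> Q r"
  shows "AE x::real^3 in lborel. Q (norm x)"
proof -
  obtain N where N: "N \<in> null_sets lborel" "\<And>r. r \<notin> N \<Longrightarrow> 0 < r \<longrightarrow> Q r"
    by (rule AE_lborel_E[OF assms], rule that)
  have [measurable]: "N \<in> sets borel" using N(1) by auto
  have "AE r in lborel. 0 < r \<longrightarrow> r \<notin> N" using AE_not_in[OF N(1)] by eventually_elim auto
  then have "AE x::real^3 in lborel. norm x \<notin> N" by (subst AE_radial_iff) auto
  moreover have "AE x::real^3 in lborel. x \<noteq> 0" by (rule AE_lborel_singleton)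
  ultimately show ?thesis by eventually_elim (use N(2) in auto)
qed

lemma AE_scaleR:
  fixes c :: real
  assumes "c \<noteq> 0" and Q: "AE x::'a::euclidean_space in lborel. Q x"
  shows "AE x in lborel. Q (c *\<^sub>R x)"
proof -
  obtain N where N: "N \<in> null_sets lborel" "\<And>x. x \<notin> N \<Longrightarrow> Q x"
    by (rule AE_lborel_E[OF Q], rule that)
  have [measurable]: "N \<in> sets borel" using N(1) by auto
  have "AE x in density (distr lborel borel (\<lambda>x::'a. 0 + c *\<^sub>R x)) (\<lambda>_. \<bar>c\<bar>^DIM('a)). x \<notin> N"
    by (rule subst[OF lborel_affine[OF assms(1), of "0::'a"], of "\<lambda>M. AE x in M. x \<notin> N"])
       (rule AE_not_in[OF N(1)])
  then have "AE x in distr lborel borel (\<lambda>x::'a. 0 + c *\<^sub>R x). x \<notin> N"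
    using assms(1) by (subst (asm) AE_density) auto
  from AE_distrD[OF _ this] have "AE x in lborel. c *\<^sub>R x \<notin> (N::'a set)" by simp
  then show ?thesis by eventually_elim (use N(2) in auto)
qed

text \<open>The profile of a function that is radial almost everywhere need not be measurable as given.
Since the exceptional set N is null, so is every dilate of N, and by Fubini almost every ray through the
origin meets N in a null set.  The restriction of u to one such ray is a Borel profile.\<close>

lemma radial_borel_profile:
  fixes u :: "real^3 \<Rightarrow> real"
  assumes [measurable]: "u \<in> borel_measurable borel" and g: "AE x in lborel. u x = g (norm x)"
  obtains g' where "g' \<in> borel_measurable borel" "AE x in lborel. u x = g' (norm x)"
proof -
  obtain N where N: "N \<in> null_sets lborel" "\<And>x. x \<notin> N \<Longrightarrow> u x = g (norm x)"
    by (rule AE_lborel_E[OF g], rule that)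
  have N_meas [measurable]: "N \<in> sets borel" using N(1) by auto
  have "AE r::real in lborel. AE x in lborel. r \<le> 0 \<or> r *\<^sub>R x \<notin> N"
  proof (rule AE_I2)
    fix r :: real
    show "AE x in lborel. r \<le> 0 \<or> r *\<^sub>R x \<notin> N"
    proof (cases "r \<le> 0")
      case False
      then have "AE x in lborel. r *\<^sub>R x \<notin> N" by (intro AE_scaleR AE_not_in[OF N(1)]) auto
      then show ?thesis by eventually_elim auto
    qed auto
  qed
  moreover have "{z \<in> space (lborel \<Otimes>\<^sub>M lborel). fst z \<le> 0 \<or> fst z *\<^sub>R snd z \<notin> N}
      \<in> sets (lborel \<Otimes>\<^sub>M (lborel :: (real^3) measure))"
    by measurable
  ultimately have "AE x in lborel. AE r::real in lborel. r \<le> 0 \<or> r *\<^sub>R x \<notin> N"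
    by (subst (asm) lborel_pair.AE_commute)
  then have "AE x in lborel. x \<noteq> 0 \<and> (AE r::real in lborel. r \<le> 0 \<or> r *\<^sub>R x \<notin> N)"
    using AE_lborel_singleton[of "0::real^3"] by eventually_elim auto
  moreover have "ae_filter (lborel :: (real^3) measure) \<noteq> bot"
    by (simp add: ae_filter_eq_bot_iff)
  ultimately obtain e where e: "e \<noteq> 0" "AE r::real in lborel. r \<le> 0 \<or> r *\<^sub>R e \<notin> N"
    using eventually_happens'[of "ae_filter (lborel :: (real^3) measure)"] by blast
  define g' where "g' r = u ((r / norm e) *\<^sub>R e)" for r
  have "AE r::real in lborel. (1 / norm e) *\<^sub>R r \<le> 0 \<or> ((1 / norm e) *\<^sub>R r) *\<^sub>R e \<notin> N"
    by (rule AE_scaleR[OF _ e(2)]) (use e(1) in simp)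
  then have "AE r in lborel. 0 < r \<longrightarrow> (r / norm e) *\<^sub>R e \<notin> N"
    by eventually_elim (use e(1) in \<open>auto simp: divide_le_0_iff\<close>)
  then have "AE x::real^3 in lborel. (norm x / norm e) *\<^sub>R e \<notin> N" by (rule AE_radial)
  then have "AE x in lborel. u x = g' (norm x)"
    using AE_not_in[OF N(1)]
  proof eventually_elim
    case (elim x)
    then have "u x = g (norm x)" "g' (norm x) = g (norm ((norm x / norm e) *\<^sub>R e))"
      using N(2) by (auto simp: g'_def)
    then show ?case using e(1) by simp
  qed
  moreover have "g' \<in> borel_measurable borel" unfolding g'_def[abs_def] by measurable
  ultimately show ?thesis using that by blast
qed

text \<open>The positive and the negative part define finite measures that agree on the half-lines {x<..}.\<close>

lemma AE_zero_of_ray_integrals: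
  fixes f :: "real \<Rightarrow> real"
  assumes f: "integrable lborel f" and z: "\<And>x. (\<integral>t. indicator {x<..} t * f t \<partial>lborel) = 0"
  shows "AE t in lborel. f t = 0"
proof -
  have [measurable]: "f \<in> borel_measurable lborel" using f by auto
  let ?p = "\<lambda>t. max 0 (f t)" and ?n = "\<lambda>t. max 0 (- f t)"
  have ip: "integrable lborel (\<lambda>t. indicator {x<..} t * ?p t)" and
       in_: "integrable lborel (\<lambda>t. indicator {x<..} t * ?n t)" for x
    by (rule Bochner_Integration.integrable_bound[OF f]; auto simp: indicator_def)+
  have eq: "(\<integral>t. indicator {x<..} t * ?p t \<partial>lborel) = (\<integral>t. indicator {x<..} t * ?n t \<partial>lborel)" for x
  proof -
    have "(\<integral>t. indicator {x<..} t * ?p t \<partial>lborel) - (\<integral>t. indicator {x<..} t * ?n t \<partial>lborel)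
      = (\<integral>t. indicator {x<..} t * ?p t - indicator {x<..} t * ?n t \<partial>lborel)"
      by (rule Bochner_Integration.integral_diff[symmetric, OF ip in_])
    also have "\<dots> = (\<integral>t. indicator {x<..} t * f t \<partial>lborel)"
      by (intro Bochner_Integration.integral_cong) (auto simp: max_def indicator_def)
    finally show ?thesis using z by simp
  qed
  have em: "emeasure (density lborel (\<lambda>t. ennreal (h t))) {x<..} = ennreal (\<integral>t. indicator {x<..} t * h t \<partial>lborel)"
    if "integrable lborel (\<lambda>t. indicator {x<..} t * h t)" "\<And>t. 0 \<le> h t" "h \<in> borel_measurable lborel" for h :: "real \<Rightarrow> real" and x
  proof -
    have "emeasure (density lborel (\<lambda>t. ennreal (h t))) {x<..} = (\<integral>\<^sup>+t. ennreal (indicator {x<..} t * h t) \<partial>lborel)"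
      using that(3) by (subst emeasure_density) (auto intro!: nn_integral_cong simp: indicator_def)
    then show ?thesis using that(1,2) by (subst (asm) nn_integral_eq_integral) auto
  qed
  have "density lborel (\<lambda>t. ennreal (?p t)) = density lborel (\<lambda>t. ennreal (?n t))"
  proof (rule measure_eqI_lessThan)
    fix x
    show "emeasure (density lborel (\<lambda>t. ennreal (?p t))) {x<..} < \<infinity>"
      using em[OF ip] by simp
    show "emeasure (density lborel (\<lambda>t. ennreal (?p t))) {x<..} = emeasure (density lborel (\<lambda>t. ennreal (?n t))) {x<..}"
      using em[OF ip] em[OF in_] eq by simp
  qed auto
  then have "AE t in lborel. ennreal (?p t) = ennreal (?n t)"
    by (subst (asm) sigma_finite_measure.density_unique_iff[OF sigma_finite_lborel]) auto
  then show ?thesis by eventually_elim (auto simp: max_def split: if_splits)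
qed

section \<open>Radial weak solutions are classical\<close>

text \<open>The test functions have mean zero, so only constancy can be concluded.  Combinations of two bump
functions approximate the normalized indicator of (a, b) minus that of (1, 2); hence all means of
T agree with its mean over (1, 2).\<close>

lemma du_bois_reymond:
  fixes T :: "real \<Rightarrow> real"
  assumes [measurable]: "T \<in> borel_measurable borel"
    and loc: "\<And>a b. 0 < a \<Longrightarrow> set_integrable lborel {a..b} T"
    and orth: "\<And>\<beta> a b. 0 < a \<Longrightarrow> a < b \<Longrightarrow> (\<And>k. Ck_on UNIV k \<beta>) \<Longrightarrow>
      (\<And>t. t \<le> a \<or> b \<le> t \<Longrightarrow> \<beta> t = 0) \<Longrightarrow> integral {0..b} \<beta> = 0 \<Longrightarrow>
      integral\<^sup>L lborel (\<lambda>t. \<beta> t * T t) = 0"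
  obtains c where "AE r in lborel. 0 < r \<longrightarrow> T r = c"
proof -
  have bump_meas [measurable]: "bump a b n \<in> borel_measurable borel" for a b n
    by (rule borel_measurable_continuous_onI) (use Ck_on_bump[of 0] in simp)
  have loc': "integrable lborel (\<lambda>t. indicator {a..b} t * T t)" if "0 < a" for a b
    using loc[OF that, of b] by (simp add: set_integrable_def)
  have bT: "integrable lborel (\<lambda>t. bump a b n t * T t)" if "0 < a" "a < b" for a b n
    by (rule Bochner_Integration.integrable_bound[OF loc'[OF that(1), of b]])
       (use bump_outside[OF _ that(2)] bump_bounds[of a b n] in
         \<open>auto simp: indicator_def abs_mult intro!: mult_left_le_one_le\<close>)
  have ind: "integrable lborel (indicat_real {a..b})" for a b :: real
    by (rule integrable_real_indicator) (simp_all add: emeasure_lborel_Icc_eq)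
  have bI: "integrable lborel (bump a b n)" if "a < b" for a b n
    by (rule Bochner_Integration.integrable_bound[OF ind[of a b]])
       (use bump_outside[OF _ that] bump_bounds[of a b n] in \<open>auto simp: indicator_def\<close>)
  define I where "I a b n = integral\<^sup>L lborel (bump a b n)" for a b n
  have I_int: "integral {0..d} (bump a b n) = I a b n" if "0 < a" "a < b" "b \<le> d" for a b d n
  proof -
    have "set_integrable lborel {0..d} (bump a b n)"
      by (rule borel_integrable_atLeastAtMost') (use Ck_on_bump[of 0 a b n] in \<open>auto intro: continuous_on_subset\<close>)
    from set_borel_integral_eq_integral(2)[OF this] have "integral {0..d} (bump a b n) = (LINT t:{0..d}|lborel. bump a b n t)"
      by simp
    also have "\<dots> = I a b n"
      unfolding I_def set_lebesgue_integral_def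
    proof (rule Bochner_Integration.integral_cong)
      show "indicator {0..d} t *\<^sub>R bump a b n t = bump a b n t" for t
        using bump_outside[of t a b n] that by (cases "t \<in> {0..d}") auto
    qed simp
    finally show ?thesis .
  qed
  have limI: "(\<lambda>n. I a b n) \<longlonglongrightarrow> b - a" if "a < b" for a b
  proof -
    have "(\<lambda>n. I a b n) \<longlonglongrightarrow> integral\<^sup>L lborel (indicat_real {a<..<b})"
      unfolding I_def
      by (rule integral_dominated_convergence[where w="indicat_real {a..b}"])
         (use that ind bump_tendsto_indicator bump_outside[OF _ that] bump_bounds[of a b] in
           \<open>auto simp: indicator_def\<close>)
    then show ?thesis using that by simp
  qed
  have limT: "(\<lambda>n. integral\<^sup>L lborel (\<lambda>t. bump a b n t * T t)) \<longlonglongrightarrow> integral\<^sup>L lborel (\<lambda>t. indicator {a<..<b} t * T t)"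
    if "0 < a" "a < b" for a b
  proof (rule integral_dominated_convergence[where w="\<lambda>t. \<bar>indicator {a..b} t * T t\<bar>"])
    show "integrable lborel (\<lambda>t. \<bar>indicator {a..b} t * T t\<bar>)"
      by (rule integrable_abs[OF loc'[OF that(1)]])
    show "AE t in lborel. (\<lambda>n. bump a b n t * T t) \<longlonglongrightarrow> indicator {a<..<b} t * T t"
      by (intro AE_I2 tendsto_mult_right bump_tendsto_indicator that)
    show "AE t in lborel. norm (bump a b n t * T t) \<le> \<bar>indicator {a..b} t * T t\<bar>" for n
      using bump_outside[OF _ that(2)] bump_bounds[of a b n]
      by (intro AE_I2) (auto simp: indicator_def abs_mult intro!: mult_left_le_one_le)
  qed auto
  have key: "integral\<^sup>L lborel (\<lambda>t. indicator {a<..<b} t * T t)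
      = (b - a) * integral\<^sup>L lborel (\<lambda>t. indicator {1<..<2} t * T t)" if ab: "0 < a" "a < b" for a b
  proof -
    \<comment> \<open>The mean of this combination vanishes for every n; clearing denominators avoids dividing by the integrals.\<close>
    let ?\<beta> = "\<lambda>n t. I 1 2 n * bump a b n t + (- I a b n) * bump 1 2 n t"
    have "integral\<^sup>L lborel (\<lambda>t. ?\<beta> n t * T t) = 0" for n
    proof (rule orth[of "min a 1" "max b 2"])
      show "Ck_on UNIV k (?\<beta> n)" for k
        by (intro Ck_on_add Ck_on_mult Ck_on_const Ck_on_bump open_UNIV)
      show "?\<beta> n t = 0" if "t \<le> min a 1 \<or> max b 2 \<le> t" for t
        using that bump_outside[of t a b n] bump_outside[of t 1 2 n] ab by auto
      have "bump a b n integrable_on {0..max b 2}" "bump 1 2 n integrable_on {0..max b 2}"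
        by (rule integrable_continuous_interval,
            rule continuous_on_subset[OF Ck_on_bump[of 0, unfolded Ck_on.simps]], simp)+
      then have "(\<lambda>t. I 1 2 n * bump a b n t) integrable_on {0..max b 2}"
          "(\<lambda>t. (- I a b n) * bump 1 2 n t) integrable_on {0..max b 2}"
        by - (rule integrable_on_mult_right, assumption)+
      from Henstock_Kurzweil_Integration.integral_add[OF this]
      show "integral {0..max b 2} (?\<beta> n) = 0"
        using I_int[of a b "max b 2" n] I_int[of 1 2 "max b 2" n] ab by simp
    qed (use ab in auto)
    moreover have "integral\<^sup>L lborel (\<lambda>t. ?\<beta> n t * T t)
      = I 1 2 n * integral\<^sup>L lborel (\<lambda>t. bump a b n t * T t) - I a b n * integral\<^sup>L lborel (\<lambda>t. bump 1 2 n t * T t)" for n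
    proof -
      have "integral\<^sup>L lborel (\<lambda>t. ?\<beta> n t * T t)
        = integral\<^sup>L lborel (\<lambda>t. I 1 2 n * (bump a b n t * T t) - I a b n * (bump 1 2 n t * T t))"
        by (rule Bochner_Integration.integral_cong) (auto simp: algebra_simps)
      then show ?thesis using bT[OF ab, of n] bT[of 1 2 n] by simp
    qed
    ultimately have "I 1 2 n * integral\<^sup>L lborel (\<lambda>t. bump a b n t * T t) = I a b n * integral\<^sup>L lborel (\<lambda>t. bump 1 2 n t * T t)" for n
      by simp
    then have "(\<lambda>n. I 1 2 n * integral\<^sup>L lborel (\<lambda>t. bump a b n t * T t))
        \<longlonglongrightarrow> (b - a) * integral\<^sup>L lborel (\<lambda>t. indicator {1<..<2} t * T t)"
      using tendsto_mult[OF limI[OF ab(2)] limT[of 1 2]] by simp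
    moreover have "(\<lambda>n. I 1 2 n * integral\<^sup>L lborel (\<lambda>t. bump a b n t * T t))
        \<longlonglongrightarrow> (2 - 1) * integral\<^sup>L lborel (\<lambda>t. indicator {a<..<b} t * T t)"
      by (rule tendsto_mult[OF limI limT[OF ab]]) simp
    ultimately show ?thesis using LIMSEQ_unique by fastforce
  qed
  define c where "c = integral\<^sup>L lborel (\<lambda>t. indicator {1<..<2} t * T t)"
  have "AE t in lborel. indicator {1 / real (Suc n)..real (Suc n)} t * (T t - c) = 0" for n
  proof (rule AE_zero_of_ray_integrals)
    let ?a = "1 / real (Suc n)" and ?b = "real (Suc n)"
    have i1: "integrable lborel (\<lambda>t. indicator {a..b} t * (T t - c))" if "0 < a" for a b
      using Bochner_Integration.integrable_diff[OF loc'[OF that, of b] integrable_mult_left[OF ind[of a b], of c]]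
      by (simp add: algebra_simps)
    show "integrable lborel (\<lambda>t. indicator {?a..?b} t * (T t - c))" by (rule i1) simp
    fix x :: real
    let ?m = "max x ?a"
    show "(\<integral>t. indicator {x<..} t * (indicator {?a..?b} t * (T t - c)) \<partial>lborel) = 0"
    proof (cases "?m < ?b")
      case True
      have m0: "0 < ?m" by (simp add: less_max_iff_disj)
      have "(\<integral>t. indicator {x<..} t * (indicator {?a..?b} t * (T t - c)) \<partial>lborel)
          = (\<integral>t. indicator {?m<..<?b} t * T t - c * indicator {?m<..<?b} t \<partial>lborel)"
      proof (rule integral_cong_AE)
        show "AE t in lborel. indicator {x<..} t * (indicator {?a..?b} t * (T t - c))
            = indicator {?m<..<?b} t * T t - c * indicator {?m<..<?b} t"
          using AE_lborel_singleton[of ?a] AE_lborel_singleton[of ?b]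
          by eventually_elim (auto simp: indicator_def algebra_simps max_def split: if_splits)
      qed measurable
      also have "\<dots> = (\<integral>t. indicator {?m<..<?b} t * T t \<partial>lborel) - (\<integral>t. c * indicator {?m<..<?b} t \<partial>lborel)"
      proof (rule Bochner_Integration.integral_diff)
        show "integrable lborel (\<lambda>t. indicator {?m<..<?b} t * T t)"
          by (rule Bochner_Integration.integrable_bound[OF loc'[OF m0, of ?b]]) (auto simp: indicator_def)
        show "integrable lborel (\<lambda>t. c * indicator {?m<..<?b} t)"
          by (intro integrable_mult_right integrable_real_indicator) (use True in auto)
      qed
      also have "\<dots> = 0" using key[OF m0 True] True by (simp add: c_def mult.commute)
      finally show ?thesis .
    next
      case False
      have "(\<integral>t. indicator {x<..} t * (indicator {?a..?b} t * (T t - c)) \<partial>lborel) = (\<integral>t. 0 \<partial>(lborel :: real measure))"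
      proof (rule integral_cong_AE)
        show "AE t in lborel. indicator {x<..} t * (indicator {?a..?b} t * (T t - c)) = 0"
          using AE_lborel_singleton[of ?b]
          by eventually_elim (use False in \<open>auto simp: indicator_def max_def split: if_splits\<close>)
      qed measurable
      then show ?thesis by simp
    qed
  qed
  then have "AE t in lborel. \<forall>n. indicator {1 / real (Suc n)..real (Suc n)} t * (T t - c) = 0"
    by (subst AE_all_countable) auto
  then have "AE t in lborel. 0 < t \<longrightarrow> T t = c"
  proof eventually_elim
    case (elim t)
    show ?case
    proof
      assume t: "0 < t"
      obtain n where n: "t + 1/t < real n" using reals_Archimedean2 by blast
      have "0 < 1/t" using t by simp
      then have "t \<le> real (Suc n)" "1/t \<le> real (Suc n)" unfolding of_nat_Suc using n t by linarith+
      moreover have "1 / real (Suc n) \<le> t" using calculation(2) t by (simp add: field_simps)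
      ultimately show "T t = c" using elim[rule_format, of n] by (simp add: indicator_def)
    qed
  qed
  then show ?thesis using that by blast
qed

text \<open>Integration by parts when one factor is merely integrable: by Fubini's theorem on the triangle r \<le> rho.\<close>

lemma integral_by_parts_L1:
  fixes m q \<kappa> :: "real \<Rightarrow> real"
  assumes m: "set_integrable lborel {0..b} m" and q: "continuous_on {0..b} q"
    and \<kappa>: "\<And>r. 0 < r \<Longrightarrow> r \<le> b \<Longrightarrow> \<kappa> r = - integral {r..b} q"
    and [measurable]: "\<kappa> \<in> borel_measurable borel"
  shows "(LINT r:{0..b}|lborel. m r * \<kappa> r) = - (LINT r:{0..b}|lborel. q r * integral {0..r} m)"
proof -
  let ?m = "\<lambda>r. indicator {0..b} r * m r" and ?q = "\<lambda>r. indicator {0..b} r * q r"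
  define K where "K z = ?m (fst z) * (?q (snd z) * (if fst z \<le> snd z then 1 else 0))" for z :: "real \<times> real"
  have mi: "integrable lborel ?m" using m by (simp add: set_integrable_def)
  have q': "set_integrable lborel {0..b} q" by (rule borel_integrable_atLeastAtMost'[OF q])
  then have qi: "integrable lborel ?q" by (simp add: set_integrable_def)
  have [measurable]: "?m \<in> borel_measurable lborel" "?q \<in> borel_measurable lborel" using mi qi by auto
  have [measurable]: "?m \<in> borel_measurable borel" "?q \<in> borel_measurable borel" using mi qi by auto
  have K_meas: "K \<in> borel_measurable (lborel \<Otimes>\<^sub>M lborel)"
    unfolding K_def by measurable
  have Kb: "norm (K (r, \<rho>)) \<le> \<bar>?m r\<bar> * \<bar>?q \<rho>\<bar>" for r \<rho>
    by (auto simp: K_def abs_mult)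
  have sec: "integrable lborel (\<lambda>\<rho>. K (r, \<rho>))" for r
  proof (rule Bochner_Integration.integrable_bound[where f="\<lambda>\<rho>. \<bar>?m r\<bar> * \<bar>?q \<rho>\<bar>"])
    show "integrable lborel (\<lambda>\<rho>. \<bar>?m r\<bar> * \<bar>?q \<rho>\<bar>)" by (intro integrable_mult_right integrable_abs qi)
    show "(\<lambda>\<rho>. K (r, \<rho>)) \<in> borel_measurable lborel" unfolding K_def by simp
  qed (use Kb in auto)
  have Ki: "integrable (lborel \<Otimes>\<^sub>M lborel) K"
  proof (rule lborel_pair.Fubini_integrable[OF K_meas])
    show "AE r in lborel. integrable lborel (\<lambda>\<rho>. K (r, \<rho>))" using sec by auto
    show "integrable lborel (\<lambda>r. \<integral>\<rho>. norm (K (r, \<rho>)) \<partial>lborel)"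
    proof (rule Bochner_Integration.integrable_bound[where f="\<lambda>r. \<bar>?m r\<bar> * (\<integral>\<rho>. \<bar>?q \<rho>\<bar> \<partial>lborel)"])
      show "integrable lborel (\<lambda>r. \<bar>?m r\<bar> * (\<integral>\<rho>. \<bar>?q \<rho>\<bar> \<partial>lborel))" by (intro integrable_mult_left integrable_abs mi)
      show "(\<lambda>r. \<integral>\<rho>. norm (K (r, \<rho>)) \<partial>lborel) \<in> borel_measurable lborel"
        using K_meas by measurable
      show "AE r in lborel. norm (\<integral>\<rho>. norm (K (r, \<rho>)) \<partial>lborel) \<le> norm (\<bar>?m r\<bar> * (\<integral>\<rho>. \<bar>?q \<rho>\<bar> \<partial>lborel))"
      proof (rule AE_I2)
        fix r
        have "(\<integral>\<rho>. norm (K (r, \<rho>)) \<partial>lborel) \<le> (\<integral>\<rho>. \<bar>?m r\<bar> * \<bar>?q \<rho>\<bar> \<partial>lborel)"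
          by (intro integral_mono integrable_norm sec integrable_mult_right integrable_abs qi Kb)
        moreover have "0 \<le> (\<integral>\<rho>. norm (K (r, \<rho>)) \<partial>lborel)" by simp
        ultimately show "norm (\<integral>\<rho>. norm (K (r, \<rho>)) \<partial>lborel) \<le> norm (\<bar>?m r\<bar> * (\<integral>\<rho>. \<bar>?q \<rho>\<bar> \<partial>lborel))" by simp
      qed
    qed
  qed
  have "(LINT r:{0..b}|lborel. m r * \<kappa> r) = (\<integral>r. - (\<integral>\<rho>. K (r, \<rho>) \<partial>lborel) \<partial>lborel)"
    unfolding set_lebesgue_integral_def
  proof (rule integral_cong_AE)
    show "(\<lambda>r. indicator {0..b} r *\<^sub>R (m r * \<kappa> r)) \<in> borel_measurable lborel"
    proof -
      have "(\<lambda>r. ?m r * \<kappa> r) \<in> borel_measurable lborel" by measurable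
      then show ?thesis by (simp add: mult.assoc)
    qed
    show "(\<lambda>r. - (\<integral>\<rho>. K (r, \<rho>) \<partial>lborel)) \<in> borel_measurable lborel" using K_meas by measurable
    show "AE r in lborel. indicator {0..b} r *\<^sub>R (m r * \<kappa> r) = - (\<integral>\<rho>. K (r, \<rho>) \<partial>lborel)"
      using AE_lborel_singleton[of 0]
    proof eventually_elim
      case (elim r)
      show ?case
      proof (cases "0 < r \<and> r \<le> b")
        case True
        have "set_integrable lborel {r..b} q" by (rule set_integrable_subset[OF q']) (use True in auto)
        from set_borel_integral_eq_integral(2)[OF this]
        have "(\<integral>\<rho>. indicator {r..b} \<rho> *\<^sub>R q \<rho> \<partial>lborel) = integral {r..b} q" by (simp add: set_lebesgue_integral_def)
        moreover have "(\<integral>\<rho>. K (r, \<rho>) \<partial>lborel) = (\<integral>\<rho>. m r * (indicator {r..b} \<rho> *\<^sub>R q \<rho>) \<partial>lborel)"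
          by (rule Bochner_Integration.integral_cong) (use True in \<open>auto simp: K_def indicator_def\<close>)
        ultimately show ?thesis using True \<kappa>[of r] by simp
      next
        case False
        then show ?thesis using elim by (auto simp: K_def indicator_def)
      qed
    qed
  qed
  also have "\<dots> = - (\<integral>r. (\<integral>\<rho>. K (r, \<rho>) \<partial>lborel) \<partial>lborel)" by simp
  also have "(\<integral>r. (\<integral>\<rho>. K (r, \<rho>) \<partial>lborel) \<partial>lborel) = (\<integral>\<rho>. (\<integral>r. K (r, \<rho>) \<partial>lborel) \<partial>lborel)"
    by (rule lborel_pair.Fubini_integral[symmetric]) (use Ki in simp)
  also have "\<dots> = (LINT \<rho>:{0..b}|lborel. q \<rho> * integral {0..\<rho>} m)"
    unfolding set_lebesgue_integral_def
  proof (rule Bochner_Integration.integral_cong)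
    fix \<rho> :: real
    show "(\<integral>r. K (r, \<rho>) \<partial>lborel) = indicator {0..b} \<rho> *\<^sub>R (q \<rho> * integral {0..\<rho>} m)"
    proof (cases "0 \<le> \<rho> \<and> \<rho> \<le> b")
      case True
      have "set_integrable lborel {0..\<rho>} m" by (rule set_integrable_subset[OF m]) (use True in auto)
      from set_borel_integral_eq_integral(2)[OF this]
      have "(\<integral>r. indicator {0..\<rho>} r *\<^sub>R m r \<partial>lborel) = integral {0..\<rho>} m" by (simp add: set_lebesgue_integral_def)
      moreover have "(\<integral>r. K (r, \<rho>) \<partial>lborel) = (\<integral>r. q \<rho> * (indicator {0..\<rho>} r *\<^sub>R m r) \<partial>lborel)"
        by (rule Bochner_Integration.integral_cong) (use True in \<open>auto simp: K_def indicator_def\<close>)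
      ultimately show ?thesis using True by simp
    qed (simp add: K_def)
  qed simp
  finally show ?thesis .
qed

lemma locally_integrable_measurable:
  fixes u :: "'a::euclidean_space \<Rightarrow> real"
  assumes "locally_integrable u"
  shows "u \<in> borel_measurable borel"
proof (rule borel_measurable_LIMSEQ_real)
  fix n :: nat
  show "(\<lambda>x. indicator (cball 0 (real n)) x *\<^sub>R u x) \<in> borel_measurable borel"
    using assms borel_measurable_integrable[of lborel "\<lambda>x. indicator (cball 0 (real n)) x *\<^sub>R u x"]
    by (simp add: locally_integrable_def set_integrable_def)
next
  fix x :: 'a
  obtain N where "norm x \<le> real N" using real_arch_simple by blast
  then have "\<forall>\<^sub>F n in sequentially. indicator (cball 0 (real n)) x *\<^sub>R u x = u x"
    by (intro eventually_mono[OF eventually_ge_at_top[of N]]) (auto simp: indicator_def)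
  then show "(\<lambda>n. indicator (cball 0 (real n)) x *\<^sub>R u x) \<longlonglongrightarrow> u x" by (rule tendsto_eventually)
qed

lemma test_function_continuous: "test_function \<phi> \<Longrightarrow> continuous_on UNIV \<phi>"
  unfolding test_function_def using Ck.simps(1) by blast

lemma laplacian_continuous:
  assumes "test_function \<phi>"
  shows "continuous_on UNIV (laplacian \<phi>)"
proof -
  have "Ck (Suc (Suc 0)) \<phi>" using assms unfolding test_function_def by blast
  then have "continuous_on UNIV (partial_deriv b (partial_deriv b \<phi>))" if "b \<in> Basis" for b
    using that by simp
  then show ?thesis unfolding laplacian_def[abs_def] by (intro continuous_on_sum) auto
qed

lemma radial_set_integrable:
  assumes u: "locally_integrable (u :: real^3 \<Rightarrow> real)" and [measurable]: "g \<in> borel_measurable borel"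
    and ug: "AE x in lborel. u x = g (norm x)"
  shows "set_integrable lborel {0..R} (\<lambda>r. r\<^sup>2 * g r)"
proof -
  have [measurable]: "u \<in> borel_measurable borel" by (rule locally_integrable_measurable[OF u])
  have "integrable lborel (\<lambda>x. indicator (cball 0 R) x * u x)"
    using u by (simp add: locally_integrable_def set_integrable_def)
  moreover have "AE x in lborel. indicator (cball 0 R) x * u x = indicator {..R} (norm x) * g (norm x)"
    using ug by eventually_elim (auto simp: indicator_def)
  ultimately have "integrable lborel (\<lambda>x::real^3. indicator {..R} (norm x) * g (norm x))"
    by (subst integrable_cong_AE[symmetric]) auto
  then have "integrable lborel (\<lambda>r. radial_weight r * (indicator {..R} r * g r))"
    by (subst (asm) integrable_radial) auto
  from integrable_mult_right[OF this, of "1 / (4 * pi)"]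
  have "integrable lborel (\<lambda>r. 1 / (4 * pi) * (radial_weight r * (indicator {..R} r * g r)))" .
  moreover have "1 / (4 * pi) * (radial_weight r * (indicator {..R} r * g r)) = indicator {0..R} r *\<^sub>R (r\<^sup>2 * g r)" for r
    by (auto simp: radial_weight_def indicator_def)
  ultimately show ?thesis by (simp add: set_integrable_def)
qed

text \<open>The weak equation tested with the radial test functions above, in polar coordinates; the factors
4 pi cancel.\<close>

lemma radial_weak_identity:
  assumes weak: "has_weak_laplacian (u :: real^3 \<Rightarrow> real) w"
    and g [measurable]: "g \<in> borel_measurable borel" and ug: "AE x in lborel. u x = g (norm x)"
    and h [measurable]: "h \<in> borel_measurable borel" and wh: "AE x in lborel. w x = h (norm x)"
    and smooth: "\<And>k. Ck_on UNIV k \<beta>" and ab: "0 < a" "a < b"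
    and supp: "\<And>t. t \<le> a \<or> b \<le> t \<Longrightarrow> \<beta> t = 0" and mean: "integral {0..b} \<beta> = 0"
  shows "integral\<^sup>L lborel (\<lambda>r. \<beta> r * g r) =
    - (LINT r:{0..b}|lborel. integral {0..r} \<beta> / r\<^sup>2 * integral {0..r} (\<lambda>t. t\<^sup>2 * h t))"
proof -
  obtain \<phi> :: "real^3 \<Rightarrow> real" and \<kappa> where \<phi>: "test_function \<phi>" "\<And>x. \<phi> x = \<kappa> (norm x)"
    and \<kappa>: "continuous_on UNIV \<kappa>" "\<And>r. b \<le> r \<Longrightarrow> \<kappa> r = 0"
      "\<And>r. 0 < r \<Longrightarrow> (\<kappa> has_real_derivative integral {0..r} \<beta> / r\<^sup>2) (at r)"
    and lap: "\<And>x. x \<noteq> 0 \<Longrightarrow> laplacian \<phi> x = \<beta> (norm x) / (norm x)\<^sup>2"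
    using radial_test_function[OF smooth ab supp mean] by blast
  have loc: "locally_integrable u" "locally_integrable w"
    using weak by (auto simp: has_weak_laplacian_def)
  have [measurable]: "u \<in> borel_measurable borel" "w \<in> borel_measurable borel"
    using loc locally_integrable_measurable by auto
  have [measurable]: "\<phi> \<in> borel_measurable borel" "laplacian \<phi> \<in> borel_measurable borel"
    using \<phi>(1) test_function_continuous laplacian_continuous by (auto intro: borel_measurable_continuous_onI)
  have [measurable]: "\<kappa> \<in> borel_measurable borel" using \<kappa>(1) by (rule borel_measurable_continuous_onI)
  have \<beta>_cont: "continuous_on UNIV \<beta>" using smooth[of 0] by simp
  then have [measurable]: "\<beta> \<in> borel_measurable borel" by (rule borel_measurable_continuous_onI)
  have "integral\<^sup>L lborel (\<lambda>x. laplacian \<phi> x *\<^sub>R u x)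
      = integral\<^sup>L lborel (\<lambda>x::real^3. \<beta> (norm x) / (norm x)\<^sup>2 * g (norm x))"
  proof (rule integral_cong_AE)
    show "AE x in lborel. laplacian \<phi> x *\<^sub>R u x = \<beta> (norm x) / (norm x)\<^sup>2 * g (norm x)"
      using ug AE_lborel_singleton[of 0] by eventually_elim (simp add: lap)
  qed measurable
  also have "\<dots> = integral\<^sup>L lborel (\<lambda>r. radial_weight r * (\<beta> r / r\<^sup>2 * g r))"
    by (rule integral_radial) measurable
  also have "\<dots> = integral\<^sup>L lborel (\<lambda>r. 4 * pi * (\<beta> r * g r))"
    by (rule Bochner_Integration.integral_cong) (use supp ab in \<open>auto simp: radial_weight_def\<close>)
  finally have L: "integral\<^sup>L lborel (\<lambda>x. laplacian \<phi> x *\<^sub>R u x) = 4 * pi * integral\<^sup>L lborel (\<lambda>r. \<beta> r * g r)"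
    by simp
  have "integral\<^sup>L lborel (\<lambda>x. \<phi> x *\<^sub>R w x) = integral\<^sup>L lborel (\<lambda>x::real^3. \<kappa> (norm x) * h (norm x))"
    by (rule integral_cong_AE) (use wh \<phi>(2) in auto)
  also have "\<dots> = integral\<^sup>L lborel (\<lambda>r. radial_weight r * (\<kappa> r * h r))"
    by (rule integral_radial) measurable
  also have "\<dots> = integral\<^sup>L lborel (\<lambda>r. 4 * pi * (indicator {0..b} r *\<^sub>R (r\<^sup>2 * h r * \<kappa> r)))"
    by (rule Bochner_Integration.integral_cong) (use \<kappa>(2) in \<open>auto simp: radial_weight_def indicator_def\<close>)
  finally have R: "integral\<^sup>L lborel (\<lambda>x. \<phi> x *\<^sub>R w x) = 4 * pi * (LINT r:{0..b}|lborel. r\<^sup>2 * h r * \<kappa> r)"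
    by (simp add: set_lebesgue_integral_def)
  have a0: "\<And>t. t \<le> a \<Longrightarrow> \<beta> t = 0" using supp by simp
  have B0: "integral {0..r} \<beta> = 0" if "r \<le> a" for r
    by (rule antiderivative_vanishing(2)[OF \<beta>_cont ab(1) a0 that])
  have q: "continuous_on UNIV (\<lambda>r. integral {0..r} \<beta> / r\<^sup>2)"
  proof -
    have "continuous_on {0<..} (\<lambda>r. integral {0..r} \<beta> / r\<^sup>2)"
    proof (rule continuous_on_divide)
      show "continuous_on {0<..} (\<lambda>r. integral {0..r} \<beta>)"
        by (rule DERIV_at_imp_continuous_on) (rule antiderivative_vanishing(1)[OF \<beta>_cont ab(1) a0])
    qed (auto intro!: continuous_intros)
    moreover have "continuous_on {..<a} (\<lambda>r. integral {0..r} \<beta> / r\<^sup>2)"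
      using B0 by (subst continuous_on_cong[where g="\<lambda>_. 0"]) auto
    ultimately have "continuous_on ({0<..} \<union> {..<a}) (\<lambda>r. integral {0..r} \<beta> / r\<^sup>2)"
      by (intro continuous_on_open_Un) auto
    moreover have "{0<..} \<union> {..<a} = UNIV" using ab by auto
    ultimately show ?thesis by simp
  qed
  have "(LINT r:{0..b}|lborel. r\<^sup>2 * h r * \<kappa> r) =
    - (LINT r:{0..b}|lborel. integral {0..r} \<beta> / r\<^sup>2 * integral {0..r} (\<lambda>t. t\<^sup>2 * h t))"
  proof (rule integral_by_parts_L1)
    show "set_integrable lborel {0..b} (\<lambda>r. r\<^sup>2 * h r)" by (rule radial_set_integrable[OF loc(2) h wh])
    show "continuous_on {0..b} (\<lambda>r. integral {0..r} \<beta> / r\<^sup>2)" by (rule continuous_on_subset[OF q]) simp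
    fix r assume r: "0 < r" "r \<le> b"
    have "((\<lambda>r. integral {0..r} \<beta> / r\<^sup>2) has_integral \<kappa> b - \<kappa> r) {r..b}"
    proof (rule fundamental_theorem_of_calculus[OF r(2)])
      fix x assume "x \<in> {r..b}"
      then show "(\<kappa> has_vector_derivative integral {0..x} \<beta> / x\<^sup>2) (at x within {r..b})"
        using \<kappa>(3)[of x] r(1)
        by (auto simp: has_real_derivative_iff_has_vector_derivative intro: has_vector_derivative_at_within)
    qed
    then show "\<kappa> r = - integral {r..b} (\<lambda>r. integral {0..r} \<beta> / r\<^sup>2)" using \<kappa>(2)[of b] by (simp add: integral_unique)
  qed measurable
  moreover have "integral\<^sup>L lborel (\<lambda>x. laplacian \<phi> x *\<^sub>R u x) = integral\<^sup>L lborel (\<lambda>x. \<phi> x *\<^sub>R w x)"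
    using weak \<phi>(1) by (simp add: has_weak_laplacian_def)
  ultimately have "4 * pi * integral\<^sup>L lborel (\<lambda>r. \<beta> r * g r) = 4 * pi *
    - (LINT r:{0..b}|lborel. integral {0..r} \<beta> / r\<^sup>2 * integral {0..r} (\<lambda>t. t\<^sup>2 * h t))"
    unfolding L R by metis
  then show ?thesis by (subst (asm) mult_left_cancel) simp_all
qed

lemma antiderivative_on_pos:
  fixes m :: "real \<Rightarrow> real"
  assumes "continuous_on {0<..} m"
  obtains M where "\<And>r. 0 < r \<Longrightarrow> (M has_real_derivative m r) (at r)"
proof -
  define M where "M r = (LBINT y=ereal 1..ereal r. m y)" for r :: real
  have "(M has_real_derivative m r) (at r)" if r: "0 < r" for r
  proof -
    let ?a = "min r 1 / 2" and ?b = "max r 1 + 1"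
    have "((\<lambda>u. LBINT y=ereal 1..ereal u. m y) has_vector_derivative m r) (at r within {?a..?b})"
      by (rule interval_integral_FTC2) (use r in \<open>auto intro!: continuous_on_subset[OF assms] simp: min_def max_def split: if_splits\<close>)
    moreover have "at r within {?a..?b} = at r"
      by (rule at_within_interior) (use r in \<open>auto simp: min_def max_def\<close>)
    ultimately show ?thesis
      by (simp add: M_def[abs_def] has_real_derivative_iff_has_vector_derivative)
  qed
  then show ?thesis using that by blast
qed

text \<open>The regularity theorem.  With H(r) = \<integral> t^2 h over (0, r) and M an antiderivative of H / r^2, the weak
equation says that g - M is orthogonal to all test functions of mean zero; hence g = M + const
almost everywhere.  Then H itself is differentiable, and s = r (M + const) satisfies s'' = c s.
Finally r M(r) tends to 0 because H(0+) = 0.\<close>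

lemma radial_weak_solution:
  assumes weak: "has_weak_laplacian (u :: real^3 \<Rightarrow> real) w"
    and rad: "AE x in lborel. u x = g0 (norm x)"
    and c: "continuous_on {0..} c" and w: "AE x in lborel. w x = c (norm x) * u x"
  obtains s s' where "\<And>r. 0 < r \<Longrightarrow> (s has_real_derivative s' r) (at r)"
    "\<And>r. 0 < r \<Longrightarrow> (s' has_real_derivative c r * s r) (at r)"
    "(s \<longlongrightarrow> 0) (at_right 0)" "AE x in lborel. u x = s (norm x) / norm x"
proof -
  have loc: "locally_integrable u" "locally_integrable w"
    using weak by (auto simp: has_weak_laplacian_def)
  have "u \<in> borel_measurable borel" using loc locally_integrable_measurable by auto
  from radial_borel_profile[OF this rad] obtain g where
    g [measurable]: "g \<in> borel_measurable borel" and ug: "AE x in lborel. u x = g (norm x)" by blast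
  define h where "h r = indicator {0..} r * c r * g r" for r
  have "(\<lambda>r. indicator {0..} r *\<^sub>R c r) \<in> borel_measurable borel"
    by (rule borel_measurable_continuous_on_indicator[OF _ c]) simp
  then have h [measurable]: "h \<in> borel_measurable borel" unfolding h_def[abs_def] by simp
  have wh: "AE x in lborel. w x = h (norm x)"
    using w ug by eventually_elim (simp add: h_def)
  have h_int: "set_integrable lborel {0..R} (\<lambda>r. r\<^sup>2 * h r)" for R
    by (rule radial_set_integrable[OF loc(2) h wh])
  have g_int: "set_integrable lborel {0..R} (\<lambda>r. r\<^sup>2 * g r)" for R
    by (rule radial_set_integrable[OF loc(1) g ug])
  define H where "H r = integral {0..r} (\<lambda>t. t\<^sup>2 * h t)" for r
  have H_cont: "continuous_on {0..R} H" for R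
    unfolding H_def[abs_def]
    by (rule indefinite_integral_continuous_1[OF set_borel_integral_eq_integral(1)[OF h_int]])
  have H_cont': "continuous_on {0..} H"
    unfolding continuous_on_eq_continuous_within
  proof
    fix x :: real assume x: "x \<in> {0..}"
    have "continuous (at x within {0..x+1}) H"
      using H_cont[of "x+1"] x by (simp add: continuous_on_eq_continuous_within)
    moreover have "at x within {0..x+1} = at x within {0..}"
      by (rule at_within_nhd[of _ "{..<x+1}"]) auto
    ultimately show "continuous (at x within {0..}) H" by (simp add: continuous_within)
  qed
  have H0: "(H \<longlongrightarrow> 0) (at_right 0)"
  proof -
    have "(H \<longlongrightarrow> H 0) (at 0 within {0..1})" using H_cont[of 1] by (simp add: continuous_on_def)
    moreover have "at 0 within {0..1} = at_right (0::real)" by (rule at_within_Icc_at_right) simp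
    ultimately show ?thesis by (simp add: H_def)
  qed
  have "continuous_on {0<..} (\<lambda>r. H r / r\<^sup>2)"
    by (intro continuous_intros continuous_on_subset[OF H_cont']) auto
  from antiderivative_on_pos[OF this] obtain M where
    DM: "\<And>r. 0 < r \<Longrightarrow> (M has_real_derivative H r / r\<^sup>2) (at r)" by blast
  have M_cont: "continuous_on {0<..} M"
    by (rule DERIV_at_imp_continuous_on, rule DM) auto
  define T where "T r = g r - indicator {0<..} r * M r" for r
  have "(\<lambda>r. indicator {0<..} r *\<^sub>R M r) \<in> borel_measurable borel"
    by (rule borel_measurable_continuous_on_indicator[OF _ M_cont]) simp
  then have T_meas: "T \<in> borel_measurable borel" unfolding T_def[abs_def] by simp
  have g_loc: "set_integrable lborel {a..b} g" if a: "0 < a" for a b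
  proof -
    have "set_integrable lborel {a..b} (\<lambda>r. r\<^sup>2 * g r)"
      by (rule set_integrable_subset[OF g_int[of b]]) (use a in auto)
    then have i: "integrable lborel (\<lambda>r. indicator {a..b} r * (r\<^sup>2 * g r))" by (simp add: set_integrable_def)
    have "integrable lborel (\<lambda>r. 1 / a\<^sup>2 * (indicator {a..b} r * (r\<^sup>2 * g r)))" by (rule integrable_mult_right[OF i])
    then have "integrable lborel (\<lambda>r. indicator {a..b} r * g r)"
    proof (rule Bochner_Integration.integrable_bound)
      show "AE r in lborel. norm (indicator {a..b} r * g r) \<le> norm (1 / a\<^sup>2 * (indicator {a..b} r * (r\<^sup>2 * g r)))"
      proof (rule AE_I2)
        fix r
        show "norm (indicator {a..b} r * g r) \<le> norm (1 / a\<^sup>2 * (indicator {a..b} r * (r\<^sup>2 * g r)))"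
        proof (cases "r \<in> {a..b}")
          case True
          then have "a\<^sup>2 * \<bar>g r\<bar> \<le> r\<^sup>2 * \<bar>g r\<bar>" using a by (intro mult_right_mono power_mono) auto
          then show ?thesis using True a by (simp add: abs_mult field_simps)
        qed simp
      qed
    qed measurable
    then show ?thesis by (simp add: set_integrable_def)
  qed
  have T_int: "set_integrable lborel {a..b} T" if a: "0 < a" for a b
  proof -
    have "set_integrable lborel {a..b} M"
      by (rule borel_integrable_atLeastAtMost') (use a in \<open>auto intro: continuous_on_subset[OF M_cont]\<close>)
    from set_integral_diff(1)[OF g_loc[OF a, of b] this]
    show ?thesis unfolding set_integrable_def
      by (rule Bochner_Integration.integrable_cong[THEN iffD1, rotated 2])
         (use a in \<open>auto simp: T_def indicator_def\<close>)
  qed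
  have orth: "integral\<^sup>L lborel (\<lambda>t. \<beta> t * T t) = 0"
    if ab: "0 < a" "a < b" and smooth: "\<And>k. Ck_on UNIV k \<beta>"
      and supp: "\<And>t. t \<le> a \<or> b \<le> t \<Longrightarrow> \<beta> t = 0" and mean: "integral {0..b} \<beta> = 0" for \<beta> a b
  proof -
    define B where "B r = integral {0..r} \<beta>" for r
    have \<beta>_cont: "continuous_on UNIV \<beta>" using smooth[of 0] by simp
    have [measurable]: "\<beta> \<in> borel_measurable borel" by (rule borel_measurable_continuous_onI[OF \<beta>_cont])
    have a0: "\<And>t. t \<le> a \<Longrightarrow> \<beta> t = 0" using supp by simp
    have DB: "(B has_real_derivative \<beta> r) (at r)" for r
      unfolding B_def[abs_def] by (rule antiderivative_vanishing(1)[OF \<beta>_cont ab(1) a0])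
    have B0: "B r = 0" if "r \<le> a" for r
      unfolding B_def by (rule antiderivative_vanishing(2)[OF \<beta>_cont ab(1) a0 that])
    have B_cont: "continuous_on A B" for A
      by (rule DERIV_at_imp_continuous_on, rule DB)
    have "(\<integral>x. (\<beta> x * M x + B x * (H x / x\<^sup>2)) * indicator {a..b} x \<partial>lborel) = B b * M b - B a * M a"
    proof (rule integral_FTC_Icc_real)
      fix x assume x: "a \<le> x" "x \<le> b"
      then have x0: "0 < x" using ab by simp
      show "((\<lambda>x. B x * M x) has_real_derivative \<beta> x * M x + B x * (H x / x\<^sup>2)) (at x)"
        using DERIV_mult[OF DB DM[OF x0]] by (simp add: algebra_simps)
      have "continuous_on {0<..} (\<lambda>x. \<beta> x * M x + B x * (H x / x\<^sup>2))"
        by (intro continuous_intros B_cont M_cont continuous_on_subset[OF \<beta>_cont] continuous_on_subset[OF H_cont']) auto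
      then show "isCont (\<lambda>x. \<beta> x * M x + B x * (H x / x\<^sup>2)) x"
        using x0 by (simp add: continuous_on_eq_continuous_at)
    qed (use ab in simp)
    then have parts: "(\<integral>x. (\<beta> x * M x + B x * (H x / x\<^sup>2)) * indicator {a..b} x \<partial>lborel) = 0"
      using B0[of a] mean by (simp add: B_def)
    have ci: "integrable lborel (\<lambda>x. indicator {a..b} x * f x)" if "continuous_on {0<..} f" for f :: "real \<Rightarrow> real"
    proof -
      have "continuous_on {a..b} f" by (rule continuous_on_subset[OF that]) (use ab in auto)
      from borel_integrable_atLeastAtMost'[OF this] show ?thesis by (simp add: set_integrable_def)
    qed
    have i1: "integrable lborel (\<lambda>x. indicator {a..b} x * (\<beta> x * M x))"
      by (rule ci) (intro continuous_intros M_cont continuous_on_subset[OF \<beta>_cont], auto)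
    have i2: "integrable lborel (\<lambda>x. indicator {a..b} x * (B x * (H x / x\<^sup>2)))"
      by (rule ci) (intro continuous_intros B_cont continuous_on_subset[OF H_cont'], auto)
    have i3: "integrable lborel (\<lambda>x. \<beta> x * g x)"
    proof -
      have "bounded (\<beta> ` {a..b})" by (intro compact_imp_bounded compact_continuous_image continuous_on_subset[OF \<beta>_cont]) auto
      then obtain K where K: "\<And>x. x \<in> {a..b} \<Longrightarrow> \<bar>\<beta> x\<bar> \<le> K" unfolding bounded_iff by (metis imageI real_norm_def)
      have "integrable lborel (\<lambda>x. K * (indicator {a..b} x * g x))"
        using g_loc[OF ab(1), of b] by (intro integrable_mult_right) (simp add: set_integrable_def)
      then show ?thesis
      proof (rule Bochner_Integration.integrable_bound)
        show "AE x in lborel. norm (\<beta> x * g x) \<le> norm (K * (indicator {a..b} x * g x))"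
        proof (rule AE_I2)
          fix x
          show "norm (\<beta> x * g x) \<le> norm (K * (indicator {a..b} x * g x))"
          proof (cases "x \<in> {a..b}")
            case True
            then have "\<bar>\<beta> x\<bar> \<le> \<bar>K\<bar>" using K[OF True] by simp
            then show ?thesis using True by (simp add: abs_mult mult_right_mono)
          qed (use supp[of x] in auto)
        qed
      qed measurable
    qed
    have "integral\<^sup>L lborel (\<lambda>t. \<beta> t * T t) = integral\<^sup>L lborel (\<lambda>t. \<beta> t * g t - indicator {a..b} t * (\<beta> t * M t))"
    proof (rule Bochner_Integration.integral_cong)
      show "\<beta> t * T t = \<beta> t * g t - indicator {a..b} t * (\<beta> t * M t)" for t
        using supp[of t] ab by (cases "t \<in> {a..b}") (auto simp: T_def algebra_simps)
    qed simp
    also have "\<dots> = integral\<^sup>L lborel (\<lambda>t. \<beta> t * g t) - integral\<^sup>L lborel (\<lambda>t. indicator {a..b} t * (\<beta> t * M t))"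
      by (rule Bochner_Integration.integral_diff[OF i3 i1])
    also have "integral\<^sup>L lborel (\<lambda>t. \<beta> t * g t) = - integral\<^sup>L lborel (\<lambda>x. indicator {a..b} x * (B x * (H x / x\<^sup>2)))"
    proof -
      have "(LINT r:{0..b}|lborel. B r / r\<^sup>2 * H r) = integral\<^sup>L lborel (\<lambda>x. indicator {a..b} x * (B x * (H x / x\<^sup>2)))"
        unfolding set_lebesgue_integral_def
        by (rule Bochner_Integration.integral_cong) (use B0 ab in \<open>auto simp: indicator_def\<close>)
      then show ?thesis
        using radial_weak_identity[OF weak g ug h wh smooth ab supp mean] by (simp add: B_def H_def)
    qed
    also have "- integral\<^sup>L lborel (\<lambda>x. indicator {a..b} x * (B x * (H x / x\<^sup>2))) - integral\<^sup>L lborel (\<lambda>t. indicator {a..b} t * (\<beta> t * M t))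
        = - integral\<^sup>L lborel (\<lambda>x. indicator {a..b} x * (\<beta> x * M x) + indicator {a..b} x * (B x * (H x / x\<^sup>2)))"
      using Bochner_Integration.integral_add[OF i1 i2] by simp
    also have "\<dots> = 0" using parts by (simp add: algebra_simps)
    finally show ?thesis .
  qed
  have "\<exists>k. AE r in lborel. 0 < r \<longrightarrow> T r = k"
  proof (rule du_bois_reymond[OF T_meas])
    show "set_integrable lborel {a..b} T" if "0 < a" for a b by (rule T_int[OF that])
    show "integral\<^sup>L lborel (\<lambda>t. \<beta> t * T t) = 0"
      if "0 < a" "a < b" "\<And>k. Ck_on UNIV k \<beta>" "\<And>t. t \<le> a \<or> b \<le> t \<Longrightarrow> \<beta> t = 0"
        "integral {0..b} \<beta> = 0" for \<beta> a b
      by (rule orth[OF that])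
  qed blast
  then obtain k where k: "AE r in lborel. 0 < r \<longrightarrow> T r = k" by blast
  define G where "G r = k + M r" for r
  have gG: "AE r in lborel. 0 < r \<longrightarrow> g r = G r"
    using k by eventually_elim (auto simp: T_def G_def)
  have DG: "(G has_real_derivative H r / r\<^sup>2) (at r)" if "0 < r" for r
    unfolding G_def[abs_def] by (auto intro!: derivative_eq_intros DM that)
  have G_cont: "continuous_on {0<..} G"
    by (rule DERIV_at_imp_continuous_on, rule DG) auto
  have DH: "(H has_real_derivative r\<^sup>2 * (c r * G r)) (at r)" if r: "0 < r" for r
  proof -
    let ?a = "r/2" and ?b = "r+1" and ?f = "\<lambda>t. t\<^sup>2 * (c t * G t)"
    have f_cont: "continuous_on {?a..?b} ?f"
      by (intro continuous_intros continuous_on_subset[OF c] continuous_on_subset[OF G_cont]) (use r in auto)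
    obtain N where N: "N \<in> null_sets lborel" "\<And>t. t \<notin> N \<Longrightarrow> 0 < t \<longrightarrow> g t = G t"
      by (rule AE_lborel_E[OF gG], rule that)
    have negN: "negligible N"
      using N(1) by (simp add: negligible_iff_null_sets null_sets_completionI)
    have hi: "(\<lambda>t. t\<^sup>2 * h t) integrable_on {0..R}" for R by (rule set_borel_integral_eq_integral(1)[OF h_int])
    have eq: "H x = H ?a + integral {?a..x} ?f" if x: "x \<in> {?a<..<?b}" for x
    proof -
      have "integral {0..?a} (\<lambda>t. t\<^sup>2 * h t) + integral {?a..x} (\<lambda>t. t\<^sup>2 * h t) = integral {0..x} (\<lambda>t. t\<^sup>2 * h t)"
        by (rule Henstock_Kurzweil_Integration.integral_combine[OF _ _ hi]) (use x r in auto)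
      moreover have "integral {?a..x} (\<lambda>t. t\<^sup>2 * h t) = integral {?a..x} ?f"
        by (rule integral_spike[OF negN]) (use N(2) r in \<open>auto simp: h_def\<close>)
      ultimately show ?thesis by (simp add: H_def)
    qed
    have "((\<lambda>u. integral {?a..u} ?f) has_real_derivative ?f r) (at r within {?a..?b})"
      by (rule integral_has_real_derivative[OF f_cont]) (use r in auto)
    moreover have "at r within {?a..?b} = at r" by (rule at_within_interior) (use r in auto)
    ultimately have "((\<lambda>u. H ?a + integral {?a..u} ?f) has_real_derivative ?f r) (at r)"
      by (auto intro!: derivative_eq_intros)
    then show ?thesis
      by (rule has_field_derivative_transform_within_open[where S="{?a<..<?b}"]) (use r eq in auto)
  qed
  show ?thesis
  proof (rule that[of "\<lambda>r. r * G r" "\<lambda>r. G r + H r / r"])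
    fix r :: real assume r: "0 < r"
    show "((\<lambda>r. r * G r) has_real_derivative G r + H r / r) (at r)"
      using DERIV_mult[OF DERIV_ident DG[OF r]] r by (simp add: power2_eq_square algebra_simps)
    show "((\<lambda>r. G r + H r / r) has_real_derivative c r * (r * G r)) (at r)"
      by (rule DERIV_cong[OF DERIV_add[OF DG[OF r] DERIV_divide[OF DH[OF r] DERIV_ident]]])
         (use r in \<open>auto simp: field_simps power2_eq_square\<close>)
  next
    have "((\<lambda>r. G r / (1 / r)) \<longlongrightarrow> 0) (at_right 0)"
    proof (rule lhopital_right_0_at_top[where f'="\<lambda>r. H r / r\<^sup>2" and g'="\<lambda>r. - 1 / r\<^sup>2"])
      show "filterlim (\<lambda>r::real. 1 / r) at_top (at_right 0)" by real_asymp
      have pos: "\<forall>\<^sub>F r::real in at_right 0. 0 < r" by (simp add: eventually_at_right_less)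
      show "\<forall>\<^sub>F r::real in at_right 0. - 1 / r\<^sup>2 \<noteq> 0" using pos by eventually_elim auto
      show "\<forall>\<^sub>F r in at_right 0. (G has_real_derivative H r / r\<^sup>2) (at r)" using pos by eventually_elim (rule DG)
      show "\<forall>\<^sub>F r::real in at_right 0. ((\<lambda>r. 1 / r) has_real_derivative - 1 / r\<^sup>2) (at r)"
        using pos by eventually_elim (auto intro!: derivative_eq_intros simp: power2_eq_square)
      have "((\<lambda>r. - H r) \<longlongrightarrow> 0) (at_right 0)" using tendsto_minus[OF H0] by simp
      then show "((\<lambda>r. H r / r\<^sup>2 / (- 1 / r\<^sup>2)) \<longlongrightarrow> 0) (at_right 0)"
        by (rule Lim_transform_eventually) (use pos in eventually_elim, auto)
    qed
    then show "((\<lambda>r. r * G r) \<longlongrightarrow> 0) (at_right 0)" by (simp add: mult.commute)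
    have "AE x::real^3 in lborel. g (norm x) = G (norm x)" by (rule AE_radial[OF gG])
    then show "AE x in lborel. u x = norm x * G (norm x) / norm x"
      using ug AE_lborel_singleton[of 0] by eventually_elim simp
  qed
qed

lemma partial_deriv_zero_on_open:
  assumes "open U" "\<And>x. x \<in> U \<Longrightarrow> f x = 0" "x \<in> U"
  shows "partial_deriv b f x = 0"
proof -
  have "((\<lambda>_. 0) has_derivative (\<lambda>_. 0)) (at x)" by simp
  then have "(f has_derivative (\<lambda>_. 0)) (at x)"
    by (rule has_derivative_transform_within_open[OF _ assms(1,3)]) (use assms(2) in simp)
  then show ?thesis using partial_deriv_eq by blast
qed

text \<open>Together with the continuity of the Laplacian this makes the pairing of a test function's Laplacian with a locally
integrable function a convergent integral, to which bounded linear maps may be applied.\<close>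

lemma laplacian_zero_outside_support:
  assumes "x \<notin> closure {x. \<phi> x \<noteq> 0}"
  shows "laplacian \<phi> x = 0"
proof -
  let ?U = "- closure {x. \<phi> x \<noteq> 0}"
  have z: "\<phi> y = 0" if "y \<in> ?U" for y using that closure_subset[of "{x. \<phi> x \<noteq> 0}"] by auto
  have z1: "partial_deriv b \<phi> y = 0" if "y \<in> ?U" for y b
    by (rule partial_deriv_zero_on_open[OF _ z that]) auto
  have "partial_deriv b (partial_deriv b \<phi>) x = 0" for b
    by (rule partial_deriv_zero_on_open[of ?U, OF _ z1]) (use assms in auto)
  then show ?thesis by (simp add: laplacian_def)
qed

lemma integrable_scaleR_locally_integrable:
  fixes u :: "'a::euclidean_space \<Rightarrow> 'b::{banach,second_countable_topology}"
  assumes u: "locally_integrable u" and \<psi>: "continuous_on UNIV \<psi>" and K: "compact K" "\<And>x. x \<notin> K \<Longrightarrow> \<psi> x = 0"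
  shows "integrable lborel (\<lambda>x. \<psi> x *\<^sub>R u x)"
proof -
  have uK: "integrable lborel (\<lambda>x. indicator K x *\<^sub>R u x)"
    using u K(1) by (simp add: locally_integrable_def set_integrable_def)
  have "bounded (\<psi> ` K)" by (intro compact_imp_bounded compact_continuous_image continuous_on_subset[OF \<psi>] K) auto
  then obtain C where C: "\<And>x. x \<in> K \<Longrightarrow> \<bar>\<psi> x\<bar> \<le> C" unfolding bounded_iff by (metis imageI real_norm_def)
  have eq: "\<psi> x *\<^sub>R u x = \<psi> x *\<^sub>R (indicator K x *\<^sub>R u x)" for x using K(2) by (cases "x \<in> K") auto
  show ?thesis
  proof (rule Bochner_Integration.integrable_bound[OF integrable_scaleR_right[OF uK, of C]])
    have "\<psi> \<in> borel_measurable borel" by (rule borel_measurable_continuous_onI[OF \<psi>])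
    then have "(\<lambda>x. \<psi> x *\<^sub>R (indicator K x *\<^sub>R u x)) \<in> borel_measurable lborel"
      using borel_measurable_integrable[OF uK] by (intro borel_measurable_scaleR[of \<psi>]) simp_all
    then show "(\<lambda>x. \<psi> x *\<^sub>R u x) \<in> borel_measurable lborel" by (simp only: eq[symmetric])
    show "AE x in lborel. norm (\<psi> x *\<^sub>R u x) \<le> norm (C *\<^sub>R (indicator K x *\<^sub>R u x))"
    proof (rule AE_I2)
      fix x
      show "norm (\<psi> x *\<^sub>R u x) \<le> norm (C *\<^sub>R (indicator K x *\<^sub>R u x))"
        using C[of x] K(2)[of x] by (cases "x \<in> K") (auto intro!: mult_right_mono)
    qed
  qed
qed

text \<open>Used for the real and imaginary parts, which reduces complex eigenfunctions to real ones.\<close>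

lemma has_weak_laplacian_bounded_linear:
  fixes u w :: "'a::euclidean_space \<Rightarrow> 'b::{banach,second_countable_topology}"
    and T :: "'b \<Rightarrow> 'c::{banach,second_countable_topology}"
  assumes T: "bounded_linear T" and weak: "has_weak_laplacian u w"
  shows "has_weak_laplacian (\<lambda>x. T (u x)) (\<lambda>x. T (w x))"
proof -
  interpret bounded_linear T by fact
  have loc: "locally_integrable (\<lambda>x. T (v x))" if "locally_integrable v" for v :: "'a \<Rightarrow> 'b"
    unfolding locally_integrable_def set_integrable_def
  proof (intro allI impI)
    fix K :: "'a set" assume "compact K"
    then have "integrable lborel (\<lambda>x. indicator K x *\<^sub>R v x)"
      using that by (simp add: locally_integrable_def set_integrable_def)
    from integrable_bounded_linear[OF T this] show "integrable lborel (\<lambda>x. indicator K x *\<^sub>R T (v x))"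
      by (simp add: scaleR)
  qed
  have u: "locally_integrable u" "locally_integrable w" using weak by (auto simp: has_weak_laplacian_def)
  have "(\<integral>x. laplacian \<phi> x *\<^sub>R T (u x) \<partial>lborel) = (\<integral>x. \<phi> x *\<^sub>R T (w x) \<partial>lborel)" if \<phi>: "test_function \<phi>" for \<phi>
  proof -
    have K: "compact (closure {x. \<phi> x \<noteq> 0})" using \<phi> by (simp add: test_function_def)
    have "integrable lborel (\<lambda>x. laplacian \<phi> x *\<^sub>R u x)"
      by (rule integrable_scaleR_locally_integrable[OF u(1) laplacian_continuous[OF \<phi>] K laplacian_zero_outside_support])
    from integral_bounded_linear[OF T this]
    have 1: "(\<integral>x. laplacian \<phi> x *\<^sub>R T (u x) \<partial>lborel) = T (\<integral>x. laplacian \<phi> x *\<^sub>R u x \<partial>lborel)" by (simp add: scaleR)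
    have "integrable lborel (\<lambda>x. \<phi> x *\<^sub>R w x)"
      by (rule integrable_scaleR_locally_integrable[OF u(2) test_function_continuous[OF \<phi>] K])
         (use closure_subset[of "{x. \<phi> x \<noteq> 0}"] in auto)
    from integral_bounded_linear[OF T this]
    have 2: "(\<integral>x. \<phi> x *\<^sub>R T (w x) \<partial>lborel) = T (\<integral>x. \<phi> x *\<^sub>R w x \<partial>lborel)" by (simp add: scaleR)
    show ?thesis using weak \<phi> unfolding 1 2 by (simp add: has_weak_laplacian_def)
  qed
  then show ?thesis using loc u by (simp add: has_weak_laplacian_def)
qed

section \<open>Second-order linear equations on a half-line\<close>

lemma last_nonpos:
  fixes h :: "real \<Rightarrow> real"
  assumes cont: "continuous_on {x..y} h" and xy: "x < y" "h x \<le> 0" "0 < h y"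
  obtains z where "x \<le> z" "z < y" "h z = 0" "\<And>t. z < t \<Longrightarrow> t \<le> y \<Longrightarrow> 0 < h t"
proof -
  define S where "S = {x..y} \<inter> h -` {..0}"
  have "closed S" unfolding S_def by (intro continuous_closed_preimage cont) auto
  then have "compact ({x..y} \<inter> S)" by (intro compact_Int_closed) auto
  then have "compact S" by (simp add: S_def)
  moreover have "x \<in> S" using xy by (simp add: S_def)
  then have ne: "S \<noteq> {}" by blast
  ultimately obtain z where z: "z \<in> S" "\<And>t. t \<in> S \<Longrightarrow> t \<le> z"
    using compact_attains_sup[OF _ ne] by metis
  have zx: "x \<le> z" "z < y" "h z \<le> 0" using z(1) xy(3) by (auto simp: S_def order.order_iff_strict)
  have after: "0 < h t" if "z < t" "t \<le> y" for t
    using z(2)[of t] that zx(1) by (auto simp: S_def not_le[symmetric])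
  have "continuous_on {z..y} h" by (rule continuous_on_subset[OF cont]) (use zx in auto)
  then obtain t where t: "z \<le> t" "t \<le> y" "h t = 0"
    using IVT'[of h z 0 y] zx xy(3) by auto
  then have "t = z" using after[of t] by force
  then show ?thesis using that[OF zx(1,2)] t after by blast
qed

lemma first_nonpos:
  fixes h :: "real \<Rightarrow> real"
  assumes cont: "continuous_on {x..y} h" and xy: "x < y" "0 < h x" "h y \<le> 0"
  obtains z where "x < z" "z \<le> y" "h z = 0" "\<And>t. x \<le> t \<Longrightarrow> t < z \<Longrightarrow> 0 < h t"
proof -
  have c: "continuous_on {- y..- x} (\<lambda>t. h (- t))"
    by (rule continuous_on_compose2[OF cont]) (auto intro!: continuous_intros)
  obtain z where z: "- y \<le> z" "z < - x" "h (- z) = 0" "\<And>t. z < t \<Longrightarrow> t \<le> - x \<Longrightarrow> 0 < h (- t)"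
    by (rule last_nonpos[OF c]) (use xy in auto)
  show ?thesis by (rule that[of "- z"]) (use z(1-3) z(4)[of "- t" for t] in auto)
qed

lemma nonpos_of_deriv_nonpos:
  fixes W W' :: "real \<Rightarrow> real"
  assumes b: "0 < b"
    and D: "\<And>r. 0 < r \<Longrightarrow> r \<le> b \<Longrightarrow> (W has_real_derivative W' r) (at r)"
    and N: "\<And>r. 0 < r \<Longrightarrow> r < b \<Longrightarrow> W' r \<le> 0"
    and L: "(W \<longlongrightarrow> 0) (at_right 0)"
  shows "W b \<le> 0"
proof -
  have *: "W b \<le> W r" if "0 < r" "r < b" for r
  proof (rule DERIV_nonpos_imp_decreasing_open[where f=W])
    show "r \<le> b" using that by simp
    show "\<exists>y. (W has_real_derivative y) (at x) \<and> y \<le> 0" if "r < x" "x < b" for x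
      using D[of x] N[of x] that \<open>0 < r\<close> by auto
    show "continuous_on {r..b} W"
      by (rule DERIV_at_imp_continuous_on[where f'=W'], rule D)
         (use that in auto)
  qed
  have "eventually (\<lambda>r. W b \<le> W r) (at_right 0)"
    using b * by (auto simp: eventually_at_right_field)
  then show ?thesis
    using tendsto_lowerbound[OF L] by (simp add: trivial_limit_at_right_real)
qed

text \<open>All Wronskians below vanish at the origin only as limits, so sign conclusions start from this form
of the mean value theorem.\<close>

lemma neg_of_deriv_neg:
  fixes W W' :: "real \<Rightarrow> real"
  assumes b: "0 < b"
    and D: "\<And>r. 0 < r \<Longrightarrow> r \<le> b \<Longrightarrow> (W has_real_derivative W' r) (at r)"
    and N: "\<And>r. 0 < r \<Longrightarrow> r < b \<Longrightarrow> W' r < 0"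
    and L: "(W \<longlongrightarrow> 0) (at_right 0)"
  shows "W b < 0"
proof -
  have "W (b/2) \<le> 0"
    by (rule nonpos_of_deriv_nonpos[where W'=W']) (use assms in \<open>auto intro: less_imp_le\<close>)
  moreover have "W b < W (b/2)"
  proof (rule DERIV_neg_imp_decreasing_open[where f=W])
    show "b/2 < b" using b by simp
    show "\<exists>y. (W has_real_derivative y) (at x) \<and> y < 0" if "b/2 < x" "x < b" for x
      using D[of x] N[of x] that b by (intro exI[of _ "W' x"]) auto
    show "continuous_on {b/2..b} W"
      by (rule DERIV_at_imp_continuous_on[where f'=W'], rule D)
         (use b in auto)
  qed
  ultimately show ?thesis by simp
qed

lemma pos_of_deriv_pos:
  fixes W W' :: "real \<Rightarrow> real"
  assumes b: "0 < b"
    and D: "\<And>r. 0 < r \<Longrightarrow> r \<le> b \<Longrightarrow> (W has_real_derivative W' r) (at r)"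
    and N: "\<And>r. 0 < r \<Longrightarrow> r < b \<Longrightarrow> W' r > 0"
    and L: "(W \<longlongrightarrow> 0) (at_right 0)"
  shows "W b > 0"
proof -
  have "- W b < 0"
  proof (rule neg_of_deriv_neg[OF b, where W'="\<lambda>r. - W' r"])
    show "((\<lambda>a. - W a) \<longlongrightarrow> 0) (at_right 0)" using tendsto_minus[OF L] by simp
  qed (use D N in \<open>auto intro!: derivative_eq_intros\<close>)
  then show ?thesis by simp
qed

text \<open>E exp (-K r) is nonincreasing and E exp (K r) is nondecreasing, which covers both sides of x.\<close>

lemma gronwall_zero:
  fixes E E' :: "real \<Rightarrow> real"
  assumes ab: "a \<le> b"
    and D: "\<And>r. a \<le> r \<Longrightarrow> r \<le> b \<Longrightarrow> (E has_real_derivative E' r) (at r)"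
    and K: "\<And>r. a \<le> r \<Longrightarrow> r \<le> b \<Longrightarrow> \<bar>E' r\<bar> \<le> K * E r"
    and nn: "\<And>r. a \<le> r \<Longrightarrow> r \<le> b \<Longrightarrow> 0 \<le> E r"
    and x: "a \<le> x" "x \<le> b" "E x = 0" and y: "a \<le> y" "y \<le> b"
  shows "E y = 0"
proof (cases "x \<le> y")
  case True
  have "E y * exp (-K*y) \<le> E x * exp (-K*x)"
  proof (rule DERIV_nonpos_imp_nonincreasing[OF True])
    fix r assume r: "x \<le> r" "r \<le> y"
    have "((\<lambda>r. E r * exp (-K*r)) has_real_derivative (E' r - K * E r) * exp (-K*r)) (at r)"
      using r x y by (auto intro!: derivative_eq_intros D simp: algebra_simps)
    moreover have "(E' r - K * E r) * exp (-K*r) \<le> 0"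
      using K[of r] r x y by (intro mult_nonpos_nonneg) auto
    ultimately show "\<exists>z. ((\<lambda>r. E r * exp (-K*r)) has_real_derivative z) (at r) \<and> z \<le> 0" by blast
  qed
  then have "E y \<le> 0" using x by (simp add: mult_le_0_iff)
  then show ?thesis using nn[of y] y by simp
next
  case False
  have "E y * exp (K*y) \<le> E x * exp (K*x)"
  proof (rule DERIV_nonneg_imp_nondecreasing[where f="\<lambda>r. E r * exp (K*r)"])
    show "y \<le> x" using False by simp
  next
    fix r assume r: "y \<le> r" "r \<le> x"
    have "((\<lambda>r. E r * exp (K*r)) has_real_derivative (E' r + K * E r) * exp (K*r)) (at r)"
      using r x y by (auto intro!: derivative_eq_intros D simp: algebra_simps)
    moreover have "(E' r + K * E r) * exp (K*r) \<ge> 0"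
      using K[of r] r x y by (intro mult_nonneg_nonneg) auto
    ultimately show "\<exists>z. ((\<lambda>r. E r * exp (K*r)) has_real_derivative z) (at r) \<and> 0 \<le> z" by blast
  qed
  then have "E y \<le> 0" using x by (simp add: mult_le_0_iff)
  then show ?thesis using nn[of y] y by simp
qed

lemma energy_bound: "\<bar>2 * y * y1 + 2 * y1 * (c * y)\<bar> \<le> (1 + M) * (y^2 + y1^2)"
  if "\<bar>c\<bar> \<le> M" for y y1 c M :: real
proof -
  have "0 \<le> (\<bar>y\<bar> - \<bar>y1\<bar>)^2" by simp
  then have "2 * (\<bar>y\<bar> * \<bar>y1\<bar>) \<le> y^2 + y1^2" by (simp add: power2_eq_square algebra_simps)
  moreover have "\<bar>1 + c\<bar> \<le> 1 + M" using that by linarith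
  ultimately have "\<bar>1 + c\<bar> * (2 * (\<bar>y\<bar> * \<bar>y1\<bar>)) \<le> (1 + M) * (y^2 + y1^2)"
    by (intro mult_mono) (use that in auto)
  moreover have "2 * y * y1 + 2 * y1 * (c * y) = (1 + c) * (2 * (y * y1))" by algebra
  ultimately show ?thesis by (simp add: abs_mult)
qed

lemma linear_ode_unique:
  fixes y y' c :: "real \<Rightarrow> real"
  assumes D: "\<And>r. 0 < r \<Longrightarrow> (y has_real_derivative y' r) (at r)"
    and D1: "\<And>r. 0 < r \<Longrightarrow> (y' has_real_derivative c r * y r) (at r)"
    and c: "continuous_on {0<..} c"
    and x: "0 < x" "y x = 0" "y' x = 0" and r: "0 < r"
  shows "y r = 0"
proof -
  let ?a = "min x r" and ?b = "max x r"
  have "continuous_on {?a..?b} c"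
    by (rule continuous_on_subset[OF c]) (use x r in auto)
  then have "bounded (c ` {?a..?b})" by (intro compact_imp_bounded compact_continuous_image) auto
  then obtain M where M: "\<And>t. t \<in> {?a..?b} \<Longrightarrow> \<bar>c t\<bar> \<le> M"
    unfolding bounded_iff by (metis imageI real_norm_def)
  have "(y r)^2 + (y' r)^2 = 0"
  proof (rule gronwall_zero[where E="\<lambda>r. (y r)^2 + (y' r)^2" and a="?a" and b="?b" and x=x
      and E'="\<lambda>t. 2 * y t * y' t + 2 * y' t * (c t * y t)" and K="1 + M"])
    fix t assume t: "?a \<le> t" "t \<le> ?b"
    then have "0 < t" using x r by (auto simp: min_def split: if_splits)
    then show "((\<lambda>r. (y r)^2 + (y' r)^2) has_real_derivative
        2 * y t * y' t + 2 * y' t * (c t * y t)) (at t)"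
      by (auto intro!: derivative_eq_intros D D1)
    show "\<bar>2 * y t * y' t + 2 * y' t * (c t * y t)\<bar> \<le> (1 + M) * ((y t)^2 + (y' t)^2)"
      by (rule energy_bound) (use M t in auto)
  qed (use x r in auto)
  then show ?thesis by simp
qed

lemma linear_ode_unique_at_0:
  fixes y y' c :: "real \<Rightarrow> real"
  assumes D: "\<And>r. 0 < r \<Longrightarrow> (y has_real_derivative y' r) (at r)"
    and D1: "\<And>r. 0 < r \<Longrightarrow> (y' has_real_derivative c r * y r) (at r)"
    and c: "continuous_on {0..} c"
    and L: "(y \<longlongrightarrow> 0) (at_right 0)" "(y' \<longlongrightarrow> 0) (at_right 0)" and r: "0 < r"
  shows "y r = 0"
proof -
  have "continuous_on {0..r} c"
    by (rule continuous_on_subset[OF c]) auto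
  then have "bounded (c ` {0..r})" by (intro compact_imp_bounded compact_continuous_image) auto
  then obtain M where M: "\<And>t. t \<in> {0..r} \<Longrightarrow> \<bar>c t\<bar> \<le> M"
    unfolding bounded_iff by (metis imageI real_norm_def)
  let ?E = "\<lambda>r. ((y r)^2 + (y' r)^2) * exp (-(1+M)*r)"
  let ?E' = "\<lambda>t. (2 * y t * y' t + 2 * y' t * (c t * y t) - (1+M) * ((y t)^2 + (y' t)^2)) * exp (-(1+M)*t)"
  have "?E r \<le> 0"
  proof (rule nonpos_of_deriv_nonpos[where W'="?E'" and W="?E"])
    fix t assume t: "0 < t" "t \<le> r"
    then show "(?E has_real_derivative ?E' t) (at t)"
      by (auto intro!: derivative_eq_intros D D1 simp: algebra_simps)
  next
    fix t assume t: "0 < t" "t < r"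
    have "\<bar>2 * y t * y' t + 2 * y' t * (c t * y t)\<bar> \<le> (1 + M) * ((y t)^2 + (y' t)^2)"
      by (rule energy_bound) (use M t in auto)
    then show "?E' t \<le> 0" by (intro mult_nonpos_nonneg) auto
  next
    show "(?E \<longlongrightarrow> 0) (at_right 0)"
      by (auto intro!: tendsto_eq_intros L)
  qed fact
  then have "(y r)^2 + (y' r)^2 \<le> 0" by (simp add: mult_le_0_iff)
  then show ?thesis using sum_power2_le_zero_iff by blast
qed

text \<open>Where V \<ge> k > 0 a positive solution is convex.  If its derivative is ever positive, the solution
grows at least quadratically.  Otherwise it decreases, and two rounds of the mean value theorem
between (r + R)/2 and r bound the solution by a multiple of 1/r^2 and its derivative by one
of 1/r^3, which is enough for all boundary terms at infinity to vanish.\<close>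

lemma growth_alternative:
  fixes \<sigma> \<sigma>1 V :: "real \<Rightarrow> real"
  assumes D: "\<And>r. R \<le> r \<Longrightarrow> (\<sigma> has_real_derivative \<sigma>1 r) (at r)"
    and D1: "\<And>r. R \<le> r \<Longrightarrow> (\<sigma>1 has_real_derivative V r * \<sigma> r) (at r)"
    and V: "\<And>r. R \<le> r \<Longrightarrow> k \<le> V r" and k: "0 < k"
    and pos: "\<And>r. R \<le> r \<Longrightarrow> 0 < \<sigma> r"
  shows "((\<lambda>r. r * \<sigma> r) \<longlongrightarrow> 0) at_top \<and> ((\<lambda>r. r * \<sigma>1 r) \<longlongrightarrow> 0) at_top
       \<or> filterlim (\<lambda>r. \<sigma> r / r) at_top at_top"
proof -
  have mono1: "\<sigma>1 x \<le> \<sigma>1 y" if "R \<le> x" "x \<le> y" for x y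
  proof (rule DERIV_nonneg_imp_nondecreasing[OF that(2)])
    fix t assume "x \<le> t" "t \<le> y"
    then have "R \<le> t" using that by simp
    then show "\<exists>z. (\<sigma>1 has_real_derivative z) (at t) \<and> 0 \<le> z"
      using D1[of t] V[of t] k pos[of t] by (intro exI[of _ "V t * \<sigma> t"]) auto
  qed
  have mv: "\<exists>z. x < z \<and> z < y \<and> \<sigma> y - \<sigma> x = (y - x) * \<sigma>1 z" if "R \<le> x" "x < y" for x y
    by (rule MVT2[OF that(2)]) (use that D in auto)
  have mv1: "\<exists>z. x < z \<and> z < y \<and> \<sigma>1 y - \<sigma>1 x = (y - x) * (V z * \<sigma> z)" if "R \<le> x" "x < y" for x y
    by (rule MVT2[OF that(2)]) (use that D1 in auto)
  show ?thesis
  proof (cases "\<exists>r\<ge>R. \<sigma>1 r > 0")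
    case True
    then obtain a where a: "R \<le> a" "\<sigma>1 a > 0" by auto
    have s1: "\<sigma> x \<le> \<sigma> y" if "a \<le> x" "x \<le> y" for x y
    proof (rule DERIV_nonneg_imp_nondecreasing[OF that(2)])
      fix t assume "x \<le> t" "t \<le> y"
      then have "R \<le> t" "\<sigma>1 t \<ge> 0" using that a mono1[of a t] by auto
      then show "\<exists>z. (\<sigma> has_real_derivative z) (at t) \<and> 0 \<le> z"
        using D[of t] by auto
    qed
    have s2: "\<sigma>1 x \<ge> k * \<sigma> a * (x - a)" if ax: "a < x" for x
    proof -
      obtain z where z: "a < z" "z < x" "\<sigma>1 x - \<sigma>1 a = (x - a) * (V z * \<sigma> z)"
        using mv1[of a x] a ax by blast
      have "k * \<sigma> a \<le> V z * \<sigma> z"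
        using V[of z] s1[of a z] z a k pos[of a] by (intro mult_mono) auto
      then have "(x - a) * (k * \<sigma> a) \<le> (x - a) * (V z * \<sigma> z)"
        using that by (intro mult_left_mono) auto
      then show ?thesis using z a by (simp add: algebra_simps)
    qed
    have s3: "\<sigma> x \<ge> (x - a)/2 * (k * \<sigma> a * ((x - a)/2))" if x: "a < x" for x
    proof -
      obtain z where z: "(a+x)/2 < z" "z < x" "\<sigma> x - \<sigma> ((a+x)/2) = (x - (a+x)/2) * \<sigma>1 z"
        using mv[of "(a+x)/2" x] a x by force
      have "k * \<sigma> a * ((x - a)/2) \<le> k * \<sigma> a * (z - a)"
        using z k pos[of a] a by (intro mult_left_mono) (auto simp: field_simps)
      also have "\<dots> \<le> \<sigma>1 z" using s2[of z] z x by (simp add: field_simps)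
      finally have "(x - a)/2 * (k * \<sigma> a * ((x - a)/2)) \<le> (x - a)/2 * \<sigma>1 z"
        using that by (intro mult_left_mono) auto
      also have "\<dots> = \<sigma> x - \<sigma> ((a+x)/2)" using z by (simp add: field_simps)
      also have "\<dots> \<le> \<sigma> x" using pos[of "(a+x)/2"] a x by (simp add: field_simps)
      finally show ?thesis .
    qed
    have "k * \<sigma> a > 0" using k pos a by auto
    then have "filterlim (\<lambda>x. (x - a)/2 * (k * \<sigma> a * ((x - a)/2)) / x) at_top at_top"
      by real_asymp
    then have "filterlim (\<lambda>r. \<sigma> r / r) at_top at_top"
    proof (rule filterlim_at_top_mono)
      show "\<forall>\<^sub>F x in at_top. (x - a)/2 * (k * \<sigma> a * ((x - a)/2)) / x \<le> \<sigma> x / x"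
        using eventually_gt_at_top[of a] eventually_gt_at_top[of 0]
        by eventually_elim (rule divide_right_mono, use s3 in auto)
    qed
    then show ?thesis by simp
  next
    case False
    then have neg: "\<sigma>1 r \<le> 0" if "R \<le> r" for r using that by force
    have dec: "\<sigma> y \<le> \<sigma> x" if "R \<le> x" "x \<le> y" for x y
    proof (rule DERIV_nonpos_imp_nonincreasing[OF that(2)])
      fix t assume "x \<le> t" "t \<le> y"
      then have "R \<le> t" using that by simp
      then show "\<exists>z. (\<sigma> has_real_derivative z) (at t) \<and> z \<le> 0" using D neg by auto
    qed
    have A: "(y - x) * (- \<sigma>1 y) \<le> \<sigma> x" if xy: "R \<le> x" "x < y" for x y
    proof -
      obtain z where z: "x < z" "z < y" "\<sigma> y - \<sigma> x = (y - x) * \<sigma>1 z" using mv[OF xy] by blast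
      have "(y - x) * (- \<sigma>1 y) \<le> (y - x) * (- \<sigma>1 z)"
        using z that mono1[of z y] by (intro mult_left_mono) auto
      also have "\<dots> = \<sigma> x - \<sigma> y" using z(3) by simp
      also have "\<dots> \<le> \<sigma> x" using pos[of y] xy by simp
      finally show ?thesis .
    qed
    have B: "(y - x) * (k * \<sigma> y) \<le> - \<sigma>1 x" if xy: "R \<le> x" "x < y" for x y
    proof -
      obtain z where z: "x < z" "z < y" "\<sigma>1 y - \<sigma>1 x = (y - x) * (V z * \<sigma> z)"
        using mv1[OF xy] by blast
      have "k * \<sigma> y \<le> V z * \<sigma> z"
        using z that V[of z] dec[of z y] k pos[of y] by (intro mult_mono) auto
      then have "(y - x) * (k * \<sigma> y) \<le> (y - x) * (V z * \<sigma> z)"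
        using that by (intro mult_left_mono) auto
      also have "\<dots> = \<sigma>1 y - \<sigma>1 x" using z(3) by simp
      also have "\<dots> \<le> - \<sigma>1 x" using neg[of y] xy by simp
      finally show ?thesis .
    qed
    let ?h = "\<lambda>r. (r - R)/2"
    have C: "\<sigma> r \<le> \<sigma> R / (k * ?h r * ?h r)" if r: "R < r" for r
    proof -
      let ?m = "(r + R)/2"
      have m: "R < ?m" "?m < r" using r by auto
      have h: "r - ?m = ?h r" "?m - R = ?h r" by (auto simp: field_simps)
      have h0: "?h r > 0" using r by auto
      have 1: "?h r * (k * \<sigma> r) \<le> - \<sigma>1 ?m" using B[OF less_imp_le[OF m(1)] m(2)] unfolding h .
      have 2: "?h r * (- \<sigma>1 ?m) \<le> \<sigma> R" using A[OF order_refl m(1)] unfolding h .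
      have "?h r * (?h r * (k * \<sigma> r)) \<le> ?h r * (- \<sigma>1 ?m)"
        by (rule mult_left_mono[OF 1]) (use h0 in simp)
      from order_trans[OF this 2] have "\<sigma> r * (k * ?h r * ?h r) \<le> \<sigma> R"
        by (simp only: mult_ac)
      moreover have "k * ?h r * ?h r > 0" using h0 k by (intro mult_pos_pos)
      ultimately show ?thesis by (simp only: pos_le_divide_eq)
    qed
    have E: "- \<sigma>1 r \<le> (\<sigma> R / (k * (?h r/2) * (?h r/2))) / ?h r" if r: "R < r" for r
    proof -
      let ?m = "(r + R)/2"
      have m: "R < ?m" "?m < r" using r by auto
      have h: "r - ?m = ?h r" "?h ?m = ?h r / 2" by (auto simp: field_simps)
      have h0: "?h r > 0" using r by auto
      have "?h r * (- \<sigma>1 r) \<le> \<sigma> ?m" using A[OF less_imp_le[OF m(1)] m(2)] unfolding h .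
      also have "\<dots> \<le> \<sigma> R / (k * (?h r/2) * (?h r/2))" using C[OF m(1)] unfolding h .
      finally show ?thesis using h0 by (simp only: pos_le_divide_eq mult.commute)
    qed
    have "((\<lambda>r. r * \<sigma> r) \<longlongrightarrow> 0) at_top"
    proof (rule tendsto_sandwich[of "\<lambda>_. 0" _ _ "\<lambda>r. r * (\<sigma> R / (k * ?h r * ?h r))"])
      show "\<forall>\<^sub>F r in at_top. 0 \<le> r * \<sigma> r"
        using eventually_gt_at_top[of R] eventually_gt_at_top[of 0]
        by eventually_elim (use pos in \<open>auto intro: less_imp_le\<close>)
      show "\<forall>\<^sub>F r in at_top. r * \<sigma> r \<le> r * (\<sigma> R / (k * ?h r * ?h r))"
        using eventually_gt_at_top[of R] eventually_gt_at_top[of 0]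
        by eventually_elim (use C in \<open>intro mult_left_mono, auto\<close>)
      show "((\<lambda>r. r * (\<sigma> R / (k * ?h r * ?h r))) \<longlongrightarrow> 0) at_top"
        using k by real_asymp
    qed simp
    moreover have "((\<lambda>r. r * (- \<sigma>1 r)) \<longlongrightarrow> 0) at_top"
    proof (rule tendsto_sandwich[of "\<lambda>_. 0" _ _ "\<lambda>r. r * ((\<sigma> R / (k * (?h r/2) * (?h r/2))) / ?h r)"])
      show "\<forall>\<^sub>F r in at_top. 0 \<le> r * (- \<sigma>1 r)"
        using eventually_gt_at_top[of R] eventually_gt_at_top[of 0]
        by eventually_elim (use neg in \<open>auto simp: mult_le_0_iff\<close>)
      show "\<forall>\<^sub>F r in at_top. r * (- \<sigma>1 r) \<le> r * ((\<sigma> R / (k * (?h r/2) * (?h r/2))) / ?h r)"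
        using eventually_gt_at_top[of R] eventually_gt_at_top[of 0]
        by eventually_elim (rule mult_left_mono, use E in auto)
      show "((\<lambda>r. r * ((\<sigma> R / (k * (?h r/2) * (?h r/2))) / ?h r)) \<longlongrightarrow> 0) at_top"
        using k by real_asymp
    qed simp
    ultimately show ?thesis using tendsto_minus_cancel_left[of "\<lambda>r. r * \<sigma>1 r" 0] by simp
  qed
qed

text \<open>Since c s extends continuously to 0, the derivative s' differs from the antiderivative of c s by a
constant and has a limit.\<close>

lemma regular_at_0:
  fixes s s' c :: "real \<Rightarrow> real"
  assumes D: "\<And>r. 0 < r \<Longrightarrow> (s has_real_derivative s' r) (at r)"
    and D': "\<And>r. 0 < r \<Longrightarrow> (s' has_real_derivative c r * s r) (at r)"
    and c: "continuous_on {0..} c" and s0: "(s \<longlongrightarrow> 0) (at_right 0)"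
  obtains l where "(s' \<longlongrightarrow> l) (at_right 0)" "((\<lambda>r. s r / r) \<longlongrightarrow> l) (at_right 0)"
proof -
  have pos: "\<forall>\<^sub>F r::real in at_right 0. 0 < r" by (simp add: eventually_at_right_less)
  define m where "m r = c r * (if r = 0 then 0 else s r)" for r
  have at0: "at 0 within {0..R} = at_right 0" if "0 < R" for R :: real
    by (rule at_within_Icc_at_right[OF that])
  have m_cont: "continuous_on {0..R} m" if "0 < R" for R
    unfolding continuous_on_eq_continuous_within
  proof
    fix x assume x: "x \<in> {0..R}"
    have cR: "continuous_on {0..R} c" by (rule continuous_on_subset[OF c]) auto
    then have cx: "continuous (at x within {0..R}) c" using x by (simp add: continuous_on_eq_continuous_within)
    have "continuous (at x within {0..R}) (\<lambda>r. if r = 0 then 0 else s r)"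
    proof (cases "x = 0")
      case True
      have "((\<lambda>r. if r = 0 then 0 else s r) \<longlongrightarrow> 0) (at_right 0)"
        by (rule Lim_transform_eventually[OF s0]) (use pos in eventually_elim, auto)
      then show ?thesis using True at0[OF that] by (simp add: continuous_within)
    next
      case False
      then have "0 < x" using x by simp
      have "((\<lambda>r. if r = 0 then 0 else s r) has_real_derivative s' x) (at x)"
        by (rule has_field_derivative_transform_within_open[OF D[OF \<open>0 < x\<close>], where S="{0<..}"])
           (use \<open>0 < x\<close> in simp_all)
      from DERIV_isCont[OF this] show ?thesis by (rule continuous_at_imp_continuous_at_within)
    qed
    then show "continuous (at x within {0..R}) m"
      unfolding m_def[abs_def] by (intro continuous_mult cx)
  qed
  define I where "I r = integral {0..r} m" for r
  have DI: "(I has_real_derivative c r * s r) (at r)" if r: "0 < r" for r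
  proof -
    have "(I has_real_derivative m r) (at r within {0..r+1})"
      unfolding I_def[abs_def] by (rule integral_has_real_derivative[OF m_cont]) (use r in auto)
    moreover have "at r within {0..r+1} = at r" by (rule at_within_interior) (use r in auto)
    ultimately show ?thesis using r by (simp add: m_def)
  qed
  have "\<exists>k. \<forall>r\<in>{0<..}. s' r - I r = k"
  proof (rule has_field_derivative_zero_constant)
    show "((\<lambda>r. s' r - I r) has_real_derivative 0) (at r within {0<..})" if "r \<in> {0<..}" for r
      using DERIV_diff[OF D'[of r] DI[of r]] that by (auto intro: has_field_derivative_at_within)
  qed simp
  then obtain k where k: "\<And>r. 0 < r \<Longrightarrow> s' r - I r = k" by auto
  have "continuous_on {0..1} I" unfolding I_def[abs_def]
    by (rule indefinite_integral_continuous_1[OF integrable_continuous_interval[OF m_cont]]) simp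
  then have "(I \<longlongrightarrow> I 0) (at 0 within {0..1})" by (simp add: continuous_on_def)
  then have "(I \<longlongrightarrow> I 0) (at_right 0)" unfolding at0[OF zero_less_one] .
  then have "((\<lambda>r. k + I r) \<longlongrightarrow> k + I 0) (at_right 0)" by (intro tendsto_intros)
  then have l: "(s' \<longlongrightarrow> k + I 0) (at_right 0)"
    by (rule Lim_transform_eventually) (use pos in eventually_elim, use k in \<open>simp add: algebra_simps\<close>)
  have "((\<lambda>r. s r / r) \<longlongrightarrow> k + I 0) (at_right 0)"
  proof (rule lhopital_right_0[where f'=s' and g'="\<lambda>_. 1"])
    show "((\<lambda>x. x) \<longlongrightarrow> 0) (at_right (0::real))" by (rule tendsto_ident_at)
    show "\<forall>\<^sub>F x in at_right 0. (s has_real_derivative s' x) (at x)" using pos by eventually_elim (rule D)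
    show "\<forall>\<^sub>F x::real in at_right 0. x \<noteq> 0" using pos by eventually_elim simp
  qed (use l s0 in auto)
  with l show ?thesis by (rule that)
qed

lemma tendsto_0_of_mult_id:
  fixes h :: "real \<Rightarrow> real"
  assumes "((\<lambda>r. r * h r) \<longlongrightarrow> 0) at_top" shows "(h \<longlongrightarrow> 0) at_top"
proof -
  have "((\<lambda>r. r * h r * (1/r)) \<longlongrightarrow> 0 * 0) at_top" by (intro tendsto_mult assms) real_asymp
  moreover have "\<forall>\<^sub>F r in at_top. r * h r * (1/r) = h r"
    by (rule eventually_mono[OF eventually_gt_at_top[of "0::real"]]) simp
  ultimately show ?thesis using Lim_transform_eventually by fastforce
qed

lemma tail_integral_tendsto_0:
  fixes g :: "real \<Rightarrow> real"
  assumes "set_integrable lborel {0<..} g"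
  shows "((\<lambda>r. set_lebesgue_integral lborel {r..} g) \<longlongrightarrow> 0) at_top"
proof -
  have "((\<lambda>r. \<integral>x. indicator {r..} x * (indicator {0<..} x * g x) \<partial>lborel) \<longlongrightarrow>
      integral\<^sup>L lborel (\<lambda>x::real. 0::real)) at_top"
  proof (rule integral_dominated_convergence_at_top[where w="\<lambda>x. \<bar>indicator {0<..} x * g x\<bar>"])
    show "AE x in lborel. ((\<lambda>r. indicator {r..} x * (indicator {0<..} x * g x)) \<longlongrightarrow> 0) at_top"
    proof (intro AE_I2)
      fix x :: real
      have "\<forall>\<^sub>F r in at_top. indicator {r..} x * (indicator {0<..} x * g x) = 0"
        using eventually_gt_at_top[of x] by eventually_elim auto
      then show "((\<lambda>r. indicator {r..} x * (indicator {0<..} x * g x)) \<longlongrightarrow> 0) at_top"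
        by (rule tendsto_eventually)
    qed
    show "\<forall>\<^sub>F r in at_top. AE x in lborel. norm (indicator {r..} x * (indicator {0<..} x * g x))
        \<le> \<bar>indicator {0<..} x * g x\<bar>"
      by (intro always_eventually allI AE_I2) (auto simp: indicator_def)
    show "integrable lborel (\<lambda>x. \<bar>indicator {0<..} x * g x\<bar>)"
      using assms unfolding set_integrable_def by (intro integrable_abs) (simp add: mult.commute)
    have m: "(\<lambda>x. indicator {0<..} x * g x) \<in> borel_measurable lborel"
      using assms unfolding set_integrable_def
      by (intro borel_measurable_integrable) simp
    show "(\<lambda>x. indicator {r..} x * (indicator {0<..} x * g x)) \<in> borel_measurable lborel" for r
      by (intro borel_measurable_times m) simp
  qed simp_all
  moreover have "\<forall>\<^sub>F r in at_top. (\<integral>x. indicator {r..} x * (indicator {0<..} x * g x) \<partial>lborel)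
      = set_lebesgue_integral lborel {r..} g"
    using eventually_gt_at_top[of "0::real"]
  proof eventually_elim
    case (elim r)
    then show ?case unfolding set_lebesgue_integral_def
      by (intro Bochner_Integration.integral_cong) (auto simp: indicator_def)
  qed
  ultimately show ?thesis using Lim_transform_eventually by fastforce
qed

lemma tail_integral_lower_bound:
  fixes g :: "real \<Rightarrow> real"
  assumes g: "set_integrable lborel {0<..} g" and R: "0 < R" "R \<le> a" "a \<le> b"
    and nn: "\<And>x. 0 < x \<Longrightarrow> 0 \<le> g x" and m: "\<And>x. a \<le> x \<Longrightarrow> x \<le> b \<Longrightarrow> m \<le> g x"
  shows "(b - a) * m \<le> set_lebesgue_integral lborel {R..} g"
proof -
  have "(b - a) * m = set_lebesgue_integral lborel {a..b} (\<lambda>_. m)"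
    using R by (simp add: set_lebesgue_integral_def)
  also have "\<dots> \<le> set_lebesgue_integral lborel {R..} g"
    unfolding set_lebesgue_integral_def
  proof (rule integral_mono)
    show "integrable lborel (\<lambda>x. indicat_real {a..b} x *\<^sub>R m)"
      by (intro integrable_scaleR_left integrable_real_indicator) (simp_all add: emeasure_lborel_Icc_eq)
    have "set_integrable lborel {R..} g"
      by (rule set_integrable_subset[OF g]) (use R in auto)
    then show "integrable lborel (\<lambda>x. indicat_real {R..} x *\<^sub>R g x)"
      by (simp add: set_integrable_def)
    show "indicat_real {a..b} x *\<^sub>R m \<le> indicat_real {R..} x *\<^sub>R g x" for x
      using nn[of x] m[of x] R by (auto simp: indicator_def)
  qed
  finally show ?thesis .
qed

text \<open>From s'' \<ge> - s / 4 a large value of s persists over a unit interval on one side of the point: the Wronskian of s with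
the comparison function 1 - (r - a)^2 / 4 has a sign there.  So pointwise values are controlled by tails of the integral.\<close>

lemma tendsto_0_of_square_integrable:
  fixes s s1 s2 :: "real \<Rightarrow> real"
  assumes D: "\<And>r. 0 < r \<Longrightarrow> (s has_real_derivative s1 r) (at r)"
    and D1: "\<And>r. 0 < r \<Longrightarrow> (s1 has_real_derivative s2 r) (at r)"
    and s2: "\<And>r. 0 < r \<Longrightarrow> s2 r \<ge> - s r / 4"
    and nn: "\<And>r. 0 < r \<Longrightarrow> 0 \<le> s r"
    and I: "set_integrable lborel {0<..} (\<lambda>r. (s r)\<^sup>2)"
  shows "(s \<longlongrightarrow> 0) at_top"
proof -
  have far: "s x \<ge> s a / 2" if side: "a > 1" "(s1 a \<ge> 0 \<and> a \<le> x \<and> x \<le> a + 1) \<or> (s1 a \<le> 0 \<and> a - 1 \<le> x \<and> x \<le> a)"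
    for a x
  proof -
    \<comment> \<open>Any c with c'' \<le> - c / 4 that stays near 1 over unit distance would do; for this one c'' = -1/2 and c \<le> 1.\<close>
    let ?c = "\<lambda>r. 1 - (r - a)^2/4"
    let ?c' = "\<lambda>r. - (r - a)/2"
    let ?N = "\<lambda>r. s1 r * ?c r - s r * ?c' r"
    have cb: "?c r \<ge> 3/4" "?c r \<le> 1" if "\<bar>r - a\<bar> \<le> 1" for r
      using abs_le_square_iff[of "r-a" 1] that by auto
    have DN: "(?N has_real_derivative (s2 r * ?c r + s r * (1/2))) (at r)" if "0 < r" for r
      by (rule derivative_eq_intros refl D[OF that] D1[OF that] | simp add: field_simps power2_eq_square)+
    have N0: "s2 r * ?c r + s r * (1/2) \<ge> 0" if "\<bar>r - a\<bar> \<le> 1" "0 < r" for r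
    proof -
      have "s2 r * ?c r \<ge> - s r / 4 * ?c r" using s2[of r] cb[of r] that by (intro mult_right_mono) auto
      moreover have "s r / 4 * ?c r \<le> s r / 4" using nn[of r] cb[of r] that
        by (intro mult_left_le) auto
      ultimately show ?thesis using nn[of r] that by linarith
    qed
    have Dq: "((\<lambda>r. s r / ?c r) has_real_derivative ?N r / (?c r)^2) (at r)" if "\<bar>r - a\<bar> \<le> 1" "0 < r" for r
    proof -
      have c0: "?c r \<noteq> 0" using cb(1)[OF that(1)] by linarith
      have "(?c has_real_derivative ?c' r) (at r)"
        by (auto intro!: derivative_eq_intros simp: field_simps)
      from DERIV_divide[OF D[OF that(2)] this c0] show ?thesis
        by (simp only: power2_eq_square)
    qed
    have mono: "?N u \<le> ?N v" if "0 < u" "u \<le> v" "\<bar>u - a\<bar> \<le> 1" "\<bar>v - a\<bar> \<le> 1" for u v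
    proof (rule DERIV_nonneg_imp_nondecreasing[where f="?N", OF that(2)])
      fix r assume "u \<le> r" "r \<le> v"
      then have "0 < r" "\<bar>r - a\<bar> \<le> 1" using that by auto
      then show "\<exists>y. (?N has_real_derivative y) (at r) \<and> 0 \<le> y"
        using DN N0 by blast
    qed
    have "s a \<le> s x / ?c x"
      using side(2)
    proof
      assume A: "s1 a \<ge> 0 \<and> a \<le> x \<and> x \<le> a + 1"
      have "s a / ?c a \<le> s x / ?c x"
      proof (rule DERIV_nonneg_imp_nondecreasing[where f="\<lambda>r. s r / ?c r"])
        fix t assume t: "a \<le> t" "t \<le> x"
        have "?N a \<le> ?N t"
          by (rule mono) (use t A side(1) in auto)
        then have "?N t \<ge> 0" using A by simp
        then show "\<exists>y. ((\<lambda>r. s r / ?c r) has_real_derivative y) (at t) \<and> 0 \<le> y"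
          using Dq[of t] t A side(1) by (intro exI[of _ "?N t / (?c t)^2"]) auto
      qed (use A in simp)
      then show ?thesis by simp
    next
      assume A: "s1 a \<le> 0 \<and> a - 1 \<le> x \<and> x \<le> a"
      have "s x / ?c x \<ge> s a / ?c a"
      proof (rule DERIV_nonpos_imp_nonincreasing[where f="\<lambda>r. s r / ?c r"])
        fix t assume t: "x \<le> t" "t \<le> a"
        have "?N t \<le> ?N a"
          by (rule mono) (use t A side(1) in auto)
        then have "?N t \<le> 0" using A by simp
        then show "\<exists>y. ((\<lambda>r. s r / ?c r) has_real_derivative y) (at t) \<and> y \<le> 0"
          using Dq[of t] t A side(1)
          by (intro exI[of _ "?N t / (?c t)^2"]) (auto simp: divide_nonpos_nonneg)
      qed (use A in simp)
      then show ?thesis by simp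
    qed
    moreover have "\<bar>x - a\<bar> \<le> 1" "0 < x" using side by auto
    moreover have "s x / ?c x \<le> s x / (3/4)"
      using cb[of x] nn[of x] \<open>\<bar>x - a\<bar> \<le> 1\<close> \<open>0 < x\<close> by (intro divide_left_mono) auto
    ultimately have "s a \<le> s x / (3/4)" "0 \<le> s x"
      using nn[of x] by (blast intro: order_trans)+
    then show ?thesis by simp
  qed
  have low: "(s a)^2 / 4 \<le> set_lebesgue_integral lborel {a - 1..} (\<lambda>r. (s r)^2)" if a: "a > 1" for a
  proof -
    obtain u where u: "a - 1 \<le> u" "\<And>x. u \<le> x \<Longrightarrow> x \<le> u + 1 \<Longrightarrow> s a / 2 \<le> s x"
    proof (cases "s1 a \<ge> 0")
      case True then show ?thesis using far[OF a] that[of a] by auto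
    next
      case False then show ?thesis using far[OF a] that[of "a - 1"] by auto
    qed
    have "(u + 1 - u) * (s a / 2)^2 \<le> set_lebesgue_integral lborel {a - 1..} (\<lambda>r. (s r)^2)"
    proof (rule tail_integral_lower_bound[OF I])
      show "(s a / 2)^2 \<le> (s x)^2" if "u \<le> x" "x \<le> u + 1" for x
        using u(2)[OF that] nn[of a] a by (intro power_mono) auto
    qed (use u a in auto)
    then show ?thesis by (simp add: power_divide)
  qed
  have "((\<lambda>a. set_lebesgue_integral lborel {a - 1..} (\<lambda>r. (s r)^2)) \<longlongrightarrow> 0) at_top"
    by (rule filterlim_compose[OF tail_integral_tendsto_0[OF I]]) real_asymp
  then have "((\<lambda>a. (s a)^2 / 4) \<longlongrightarrow> 0) at_top"
  proof (rule tendsto_sandwich[rotated 2, OF tendsto_const])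
    show "\<forall>\<^sub>F a in at_top. (s a)^2 / 4 \<le> set_lebesgue_integral lborel {a - 1..} (\<lambda>r. (s r)^2)"
      by (rule eventually_mono[OF eventually_gt_at_top[of 1]]) (rule low)
  qed simp
  then have "((\<lambda>a. (s a)^2 / 4 * 4) \<longlongrightarrow> 0 * 4) at_top" by (intro tendsto_intros)
  then have "((\<lambda>a. sqrt ((s a)^2)) \<longlongrightarrow> sqrt 0) at_top" by (intro tendsto_intros) simp
  then show ?thesis by (simp add: tendsto_rabs_zero_iff)
qed

section \<open>The soliton profile: sign, decay and monotonicity\<close>

lemma at_right_0_I:
  fixes b :: real
  assumes "\<And>r. 0 < r \<Longrightarrow> r < b \<Longrightarrow> P r" "0 < b"
  shows "eventually P (at_right 0)"
  unfolding eventually_at_right_field by (rule exI[of _ b]) (use assms in auto)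

text \<open>The radial form of the soliton equation.  The assumption on r^2 p' is the regularity at the
origin: there is no flux of the gradient field through small spheres.\<close>

locale soliton_ode =
  fixes \<omega> :: real and p p1 :: "real \<Rightarrow> real"
  assumes \<omega>: "0 < \<omega>" "\<omega> < 1/4"
    and Dp: "\<And>r. 0 < r \<Longrightarrow> (p has_real_derivative p1 r) (at r)"
    and Dp1: "\<And>r. 0 < r \<Longrightarrow>
      (p1 has_real_derivative (-2/r * p1 r - (p r ^ 3 - p r ^ 5 - \<omega> * p r))) (at r)"
    and p_at_0: "(p \<longlongrightarrow> p 0) (at_right 0)"
    and flux_at_0: "((\<lambda>r. r\<^sup>2 * p1 r) \<longlongrightarrow> 0) (at_right 0)"
    and p_nonneg: "\<And>r. 0 < r \<Longrightarrow> 0 \<le> p r"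
    and p_nontrivial: "\<exists>r>0. p r \<noteq> 0"
    and p_L2: "set_integrable lborel {0<..} (\<lambda>r. (r * p r)\<^sup>2)"
begin

text \<open>The nonlinearity, its derivative, the factor in f(x) = x g(x^2), and the antiderivative of f.\<close>

definition f :: "real \<Rightarrow> real" where "f x = x^3 - x^5 - \<omega> * x"
definition f1 :: "real \<Rightarrow> real" where "f1 x = 3*x^2 - 5*x^4 - \<omega>"
definition g :: "real \<Rightarrow> real" where "g q = q - q\<^sup>2 - \<omega>"
definition F :: "real \<Rightarrow> real" where "F x = x^4/4 - x^6/6 - \<omega> * x^2 / 2"

lemma f_g: "f x = x * g (x\<^sup>2)"
  by (simp add: f_def g_def algebra_simps power_numeral_reduce)

lemma Df: "(f has_real_derivative f1 x) (at x)"
  unfolding f_def f1_def by (auto intro!: derivative_eq_intros)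

lemma DF: "(F has_real_derivative f x) (at x)"
  unfolding F_def f_def by (auto intro!: derivative_eq_intros simp: field_simps)

lemma Dp1': "0 < r \<Longrightarrow> (p1 has_real_derivative (-2/r * p1 r - f (p r))) (at r)"
  using Dp1 by (simp add: f_def)

lemma p_cont: "continuous_on {0..} p"
  unfolding continuous_on_eq_continuous_within
proof
    fix x :: real assume "x \<in> {0..}"
    show "continuous (at x within {0..}) p"
    proof (cases "x = 0")
      case True
      have "at 0 within {0..} = at_right (0::real)"
        by (metis at_within_Icc_at_right at_within_Ici_at_right)
      then show ?thesis using p_at_0 True by (simp add: continuous_within)
    next
      case False
      then have "isCont p x" using Dp[of x] \<open>x \<in> {0..}\<close> by (intro DERIV_isCont) auto
      then show ?thesis by (rule continuous_at_imp_continuous_at_within)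
    qed
qed

lemma p_cont_pos: "continuous_on {0<..} p"
  by (rule continuous_on_subset[OF p_cont]) auto

lemma Dflux: "0 < r \<Longrightarrow> ((\<lambda>r. r\<^sup>2 * p1 r) has_real_derivative - (r\<^sup>2 * f (p r))) (at r)"
  by (auto intro!: derivative_eq_intros Dp1' simp: field_simps power2_eq_square)

lemma Drp: "0 < r \<Longrightarrow> ((\<lambda>r. r * p r) has_real_derivative p r + r * p1 r) (at r)"
  by (auto intro!: derivative_eq_intros Dp)

lemma Drp1: "0 < r \<Longrightarrow> ((\<lambda>r. p r + r * p1 r) has_real_derivative (p r ^ 4 - p r ^ 2 + \<omega>) * (r * p r)) (at r)"
  by (auto intro!: derivative_eq_intros Dp Dp1 simp: field_simps power_numeral_reduce)

text \<open>r^2 p' is the integral of - t^2 f(p), which is at most a multiple of r^3.\<close>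

lemma p1_linear_bound: "\<exists>C. \<forall>r. 0 < r \<and> r \<le> 1 \<longrightarrow> \<bar>p1 r\<bar> \<le> C * r"
proof -
  have "continuous_on {0..1} (\<lambda>r. f (p r))"
    unfolding f_def by (intro continuous_intros continuous_on_subset[OF p_cont]) auto
  then have "bounded ((\<lambda>r. f (p r)) ` {0..1})"
    by (intro compact_imp_bounded compact_continuous_image) auto
  then obtain M where M: "\<And>t. t \<in> {0..1} \<Longrightarrow> \<bar>f (p t)\<bar> \<le> M"
    unfolding bounded_iff by (metis (mono_tags, lifting) imageI real_norm_def)
  have "\<bar>p1 b\<bar> \<le> M/3 * b" if b: "0 < b" "b \<le> 1" for b
  proof -
    have "b\<^sup>2 * p1 b - M/3 * b^3 \<le> 0"
    proof (rule nonpos_of_deriv_nonpos[where W="\<lambda>r. r\<^sup>2 * p1 r - M/3 * r^3" and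
          W'="\<lambda>r. - (r\<^sup>2 * f (p r)) - M * r\<^sup>2"])
      show "- (r\<^sup>2 * f (p r)) - M * r\<^sup>2 \<le> 0" if "0 < r" "r < b" for r
      proof -
        have "(- M) * r\<^sup>2 \<le> f (p r) * r\<^sup>2" using M[of r] that b by (intro mult_right_mono) auto
        then show ?thesis by (simp add: mult.commute)
      qed
      show "((\<lambda>r. r\<^sup>2 * p1 r - M / 3 * r ^ 3) \<longlongrightarrow> 0) (at_right 0)"
        by (rule tendsto_eq_intros flux_at_0 refl | simp)+
      show "((\<lambda>r. r\<^sup>2 * p1 r - M / 3 * r ^ 3) has_real_derivative - (r\<^sup>2 * f (p r)) - M * r\<^sup>2) (at r)"
        if "0 < r" "r \<le> b" for r
        by (rule DERIV_diff[OF Dflux[OF that(1)]])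
           (auto intro!: derivative_eq_intros simp: power2_eq_square)
    qed (use b in auto)
    moreover have "- (b\<^sup>2 * p1 b) - M/3 * b^3 \<le> 0"
    proof (rule nonpos_of_deriv_nonpos[where W="\<lambda>r. - (r\<^sup>2 * p1 r) - M/3 * r^3" and
          W'="\<lambda>r. (r\<^sup>2 * f (p r)) - M * r\<^sup>2"])
      show "(r\<^sup>2 * f (p r)) - M * r\<^sup>2 \<le> 0" if "0 < r" "r < b" for r
      proof -
        have "f (p r) * r\<^sup>2 \<le> M * r\<^sup>2" using M[of r] that b by (intro mult_right_mono) auto
        then show ?thesis by (simp add: mult.commute)
      qed
      show "((\<lambda>r. - (r\<^sup>2 * p1 r) - M / 3 * r ^ 3) \<longlongrightarrow> 0) (at_right 0)"
        by (rule tendsto_eq_intros flux_at_0 refl | simp)+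
      show "((\<lambda>r. - (r\<^sup>2 * p1 r) - M / 3 * r ^ 3) has_real_derivative r\<^sup>2 * f (p r) - M * r\<^sup>2) (at r)"
        if "0 < r" "r \<le> b" for r
      proof -
        have "((\<lambda>r. - (r\<^sup>2 * p1 r)) has_real_derivative r\<^sup>2 * f (p r)) (at r)"
          using DERIV_minus[OF Dflux[OF that(1)]] by simp
        then show ?thesis
          by (rule DERIV_diff) (auto intro!: derivative_eq_intros simp: power2_eq_square)
      qed
    qed (use b in auto)
    ultimately have "\<bar>b\<^sup>2 * p1 b\<bar> \<le> M/3 * b^3" by linarith
    then have "b\<^sup>2 * \<bar>p1 b\<bar> \<le> b\<^sup>2 * (M/3 * b)" using b
      by (simp add: abs_mult power2_eq_square power3_eq_cube mult_ac)
    then show ?thesis using b by (simp add: mult_le_cancel_left)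
  qed
  then show ?thesis by blast
qed

lemma p1_at_0: "(p1 \<longlongrightarrow> 0) (at_right 0)"
proof -
  obtain C where C: "\<And>r. 0 < r \<Longrightarrow> r \<le> 1 \<Longrightarrow> \<bar>p1 r\<bar> \<le> C * r" using p1_linear_bound by blast
  have "((\<lambda>r. C * r) \<longlongrightarrow> 0) (at_right 0)" by (auto intro!: tendsto_eq_intros)
  then show ?thesis
    by (rule Lim_null_comparison[rotated]) (rule at_right_0_I[of 1], use C in auto)
qed

text \<open>At a zero p has a minimum, and r p solves a linear equation; so p would vanish identically.\<close>

lemma p_pos: "0 < r \<Longrightarrow> 0 < p r"
proof (rule ccontr)
  assume r: "0 < r" and n: "\<not> 0 < p r"
  then have pr: "p r = 0" using p_nonneg[of r] by simp
  have p1r: "p1 r = 0"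
  proof (rule DERIV_local_min[OF Dp[OF r]])
    show "0 < r" by fact
    show "\<forall>y. \<bar>r - y\<bar> < r \<longrightarrow> p r \<le> p y" using p_nonneg pr by auto
  qed
  have "x * p x = 0" if "0 < x" for x
  proof (rule linear_ode_unique[where y="\<lambda>r. r * p r" and y'="\<lambda>r. p r + r * p1 r" and
        c="\<lambda>r. p r ^ 4 - p r ^ 2 + \<omega>"])
    show "continuous_on {0<..} (\<lambda>r. p r ^ 4 - p r ^ 2 + \<omega>)"
      by (intro continuous_intros p_cont_pos)
  qed (use r pr p1r that Drp Drp1 in auto)
  then show False using p_nontrivial by auto
qed

text \<open>r p solves a linear equation whose potential p^4 - p^2 + omega is at least -1/4 everywhere and tends to
omega at infinity.  Square integrability gives r p \<longlonglongrightarrow> 0, hence p \<longlonglongrightarrow> 0, and excludes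
growth.\<close>

lemma p_decay: "(p \<longlongrightarrow> 0) at_top" "((\<lambda>r. r\<^sup>2 * p r) \<longlongrightarrow> 0) at_top" "((\<lambda>r. r\<^sup>2 * p1 r) \<longlongrightarrow> 0) at_top"
proof -
  let ?s = "\<lambda>r. r * p r" and ?s1 = "\<lambda>r. p r + r * p1 r" and ?c = "\<lambda>r. p r ^ 4 - p r ^ 2 + \<omega>"
  have s0: "(?s \<longlongrightarrow> 0) at_top"
  proof (rule tendsto_0_of_square_integrable[OF Drp Drp1 _ _ p_L2])
    fix r :: real assume r: "0 < r"
    then show "0 \<le> r * p r" using p_nonneg[of r] by simp
    \<comment> \<open>The minimum of q^2 - q is -1/4, at q = 1/2.\<close>
    have "0 \<le> (p r ^ 2 - 1/2)^2" by simp
    also have "\<dots> = p r ^ 4 - p r ^ 2 + 1/4" by (simp add: power2_eq_square power_numeral_reduce algebra_simps)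
    finally have "- (1/4) \<le> ?c r" using \<omega> by linarith
    from mult_right_mono[OF this, of "r * p r"] show "- (r * p r) / 4 \<le> ?c r * (r * p r)"
      using r p_nonneg[of r] by simp
  qed
  show p0: "(p \<longlongrightarrow> 0) at_top" by (rule tendsto_0_of_mult_id[OF s0])
  have "((\<lambda>r. ?c r) \<longlongrightarrow> 0^4 - 0^2 + \<omega>) at_top" by (intro tendsto_intros p0)
  then have "\<forall>\<^sub>F r in at_top. \<omega>/2 < ?c r" by (rule order_tendstoD) (use \<omega> in auto)
  then obtain R where R: "\<And>r. R \<le> r \<Longrightarrow> \<omega>/2 < ?c r" by (auto simp: eventually_at_top_linorder)
  let ?R = "max R 1"
  have "((\<lambda>r. r * ?s r) \<longlongrightarrow> 0) at_top \<and> ((\<lambda>r. r * ?s1 r) \<longlongrightarrow> 0) at_top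
       \<or> filterlim (\<lambda>r. ?s r / r) at_top at_top"
  proof (rule growth_alternative[where V="?c" and k="\<omega>/2" and R="?R"])
    fix r assume r: "?R \<le> r"
    show "(?s has_real_derivative ?s1 r) (at r)" by (rule Drp) (use r in auto)
    show "(?s1 has_real_derivative ?c r * ?s r) (at r)" by (rule Drp1) (use r in auto)
    show "\<omega>/2 \<le> ?c r" using R[of r] r by simp
    show "0 < ?s r" using p_pos[of r] r by simp
  qed (use \<omega> in simp)
  moreover have "\<not> filterlim (\<lambda>r. ?s r / r) at_top at_top"
  proof
    assume "filterlim (\<lambda>r. ?s r / r) at_top at_top"
    then have "\<forall>\<^sub>F r in at_top. 1 \<le> ?s r / r" by (auto simp: filterlim_at_top)
    moreover have "\<forall>\<^sub>F r in at_top. p r < 1" by (rule order_tendstoD[OF p0]) simp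
    moreover have "\<forall>\<^sub>F r in at_top. (0::real) < r" by (rule eventually_gt_at_top)
    ultimately have "\<forall>\<^sub>F r::real in at_top. False" by eventually_elim auto
    then show False by simp
  qed
  ultimately have A: "((\<lambda>r. r * ?s r) \<longlongrightarrow> 0) at_top" and B: "((\<lambda>r. r * ?s1 r) \<longlongrightarrow> 0) at_top" by auto
  show "((\<lambda>r. r\<^sup>2 * p r) \<longlongrightarrow> 0) at_top" using A by (simp add: power2_eq_square mult.assoc)
  have "((\<lambda>r. r * ?s1 r - ?s r) \<longlongrightarrow> 0 - 0) at_top" by (intro tendsto_diff B s0)
  then show "((\<lambda>r. r\<^sup>2 * p1 r) \<longlongrightarrow> 0) at_top" by (simp add: power2_eq_square algebra_simps)
qed

text \<open>If p were stationary at a zero of f, then r (p - p(r)) would solve a linear equation with vanishing initial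
data, so p would be constant, against its decay.\<close>

lemma p_not_constant: assumes r: "0 < r" "p1 r = 0" "f (p r) = 0" shows False
proof -
  let ?a = "p r"
  \<comment> \<open>The quotient of f(p(r)) - f(x) by x - p(r), a polynomial in x.\<close>
  let ?h = "\<lambda>x. (x^4 + x^3*?a + x^2*?a^2 + x*?a^3 + ?a^4) - (x^2 + x * ?a + ?a^2) + \<omega>"
  have h: "- f x = ?h x * (x - ?a)" for x
  proof -
    have "f ?a - f x = ?h x * (x - ?a)"
      unfolding f_def by (simp add: algebra_simps power_numeral_reduce)
    then show ?thesis using r by simp
  qed
  have "x * (p x - ?a) = 0" if "0 < x" for x
  proof (rule linear_ode_unique[where y="\<lambda>r. r * (p r - ?a)" and y'="\<lambda>r. (p r - ?a) + r * p1 r" and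
        c="\<lambda>r. ?h (p r)"])
    fix t :: real assume t: "0 < t"
    show "((\<lambda>r. r * (p r - ?a)) has_real_derivative (p t - ?a) + t * p1 t) (at t)"
      using t by (auto intro!: derivative_eq_intros Dp)
    have "((\<lambda>r. (p r - ?a) + r * p1 r) has_real_derivative t * (- f (p t))) (at t)"
      using t by (auto intro!: derivative_eq_intros Dp Dp1' simp: field_simps)
    then show "((\<lambda>r. (p r - ?a) + r * p1 r) has_real_derivative ?h (p t) * (t * (p t - ?a))) (at t)"
      unfolding h by (simp only: mult_ac)
  next
    show "continuous_on {0<..} (\<lambda>r. ?h (p r))"
      by (intro continuous_intros p_cont_pos)
  qed (use r that in auto)
  then have "\<forall>\<^sub>F x in at_top. p x = ?a"
    by (intro eventually_mono[OF eventually_gt_at_top[of "0::real"]]) auto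
  then have "(p \<longlongrightarrow> ?a) at_top" by (rule tendsto_eventually)
  then have "?a = 0" using tendsto_unique[OF _ _ p_decay(1)] by simp
  then show False using p_pos[of r] r by simp
qed

end

context soliton_ode begin

lemma g_diff: "g a - g b = (a - b) * (1 - a - b)"
  by (simp add: g_def algebra_simps power2_eq_square)

text \<open>A maximum principle.  Otherwise f would be negative at the maximum of p as well, because g decreases beyond 1/2; but there
-Laplace p \<ge> 0.  The maximum may lie at the origin, where the sign of r^2 p' is used instead
of the second derivative.\<close>

lemma g_nonneg_top:
  assumes r: "0 < r" "(p r)\<^sup>2 \<ge> 1/2"
  shows "g ((p r)\<^sup>2) \<ge> 0"
proof (rule ccontr)
  assume neg: "\<not> g ((p r)\<^sup>2) \<ge> 0"
  have "\<forall>\<^sub>F x in at_top. p x < p r"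
    by (rule order_tendstoD[OF p_decay(1)]) (use p_pos r in simp)
  then obtain R0 where R0: "\<And>x. R0 \<le> x \<Longrightarrow> p x < p r" by (auto simp: eventually_at_top_linorder)
  \<comment> \<open>Beyond R the profile is below p(r), so a maximum over [0, R] is not attained at the right end.\<close>
  define R where "R = max R0 (r + 1)"
  have R: "r < R" "p R < p r" using R0[of R] by (auto simp: R_def)
  have "\<exists>m\<in>{0..R}. \<forall>y\<in>{0..R}. p y \<le> p m"
    by (rule continuous_attains_sup) (use r R in \<open>auto intro: continuous_on_subset[OF p_cont]\<close>)
  then obtain m where m: "0 \<le> m" "m \<le> R" "\<And>y. 0 \<le> y \<Longrightarrow> y \<le> R \<Longrightarrow> p y \<le> p m" by auto
  have pm: "p r \<le> p m" using m(3)[of r] r R by auto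
  then have "m \<noteq> R" using R by auto
  then have mR: "m < R" using m by simp
  have "(p r)\<^sup>2 \<le> (p m)\<^sup>2" using pm p_pos[OF r(1)] by (intro power_mono) auto
  then have "((p m)\<^sup>2 - (p r)\<^sup>2) * (1 - (p m)\<^sup>2 - (p r)\<^sup>2) \<le> 0"
    using r by (intro mult_nonneg_nonpos) auto
  then have "g ((p m)\<^sup>2) < 0" using neg g_diff[of "(p m)\<^sup>2" "(p r)\<^sup>2"] by linarith
  then have fm: "f (p m) < 0" using pm p_pos[OF r(1)] by (simp add: f_g mult_pos_neg)
  show False
  proof (cases "m = 0")
    case False
    then have m0: "0 < m" using m by simp
    have p1m: "p1 m = 0"
    proof (rule DERIV_local_max[OF Dp[OF m0]])
      show "0 < min m (R - m)" using m0 mR by simp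
      show "\<forall>y. \<bar>m - y\<bar> < min m (R - m) \<longrightarrow> p y \<le> p m" using m(3) by auto
    qed
    then have "(p1 has_real_derivative - f (p m)) (at m)" using Dp1'[OF m0] by simp
    from DERIV_pos_inc_right[OF this] fm p1m
    obtain d where d: "d > 0" "\<And>h. 0 < h \<Longrightarrow> h < d \<Longrightarrow> 0 < p1 (m + h)" by auto
    define h where "h = min (d/2) (R - m)"
    have h: "0 < h" "h < d" "m + h \<le> R" using d mR by (auto simp: h_def)
    obtain z where "m < z" "z < m + h" "p (m+h) - p m = (m + h - m) * p1 z"
      using MVT2[of m "m+h" p p1] Dp m0 h by auto
    moreover have "p1 z > 0" using d(2)[of "z - m"] calculation h by auto
    ultimately have "p (m + h) - p m > 0" using h by simp
    then show False using m(3)[of "m+h"] h m0 by auto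
  next
    case True
    have "((\<lambda>r. f (p r)) \<longlongrightarrow> f (p 0)) (at_right 0)"
      unfolding f_def by (intro tendsto_intros p_at_0)
    then have "\<forall>\<^sub>F r in at_right 0. f (p r) < 0"
      by (rule order_tendstoD) (use fm True in simp)
    then obtain b where b: "0 < b" "\<And>r. 0 < r \<Longrightarrow> r < b \<Longrightarrow> f (p r) < 0"
      unfolding eventually_at_right_field by auto
    define b' where "b' = min b R / 2"
    have b': "0 < b'" "b' < b" "b' \<le> R" using b(1) mR True by (auto simp: b'_def)
    have p1p: "p1 t > 0" if t: "0 < t" "t \<le> b'" for t
    proof -
      have "t\<^sup>2 * p1 t > 0"
        by (rule pos_of_deriv_pos[OF t(1) Dflux _ flux_at_0])
           (use t b b' in \<open>auto simp: mult_pos_neg\<close>)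
      then show ?thesis using t by (simp add: zero_less_mult_iff)
    qed
    have "p b' - p 0 > 0"
    proof (rule pos_of_deriv_pos[where W="\<lambda>r. p r - p 0" and W'=p1])
      show "((\<lambda>r. p r - p 0) \<longlongrightarrow> 0) (at_right 0)" using tendsto_diff[OF p_at_0 tendsto_const[of "p 0"]] by simp
    qed (use b' p1p in \<open>auto intro!: derivative_eq_intros Dp\<close>)
    then show False using m(3)[of b'] b' True by auto
  qed
qed

lemma F_q: "F x = x\<^sup>2 / 2 * (x\<^sup>2 / 2 - (x\<^sup>2)\<^sup>2 / 3 - \<omega>)"
  by (simp add: F_def algebra_simps power_numeral_reduce)

lemma g_nonneg_of_F:
  assumes F: "F x \<ge> 0" and x: "0 < x" "x\<^sup>2 \<le> 3/4"
  shows "g (x\<^sup>2) \<ge> 0"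
proof -
  have "0 < x\<^sup>2" using x by simp
  then have "x\<^sup>2 / 2 - (x\<^sup>2)\<^sup>2 / 3 - \<omega> \<ge> 0" using F unfolding F_q by (simp add: zero_le_mult_iff)
  moreover have "0 \<le> x\<^sup>2 * (1/2 - 2 * x\<^sup>2 / 3)" using x by (intro mult_nonneg_nonneg) auto
  ultimately show ?thesis by (simp add: g_def power2_eq_square algebra_simps)
qed

lemma D_energy: "0 < r \<Longrightarrow> ((\<lambda>r. (p1 r)\<^sup>2 / 2 + F (p r)) has_real_derivative - (2 / r * (p1 r)\<^sup>2)) (at r)"
  by (auto intro!: derivative_eq_intros Dp1' DERIV_chain2[OF DF Dp] simp: field_simps power2_eq_square)

lemma energy_antimono:
  assumes "0 < a" "a \<le> b"
  shows "(p1 b)\<^sup>2 / 2 + F (p b) \<le> (p1 a)\<^sup>2 / 2 + F (p a)"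
proof (rule DERIV_nonpos_imp_nonincreasing[where f="\<lambda>r. (p1 r)\<^sup>2 / 2 + F (p r)", OF assms(2)])
  fix x assume "a \<le> x" "x \<le> b"
  then have "0 < x" using assms by simp
  then show "\<exists>y. ((\<lambda>r. (p1 r)\<^sup>2 / 2 + F (p r)) has_real_derivative y) (at x) \<and> y \<le> 0"
    using D_energy by (intro exI[of _ "- (2 / x * (p1 x)\<^sup>2)"]) auto
qed

lemma p1_decay: "(p1 \<longlongrightarrow> 0) at_top"
  by (rule tendsto_0_of_mult_id, rule tendsto_0_of_mult_id)
     (use p_decay(3) in \<open>simp add: power2_eq_square mult.assoc\<close>)

text \<open>The energy is nonincreasing in r and tends to 0 at infinity.\<close>

lemma energy_nonneg: "0 < r \<Longrightarrow> 0 \<le> (p1 r)\<^sup>2 / 2 + F (p r)"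
proof (rule tendsto_upperbound)
  assume r: "0 < r"
  show "((\<lambda>r. (p1 r)\<^sup>2 / 2 + F (p r)) \<longlongrightarrow> 0) at_top"
    unfolding F_def by (auto intro!: tendsto_eq_intros p1_decay p_decay)
  show "\<forall>\<^sub>F x in at_top. (p1 x)\<^sup>2 / 2 + F (p x) \<le> (p1 r)\<^sup>2 / 2 + F (p r)"
    by (rule eventually_mono[OF eventually_ge_at_top[of r]]) (use energy_antimono r in auto)
qed simp

text \<open>At a critical point the energy is F(p), and F \<ge> 0 confines q to the range where g \<ge> 0: for
q \<le> 3/4 directly, and for larger q by the maximum principle.  So every critical point away from the origin is
a strict local maximum.\<close>

lemma f_pos_at_critical:
  assumes r: "0 < r" "p1 r = 0"
  shows "f (p r) > 0"
proof -
  have "F (p r) \<ge> 0" using energy_nonneg[OF r(1)] r(2) by simp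
  then have "g ((p r)\<^sup>2) \<ge> 0"
    using g_nonneg_of_F[of "p r"] g_nonneg_top[OF r(1)] p_pos[OF r(1)] by linarith
  then have "f (p r) \<ge> 0" using p_pos[OF r(1)] by (simp add: f_g)
  moreover have "f (p r) \<noteq> 0" using p_not_constant r by blast
  ultimately show ?thesis by simp
qed

lemma p0_pos: "0 < p 0"
proof (rule ccontr)
  assume "\<not> 0 < p 0"
  moreover have "0 \<le> p 0"
    by (rule tendsto_lowerbound[OF p_at_0]) (auto intro: at_right_0_I[of 1] p_nonneg)
  ultimately have z: "p 0 = 0" by simp
  have p0: "(p \<longlongrightarrow> 0) (at_right 0)" using p_at_0 z by simp
  have "1 * p 1 = 0"
  proof (rule linear_ode_unique_at_0[where y="\<lambda>r. r * p r" and y'="\<lambda>r. p r + r * p1 r" and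
        c="\<lambda>r. p r ^ 4 - p r ^ 2 + \<omega>"])
    show "continuous_on {0..} (\<lambda>r. p r ^ 4 - p r ^ 2 + \<omega>)"
      by (intro continuous_intros p_cont)
    show "((\<lambda>r. r * p r) \<longlongrightarrow> 0) (at_right 0)" "((\<lambda>r. p r + r * p1 r) \<longlongrightarrow> 0) (at_right 0)"
      by (auto intro!: tendsto_eq_intros p0 p1_at_0)
  qed (use Drp Drp1 in auto)
  then show False using p_pos[of 1] by simp
qed

text \<open>p' > 0 just before r.  The last earlier point with p' \<le> 0 would be a critical point from which p
increases, so not a local maximum.\<close>

lemma p1_pos_before_critical:
  assumes r: "0 < r" "p1 r = 0" and x: "0 < x" "x < r"
  shows "p1 x > 0"
proof (rule ccontr)
  assume neg: "\<not> p1 x > 0"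
  have down: "(p1 has_real_derivative - f (p t)) (at t)" "- f (p t) < 0" if "0 < t" "p1 t = 0" for t
    using Dp1'[OF that(1)] f_pos_at_critical[OF that] that by auto
  obtain d where d: "d > 0" "\<And>h. 0 < h \<Longrightarrow> h < d \<Longrightarrow> 0 < p1 (r - h)"
    using DERIV_neg_dec_left[OF down[OF r]] r by auto
  define h where "h = min (d/2) ((r - x)/2)"
  have h: "0 < h" "h < d" "x < r - h" using d x by (auto simp: h_def min_def field_simps)
  define y where "y = r - h"
  have y: "x < y" "p1 y > 0" using h d by (auto simp: y_def)
  have cont: "continuous_on {x..y} p1"
    by (rule DERIV_at_imp_continuous_on, rule Dp1') (use x in auto)
  obtain z where zx: "x \<le> z" "z < y" and pz: "p1 z = 0" and after: "\<And>t. z < t \<Longrightarrow> t \<le> y \<Longrightarrow> 0 < p1 t"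
    by (rule last_nonpos[OF cont y(1) _ y(2)]) (use neg in auto)
  obtain e where e: "e > 0" "\<And>h. 0 < h \<Longrightarrow> h < e \<Longrightarrow> 0 > p1 (z + h)"
    using DERIV_neg_dec_right[OF down[of z]] zx x pz by auto
  define k where "k = min (e/2) (y - z)"
  have "0 < k" "k < e" "z + k \<le> y" using e zx by (auto simp: k_def)
  then show False using e(2)[of k] after[of "z + k"] by auto
qed

text \<open>Before a critical point p would increase from p(0).  As the energy at the origin is
nonnegative, g \<ge> 0 at both ends of the range of q, and in between by concavity.  Then r^2 p' decreases from 0,
which contradicts p' > 0.\<close>

lemma p1_nonzero: assumes r: "0 < r" shows "p1 r \<noteq> 0"
proof
  assume z: "p1 r = 0"
  note pos = p1_pos_before_critical[OF r z]
  have mono: "p a \<le> p b" if "0 < a" "a \<le> b" "b \<le> r" for a b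
  proof (rule DERIV_nonneg_imp_nondecreasing[OF that(2)])
    fix x assume "a \<le> x" "x \<le> b"
    then have "0 < x" "p1 x \<ge> 0" using that pos[of x] z by (cases "x = r"; auto)+
    then show "\<exists>y. (p has_real_derivative y) (at x) \<and> 0 \<le> y" using Dp by blast
  qed
  have p0: "p 0 \<le> p b" if "0 < b" "b \<le> r" for b
    by (rule tendsto_upperbound[OF p_at_0])
       (rule at_right_0_I[of b], use that mono in auto)
  have gr: "g ((p r)\<^sup>2) > 0" using f_pos_at_critical[OF r z] p_pos[OF r] by (simp add: f_g zero_less_mult_iff)
  have "F (p 0) \<ge> 0"
  proof (rule tendsto_lowerbound)
    show "((\<lambda>r. (p1 r)\<^sup>2 / 2 + F (p r)) \<longlongrightarrow> F (p 0)) (at_right 0)"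
      unfolding F_def by (auto intro!: tendsto_eq_intros p1_at_0 p_at_0)
    show "\<forall>\<^sub>F x in at_right 0. 0 \<le> (p1 x)\<^sup>2 / 2 + F (p x)"
      by (rule at_right_0_I[of 1]) (use energy_nonneg in auto)
  qed simp
  then have g0: "g ((p 0)\<^sup>2) \<ge> 0"
  proof (cases "(p 0)\<^sup>2 \<le> 3/4")
    case True then show ?thesis using g_nonneg_of_F \<open>F (p 0) \<ge> 0\<close> p0_pos by blast
  next
    case False
    show ?thesis
    proof (rule tendsto_lowerbound)
      show "((\<lambda>r. g ((p r)\<^sup>2)) \<longlongrightarrow> g ((p 0)\<^sup>2)) (at_right 0)"
        unfolding g_def by (intro tendsto_intros p_at_0)
      have "((\<lambda>r. (p r)\<^sup>2) \<longlongrightarrow> (p 0)\<^sup>2) (at_right 0)" by (intro tendsto_intros p_at_0)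
      then have "\<forall>\<^sub>F x in at_right 0. 1/2 < (p x)\<^sup>2" by (rule order_tendstoD) (use False in simp)
      moreover have "\<forall>\<^sub>F x::real in at_right 0. 0 < x" by (rule at_right_0_I[of 1]) auto
      ultimately show "\<forall>\<^sub>F x in at_right 0. 0 \<le> g ((p x)\<^sup>2)"
        by eventually_elim (use g_nonneg_top in auto)
    qed simp
  qed
  have gnn: "g ((p x)\<^sup>2) \<ge> 0" if x: "0 < x" "x \<le> r" for x
  proof -
    let ?a = "(p 0)\<^sup>2" and ?b = "(p r)\<^sup>2" and ?q = "(p x)\<^sup>2"
    have q: "?a \<le> ?q" "?q \<le> ?b"
      using p0[OF x] mono[OF x(1,2)] p0_pos p_pos[OF x(1)] by (auto intro!: power_mono)
    have "(?b - ?a) * g ?q = (?q - ?a) * g ?b + (?b - ?q) * g ?a + (?q - ?a) * (?b - ?q) * (?b - ?a)"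
      unfolding g_def by (simp add: algebra_simps power_numeral_reduce)
    also have "\<dots> \<ge> 0" using q g0 gr by (intro add_nonneg_nonneg mult_nonneg_nonneg) auto
    finally show ?thesis using q g0 gr by (cases "?a = ?b") (auto simp: zero_le_mult_iff)
  qed
  have "(r/2)\<^sup>2 * p1 (r/2) \<le> 0"
    by (rule nonpos_of_deriv_nonpos[OF _ Dflux _ flux_at_0])
       (use r gnn p_pos in \<open>auto simp: f_g intro!: mult_nonneg_nonneg less_imp_le[OF p_pos]\<close>)
  then show False using pos[of "r/2"] r by (auto simp: mult_le_0_iff)
qed

lemma p1_neg: assumes r: "0 < r" shows "p1 r < 0"
proof (rule ccontr)
  assume "\<not> p1 r < 0"
  then have pos: "p1 r > 0" using p1_nonzero[OF r] by simp
  have "\<forall>\<^sub>F x in at_top. p x < p r"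
    by (rule order_tendstoD[OF p_decay(1)]) (use p_pos r in simp)
  then obtain R0 where R0: "\<And>x. R0 \<le> x \<Longrightarrow> p x < p r" by (auto simp: eventually_at_top_linorder)
  define R where "R = max R0 (r + 1)"
  have R: "r < R" "p R < p r" using R0[of R] by (auto simp: R_def)
  obtain z where z: "r < z" "z < R" "p R - p r = (R - r) * p1 z"
    using MVT2[of r R p p1] Dp r R by auto
  have "p1 z < 0"
  proof (rule ccontr)
    assume "\<not> p1 z < 0"
    then have "0 \<le> (R - r) * p1 z" using R by (intro mult_nonneg_nonneg) auto
    then show False using z R by simp
  qed
  moreover have "continuous_on {r..z} p1"
    by (rule DERIV_at_imp_continuous_on, rule Dp1') (use r in auto)
  ultimately obtain t where "r \<le> t" "t \<le> z" "p1 t = 0"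
    using IVT2'[of p1 z 0 r] pos z by auto
  then show False using p1_nonzero[of t] r by auto
qed

lemma p_strict_antimono: assumes "0 < a" "a < b" shows "p b < p a"
proof (rule DERIV_neg_imp_decreasing[OF assms(2)])
  fix x assume "a \<le> x" "x \<le> b"
  then have "0 < x" using assms by simp
  then show "\<exists>y. (p has_real_derivative y) (at x) \<and> y < 0" using Dp p1_neg by blast
qed

lemma q_strict_antimono: "0 < a \<Longrightarrow> a < b \<Longrightarrow> (p b)\<^sup>2 < (p a)\<^sup>2"
  using p_strict_antimono[of a b] p_pos[of b] by (intro power_strict_mono) auto

lemma f_pos_top: assumes r: "0 < r" "(p r)\<^sup>2 \<ge> 1/2" shows "f (p r) > 0"
proof -
  have q: "(p r)\<^sup>2 < (p (r/2))\<^sup>2" using q_strict_antimono[of "r/2" r] r by simp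
  then have "0 < ((p r)\<^sup>2 - (p (r/2))\<^sup>2) * (1 - (p r)\<^sup>2 - (p (r/2))\<^sup>2)"
    using r by (intro mult_neg_neg) auto
  moreover have "g ((p (r/2))\<^sup>2) \<ge> 0" using g_nonneg_top[of "r/2"] r q by auto
  ultimately have "g ((p r)\<^sup>2) > 0" using g_diff[of "(p r)\<^sup>2" "(p (r/2))\<^sup>2"] by linarith
  then show ?thesis using p_pos[OF r(1)] by (simp add: f_g)
qed

end

section \<open>A monotone quantity from the Pohozaev identity\<close>

context soliton_ode begin

text \<open>The boundary term of the Pohozaev identity, obtained by testing the equation with
r p' and p on a ball.\<close>

definition pohozaev :: "real \<Rightarrow> real" where
  "pohozaev r = r^3 * ((p1 r)\<^sup>2 + 2 * F (p r)) + r\<^sup>2 * p r * p1 r"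

lemma D_pohozaev: assumes r: "0 < r"
  shows "(pohozaev has_real_derivative r\<^sup>2 * ((p r)\<^sup>2 * ((p r)\<^sup>2 / 2 - 2 * \<omega>))) (at r)"
  unfolding pohozaev_def[abs_def]
  apply (rule derivative_eq_intros refl Dp[OF r] Dp1'[OF r] DERIV_chain2[OF DF Dp[OF r]])+
  using r unfolding F_def f_def by (simp add: field_simps power_numeral_reduce)

lemma pohozaev_at_0: "(pohozaev \<longlongrightarrow> 0) (at_right 0)"
  unfolding pohozaev_def[abs_def] F_def by (rule tendsto_eq_intros p1_at_0 p_at_0 refl | simp)+

lemma pohozaev_at_top: "(pohozaev \<longlongrightarrow> 0) at_top"
proof -
  let ?a = "\<lambda>r. r\<^sup>2 * p1 r" and ?b = "\<lambda>r. r\<^sup>2 * p r"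
  have i: "((\<lambda>r::real. 1/r) \<longlongrightarrow> 0) at_top" "((\<lambda>r::real. 1/r\<^sup>2) \<longlongrightarrow> 0) at_top" by real_asymp+
  have "((\<lambda>r. (?a r)\<^sup>2 * (1/r) + 2 * ((?b r)\<^sup>2 * (1/r) * ((p r)^2/4 - (p r)^4/6 - \<omega>/2)) + ?a r * ?b r * (1/r\<^sup>2))
      \<longlongrightarrow> 0\<^sup>2 * 0 + 2 * (0\<^sup>2 * 0 * (0^2/4 - 0^4/6 - \<omega>/2)) + 0 * 0 * 0) at_top"
    by (intro tendsto_intros p_decay i) auto
  moreover have "\<forall>\<^sub>F r in at_top. (?a r)\<^sup>2 * (1/r) + 2 * ((?b r)\<^sup>2 * (1/r) * ((p r)^2/4 - (p r)^4/6 - \<omega>/2)) + ?a r * ?b r * (1/r\<^sup>2) = pohozaev r"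
    by (rule eventually_mono[OF eventually_gt_at_top[of "0::real"]])
       (simp add: pohozaev_def F_def field_simps power_numeral_reduce)
  ultimately show ?thesis using Lim_transform_eventually by fastforce
qed

text \<open>As q is decreasing, the derivative changes sign at most once, from plus to minus; so the
quantity is positive wherever it is still rising from its value 0 at the origin, and
wherever it is already falling to its limit 0 at infinity.\<close>

lemma pohozaev_pos: assumes r: "0 < r" shows "pohozaev r > 0"
proof (cases "(p r)\<^sup>2 \<ge> 4 * \<omega>")
  case True
  show ?thesis
  proof (rule pos_of_deriv_pos[OF r D_pohozaev _ pohozaev_at_0])
    fix x assume x: "0 < x" "x < r"
    then have "(p x)\<^sup>2 / 2 - 2 * \<omega> > 0" using q_strict_antimono[of x r] True by simp
    then show "x\<^sup>2 * ((p x)\<^sup>2 * ((p x)\<^sup>2 / 2 - 2 * \<omega>)) > 0"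
      using x p_pos[of x] by (intro mult_pos_pos) auto
  qed auto
next
  case False
  have dec: "pohozaev b < pohozaev a" if "r \<le> a" "a < b" for a b
  proof (rule DERIV_neg_imp_decreasing[OF that(2)])
    fix x assume "a \<le> x" "x \<le> b"
    then have x: "0 < x" "r \<le> x" using that r by auto
    have "(p x)\<^sup>2 \<le> (p r)\<^sup>2" using q_strict_antimono[of r x] r x by (cases "r = x") auto
    then have "(p x)\<^sup>2 / 2 - 2 * \<omega> < 0" using False by simp
    then have "x\<^sup>2 * ((p x)\<^sup>2 * ((p x)\<^sup>2 / 2 - 2 * \<omega>)) < 0"
      using x p_pos[of x] by (intro mult_pos_neg) auto
    then show "\<exists>y. (pohozaev has_real_derivative y) (at x) \<and> y < 0" using D_pohozaev[OF x(1)] by blast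
  qed
  have "0 \<le> pohozaev (r + 1)"
  proof (rule tendsto_upperbound[OF pohozaev_at_top])
    show "\<forall>\<^sub>F x in at_top. pohozaev x \<le> pohozaev (r + 1)"
      by (rule eventually_mono[OF eventually_gt_at_top[of "r+1"]]) (use dec in \<open>auto intro: less_imp_le\<close>)
  qed simp
  then show ?thesis using dec[of r "r+1"] by simp
qed

lemma f_minus_pf1: "f x - x * f1 x = 2 * x^3 * (2 * x\<^sup>2 - 1)"
  by (simp add: f_def f1_def algebra_simps power_numeral_reduce)

text \<open>This is r^2 p^2 \<theta>' for the logarithmic derivative \<theta> = - r p' / p, multiplied out so that
it makes sense at the origin.\<close>

definition \<theta>_flux :: "real \<Rightarrow> real" where
  "\<theta>_flux r = r^3 * (p1 r)\<^sup>2 + r\<^sup>2 * p r * p1 r + r^3 * p r * f (p r)"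

lemma D_\<theta>_flux: assumes r: "0 < r"
  shows "(\<theta>_flux has_real_derivative 2 * r\<^sup>2 * p r * f (p r) - r^3 * p1 r * (f (p r) - p r * f1 (p r))) (at r)"
  unfolding \<theta>_flux_def[abs_def]
  apply (rule derivative_eq_intros refl Dp[OF r] Dp1'[OF r] DERIV_chain2[OF Df Dp[OF r]])+
  using r by (simp add: field_simps power_numeral_reduce)

text \<open>For q \<ge> 1/2 both terms of the derivative are positive.  For q < 1/2 the difference from the
Pohozaev quantity is r^3 (p f(p) - 2 F(p)) = r^3 p^4 (1/2 - 2 q / 3) \<ge> 0.\<close>

lemma \<theta>_flux_pos: assumes r: "0 < r" shows "\<theta>_flux r > 0"
proof (cases "(p r)\<^sup>2 \<ge> 1/2")
  case True
  show ?thesis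
  proof (rule pos_of_deriv_pos[OF r D_\<theta>_flux])
    fix x assume x: "0 < x" "x < r"
    then have q: "(p x)\<^sup>2 > 1/2" using q_strict_antimono[of x r] True by simp
    have "2 * x\<^sup>2 * p x * f (p x) > 0"
      using x p_pos[of x] f_pos_top[of x] q by (intro mult_pos_pos) auto
    moreover have "f (p x) - p x * f1 (p x) > 0"
      unfolding f_minus_pf1 using q p_pos[of x] x by (intro mult_pos_pos) auto
    then have "x^3 * p1 x * (f (p x) - p x * f1 (p x)) < 0"
      using p1_neg[of x] x by (intro mult_neg_pos mult_pos_neg) auto
    ultimately show "2 * x\<^sup>2 * p x * f (p x) - x^3 * p1 x * (f (p x) - p x * f1 (p x)) > 0" by linarith
  next
    show "(\<theta>_flux \<longlongrightarrow> 0) (at_right 0)"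
      unfolding \<theta>_flux_def[abs_def] f_def by (rule tendsto_eq_intros p1_at_0 p_at_0 refl | simp)+
  qed auto
next
  case False
  have "\<theta>_flux r = pohozaev r + r^3 * ((p r)^4 * (1/2 - 2 * (p r)\<^sup>2 / 3))"
    by (simp add: \<theta>_flux_def pohozaev_def F_def f_def field_simps power_numeral_reduce)
  moreover have "r^3 * ((p r)^4 * (1/2 - 2 * (p r)\<^sup>2 / 3)) \<ge> 0"
    using False r by (intro mult_nonneg_nonneg) auto
  ultimately show ?thesis using pohozaev_pos[OF r] by linarith
qed

definition \<theta> :: "real \<Rightarrow> real" where "\<theta> r = - (r * p1 r / p r)"

lemma \<theta>_strict_mono: assumes "0 < a" "a < b" shows "\<theta> a < \<theta> b"
proof (rule DERIV_pos_imp_increasing[OF assms(2)])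
  fix x assume "a \<le> x" "x \<le> b"
  then have x: "0 < x" using assms by simp
  have px: "p x > 0" by (rule p_pos[OF x])
  have "(\<theta> has_real_derivative \<theta>_flux x / (x\<^sup>2 * (p x)\<^sup>2)) (at x)"
  proof -
    have "((\<lambda>r. r * p1 r) has_real_derivative - p1 x - x * f (p x)) (at x)"
      using x by (auto intro!: derivative_eq_intros Dp1' simp: field_simps)
    from DERIV_minus[OF DERIV_divide[OF this Dp[OF x] less_imp_neq[OF px, symmetric]]] show ?thesis
      unfolding \<theta>_def[abs_def] \<theta>_flux_def
      by (rule DERIV_cong) (use px x in \<open>simp_all add: field_simps power_numeral_reduce\<close>)
  qed
  moreover have "\<theta>_flux x / (x\<^sup>2 * (p x)\<^sup>2) > 0" using \<theta>_flux_pos[OF x] px x by (intro divide_pos_pos mult_pos_pos) auto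
  ultimately show "\<exists>y. (\<theta> has_real_derivative y) (at x) \<and> y > 0" by blast
qed

end

section \<open>The linearized equation: one sign change, then divergence\<close>

text \<open>The linearized equation for \<sigma> = r \<delta>, whose initial slope is \<delta>(0) = 1.\<close>

locale linearized_ode = soliton_ode +
  fixes \<sigma> \<sigma>1 :: "real \<Rightarrow> real"
  assumes D\<sigma>: "\<And>r. 0 < r \<Longrightarrow> (\<sigma> has_real_derivative \<sigma>1 r) (at r)"
    and D\<sigma>1: "\<And>r. 0 < r \<Longrightarrow> (\<sigma>1 has_real_derivative (5 * p r ^ 4 - 3 * p r ^ 2 + \<omega>) * \<sigma> r) (at r)"
    and \<sigma>_at_0: "(\<sigma> \<longlongrightarrow> 0) (at_right 0)"
    and \<sigma>1_at_0: "(\<sigma>1 \<longlongrightarrow> 1) (at_right 0)"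
begin

lemma D\<sigma>1': "0 < r \<Longrightarrow> (\<sigma>1 has_real_derivative - f1 (p r) * \<sigma> r) (at r)"
  using D\<sigma>1 by (simp add: f1_def algebra_simps)

lemma \<sigma>_cont: "0 < a \<Longrightarrow> continuous_on {a..b} \<sigma>"
  by (rule DERIV_at_imp_continuous_on, rule D\<sigma>) auto

text \<open>For \<tau> = r v the term h is r L v, and the Wronskian of \<sigma> and \<tau> is r^2 (\<delta> v' - \<delta>' v).\<close>

lemma wronskian_deriv:
  assumes "0 < r" "(\<tau> has_real_derivative \<tau>' r) (at r)"
    and "(\<tau>' has_real_derivative - f1 (p r) * \<tau> r - h) (at r)"
  shows "((\<lambda>r. \<sigma> r * \<tau>' r - \<sigma>1 r * \<tau> r) has_real_derivative - (\<sigma> r * h)) (at r)"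
  by (rule derivative_eq_intros D\<sigma> D\<sigma>1' assms refl | simp add: algebra_simps)+

text \<open>The comparison function v = p' is the radial part of a translation mode: L p' = -(2 / r^2) p'.\<close>

lemma wronskian_translation:
  assumes "0 < r"
  shows "((\<lambda>r. \<sigma> r * (- p1 r - r * f (p r)) - \<sigma>1 r * (r * p1 r)) has_real_derivative 2 * \<sigma> r * p1 r / r) (at r)"
proof -
  have "((\<lambda>r. r * p1 r) has_real_derivative - p1 r - r * f (p r)) (at r)"
    using assms by (auto intro!: derivative_eq_intros Dp1' simp: field_simps)
  moreover have "((\<lambda>r. - p1 r - r * f (p r)) has_real_derivative - f1 (p r) * (r * p1 r) - (- 2 * p1 r / r)) (at r)"
    using assms by (auto intro!: derivative_eq_intros Dp1' DERIV_chain2[OF Df Dp] simp: field_simps)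
  ultimately show ?thesis
    using wronskian_deriv[OF assms, of "\<lambda>r. r * p1 r" "\<lambda>r. - p1 r - r * f (p r)" "- 2 * p1 r / r"]
    by (simp add: field_simps)
qed

text \<open>The comparison function v = r p' + c p.  Here r p' generates dilations, whence L (r p') = 2 f(p).\<close>

lemma wronskian_scaling:
  fixes c :: real
  assumes "0 < r"
  shows "((\<lambda>r. \<sigma> r * (- r\<^sup>2 * f (p r) + c * (p r + r * p1 r)) - \<sigma>1 r * (r\<^sup>2 * p1 r + c * (r * p r)))
     has_real_derivative - (\<sigma> r * (r * (2 * f (p r) + c * (f (p r) - p r * f1 (p r)))))) (at r)"
proof (rule wronskian_deriv[OF assms])
  show "((\<lambda>r. r\<^sup>2 * p1 r + c * (r * p r)) has_real_derivative - r\<^sup>2 * f (p r) + c * (p r + r * p1 r)) (at r)"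
    using assms by (auto intro!: derivative_eq_intros Dp Dp1' simp: field_simps power2_eq_square)
  show "((\<lambda>r. - r\<^sup>2 * f (p r) + c * (p r + r * p1 r)) has_real_derivative
    - f1 (p r) * (r\<^sup>2 * p1 r + c * (r * p r)) - r * (2 * f (p r) + c * (f (p r) - p r * f1 (p r)))) (at r)"
    using assms by (auto intro!: derivative_eq_intros Dp Dp1' DERIV_chain2[OF Df Dp] simp: field_simps power2_eq_square)
qed

lemma \<sigma>_pos_near_0: "\<exists>b>0. \<forall>r. 0 < r \<and> r < b \<longrightarrow> \<sigma> r > 0"
proof -
  have "\<forall>\<^sub>F r in at_right 0. \<sigma>1 r > 0" by (rule order_tendstoD[OF \<sigma>1_at_0]) simp
  then obtain b where b: "0 < b" "\<And>r. 0 < r \<Longrightarrow> r < b \<Longrightarrow> \<sigma>1 r > 0"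
    unfolding eventually_at_right_field by auto
  have "\<sigma> r > 0" if "0 < r" "r < b" for r
    by (rule pos_of_deriv_pos[OF that(1) D\<sigma> _ \<sigma>_at_0]) (use that b in auto)
  then show ?thesis using b(1) by blast
qed

lemma wronskian_translation_at_0: "((\<lambda>r. \<sigma> r * (- p1 r - r * f (p r)) - \<sigma>1 r * (r * p1 r)) \<longlongrightarrow> 0) (at_right 0)"
  unfolding f_def by (rule tendsto_eq_intros p1_at_0 p_at_0 \<sigma>_at_0 \<sigma>1_at_0 refl | simp)+

lemma wronskian_scaling_at_0: "((\<lambda>r. \<sigma> r * (- r\<^sup>2 * f (p r) + c * (p r + r * p1 r)) - \<sigma>1 r * (r\<^sup>2 * p1 r + c * (r * p r))) \<longlongrightarrow> 0) (at_right 0)"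
  unfolding f_def by (rule tendsto_eq_intros p1_at_0 p_at_0 \<sigma>_at_0 \<sigma>1_at_0 refl | simp)+

lemma wronskian_translation_neg:
  assumes "0 < b" "\<And>r. 0 < r \<Longrightarrow> r < b \<Longrightarrow> \<sigma> r > 0"
  shows "\<sigma> b * (- p1 b - b * f (p b)) - \<sigma>1 b * (b * p1 b) < 0"
  by (rule neg_of_deriv_neg[OF assms(1) wronskian_translation _ wronskian_translation_at_0])
     (use assms p1_neg in \<open>auto intro!: divide_neg_pos mult_pos_neg\<close>)

lemma profile_decay: "((\<lambda>r. r * p r) \<longlongrightarrow> 0) at_top" "((\<lambda>r. r * p1 r) \<longlongrightarrow> 0) at_top"
    "((\<lambda>r. r\<^sup>2 * f (p r)) \<longlongrightarrow> 0) at_top" "((\<lambda>r. r * f (p r)) \<longlongrightarrow> 0) at_top"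
proof -
  note sq = power2_eq_square mult.assoc
  show "((\<lambda>r. r * p r) \<longlongrightarrow> 0) at_top" "((\<lambda>r. r * p1 r) \<longlongrightarrow> 0) at_top"
    by (rule tendsto_0_of_mult_id, use p_decay(2,3) in \<open>simp add: sq\<close>)+
  have "((\<lambda>r. r\<^sup>2 * p r * g ((p r)\<^sup>2)) \<longlongrightarrow> 0 * g (0\<^sup>2)) at_top"
    unfolding g_def by (intro tendsto_intros p_decay)
  then show *: "((\<lambda>r. r\<^sup>2 * f (p r)) \<longlongrightarrow> 0) at_top" by (simp add: f_g mult.assoc)
  show "((\<lambda>r. r * f (p r)) \<longlongrightarrow> 0) at_top"
    by (rule tendsto_0_of_mult_id) (use * in \<open>simp add: sq\<close>)
qed

lemma potential_eventually_positive: "\<exists>R>0. \<forall>r\<ge>R. \<omega>/2 \<le> - f1 (p r)"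
proof -
  have "((\<lambda>r. - f1 (p r)) \<longlongrightarrow> - f1 0) at_top" unfolding f1_def by (intro tendsto_intros p_decay)
  then have "\<forall>\<^sub>F r in at_top. \<omega>/2 < - f1 (p r)" by (rule order_tendstoD) (use \<omega> in \<open>simp add: f1_def\<close>)
  then obtain R where R: "\<And>r. R \<le> r \<Longrightarrow> \<omega>/2 < - f1 (p r)" by (auto simp: eventually_at_top_linorder)
  then show ?thesis by (intro exI[of _ "max R 1"]) (auto intro: less_imp_le)
qed

text \<open>If \<delta> > 0 throughout, its Wronskian W with p' decreases from 0 and so stays away from 0.  If \<delta>
decays, W tends to 0; otherwise \<delta> tends to infinity, while W < 0 makes p' / \<delta> decreasing, so that \<delta> is bounded by a multiple
of the decaying function - p'.\<close>

lemma \<sigma>_vanishes: "\<exists>r>0. \<sigma> r \<le> 0"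
proof (rule ccontr)
  assume "\<not> (\<exists>r>0. \<sigma> r \<le> 0)"
  then have pos: "\<sigma> r > 0" if "0 < r" for r using that by force
  let ?W = "\<lambda>r. \<sigma> r * (- p1 r - r * f (p r)) - \<sigma>1 r * (r * p1 r)"
  have W1: "?W 1 < 0" by (rule wronskian_translation_neg) (use pos in auto)
  have Wdec: "?W b \<le> ?W a" if "0 < a" "a \<le> b" for a b
  proof (rule DERIV_nonpos_imp_nonincreasing[where f="?W", OF that(2)])
    fix x assume "a \<le> x" "x \<le> b"
    then have x: "0 < x" using that by simp
    have "2 * \<sigma> x * p1 x / x \<le> 0"
      using pos[OF x] p1_neg[OF x] x by (intro divide_nonpos_pos mult_nonneg_nonpos) auto
    then show "\<exists>y. (?W has_real_derivative y) (at x) \<and> y \<le> 0" using wronskian_translation[OF x] by blast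
  qed
  obtain R where R: "R > 0" "\<And>r. r \<ge> R \<Longrightarrow> \<omega>/2 \<le> - f1 (p r)" using potential_eventually_positive by blast
  have "((\<lambda>r. r * \<sigma> r) \<longlongrightarrow> 0) at_top \<and> ((\<lambda>r. r * \<sigma>1 r) \<longlongrightarrow> 0) at_top
       \<or> filterlim (\<lambda>r. \<sigma> r / r) at_top at_top"
    by (rule growth_alternative[where V="\<lambda>r. - f1 (p r)" and k="\<omega>/2" and R=R])
       (use R \<omega> pos D\<sigma> D\<sigma>1' in auto)
  then show False
  proof
    assume "((\<lambda>r. r * \<sigma> r) \<longlongrightarrow> 0) at_top \<and> ((\<lambda>r. r * \<sigma>1 r) \<longlongrightarrow> 0) at_top"
    then have "(\<sigma> \<longlongrightarrow> 0) at_top" "(\<sigma>1 \<longlongrightarrow> 0) at_top" using tendsto_0_of_mult_id by auto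
    then have "(?W \<longlongrightarrow> 0 * (- 0 - 0) - 0 * 0) at_top"
      by (intro tendsto_intros profile_decay p1_decay)
    then have "0 \<le> ?W 1"
      by (intro tendsto_upperbound[of ?W 0 at_top] eventually_mono[OF eventually_ge_at_top[of 1]] Wdec)
         simp_all
    then show False using W1 by simp
  next
    assume inf: "filterlim (\<lambda>r. \<sigma> r / r) at_top at_top"
    \<comment> \<open>W < 0 says that the quotient p' / \<delta> decreases; numerator and denominator carry a factor r here\<close>
    let ?Q = "\<lambda>r. r * p1 r / \<sigma> r"
    have Q: "?Q r \<le> ?Q 1" if r: "1 \<le> r" for r
    proof (rule DERIV_nonpos_imp_nonincreasing[where f="?Q", OF r])
      fix x :: real assume "1 \<le> x" "x \<le> r"
      then have x: "0 < x" "1 \<le> x" by auto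
      have "(?Q has_real_derivative ?W x / (\<sigma> x)\<^sup>2) (at x)"
        using x pos[OF x(1)]
        by (auto intro!: derivative_eq_intros Dp1' D\<sigma> simp: field_simps power2_eq_square)
      moreover have "?W x \<le> 0" using Wdec[of 1 x] W1 x by simp
      ultimately show "\<exists>y. (?Q has_real_derivative y) (at x) \<and> y \<le> 0"
        by (intro exI[of _ "?W x / (\<sigma> x)\<^sup>2"]) (auto intro: divide_nonpos_nonneg)
    qed
    have Q1: "?Q 1 < 0" using pos[of 1] p1_neg[of 1] by (simp add: divide_neg_pos)
    have le: "- ?Q 1 * (\<sigma> r / r) \<le> - p1 r" if r: "1 \<le> r" for r
    proof -
      have "r * p1 r \<le> ?Q 1 * \<sigma> r" using Q[OF r] pos[of r] r by (simp only: pos_divide_le_eq)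
      then have "(r * p1 r) / r \<le> ?Q 1 * \<sigma> r / r" using r by (intro divide_right_mono) auto
      then show ?thesis using r by simp
    qed
    have "filterlim (\<lambda>r. - ?Q 1 * (\<sigma> r / r)) at_top at_top"
      by (rule filterlim_tendsto_pos_mult_at_top[OF tendsto_const _ inf]) (use Q1 in simp)
    then have "filterlim (\<lambda>r. - p1 r) at_top at_top"
      by (rule filterlim_at_top_mono) (rule eventually_mono[OF eventually_ge_at_top[of 1]], rule le)
    then have "\<forall>\<^sub>F r in at_top. 1 \<le> - p1 r" unfolding filterlim_at_top by blast
    moreover have "\<forall>\<^sub>F r in at_top. - 1 < p1 r" by (rule order_tendstoD[OF p1_decay]) simp
    ultimately have "\<forall>\<^sub>F r::real in at_top. False" by eventually_elim auto
    then show False by simp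
  qed
qed

lemma first_zero:
  obtains r0 where "0 < r0" "\<sigma> r0 = 0" "\<And>r. 0 < r \<Longrightarrow> r < r0 \<Longrightarrow> \<sigma> r > 0"
proof -
  obtain b where b: "0 < b" "\<And>r. 0 < r \<Longrightarrow> r < b \<Longrightarrow> \<sigma> r > 0" using \<sigma>_pos_near_0 by blast
  obtain c where c: "0 < c" "\<sigma> c \<le> 0" using \<sigma>_vanishes by blast
  have bc: "b \<le> c" using b c by force
  obtain z where z: "b/2 < z" "\<sigma> z = 0" "\<And>t. b/2 \<le> t \<Longrightarrow> t < z \<Longrightarrow> 0 < \<sigma> t"
    by (rule first_nonpos[of "b/2" c \<sigma>]) (use b c bc in \<open>auto intro: \<sigma>_cont\<close>)
  have "0 < \<sigma> r" if "0 < r" "r < z" for r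
    using z(3)[of r] b(2)[of r] that b(1) by (cases "r < b/2") auto
  then show ?thesis using that[of z] z b(1) by auto
qed

text \<open>The comparison argument described at the beginning: the location of the first zero fixes the
constant c, and the comparison with r p' + c p excludes both a second zero and decay.\<close>

lemma \<sigma>_over_r_at_bot: "filterlim (\<lambda>r. \<sigma> r / r) at_bot at_top"
proof -
  obtain r0 where r0: "0 < r0" "\<sigma> r0 = 0" and before: "\<And>r. 0 < r \<Longrightarrow> r < r0 \<Longrightarrow> \<sigma> r > 0"
    using first_zero by metis
  have \<sigma>1_r0: "\<sigma>1 r0 < 0"
  proof -
    have "0 < \<sigma>1 r0 * (r0 * p1 r0)" using wronskian_translation_neg[OF r0(1) before] r0(2) by simp
    then show ?thesis using r0 p1_neg[OF r0(1)] by (simp add: zero_less_mult_iff)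
  qed
  define q0 where "q0 = (p r0)\<^sup>2"
  have q0: "0 < q0" using p_pos[OF r0(1)] by (simp add: q0_def)
  have q0_half: "q0 < 1/2"
  proof (rule ccontr)
    assume "\<not> q0 < 1/2"
    then have h: "q0 \<ge> 1/2" by simp
    \<comment> \<open>the Wronskian with p is the part of the scaling Wronskian that is linear in c\<close>
    let ?W = "\<lambda>r. \<sigma> r * (p r + r * p1 r) - \<sigma>1 r * (r * p r)"
    have "?W r0 < 0"
    proof (rule neg_of_deriv_neg[OF r0(1), where W="?W" and W'="\<lambda>r. - (\<sigma> r * (r * (f (p r) - p r * f1 (p r))))"])
      fix r assume r: "0 < r" "r \<le> r0"
      show "(?W has_real_derivative - (\<sigma> r * (r * (f (p r) - p r * f1 (p r))))) (at r)"
      proof (rule wronskian_deriv[OF r(1)])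
        show "((\<lambda>r. r * p r) has_real_derivative p r + r * p1 r) (at r)"
          by (rule Drp[OF r(1)])
        show "((\<lambda>r. p r + r * p1 r) has_real_derivative - f1 (p r) * (r * p r) - r * (f (p r) - p r * f1 (p r))) (at r)"
          using r by (auto intro!: derivative_eq_intros Dp Dp1' simp: field_simps)
      qed
    next
      fix r assume r: "0 < r" "r < r0"
      then have "(p r)\<^sup>2 > 1/2" using q_strict_antimono[of r r0] h by (simp add: q0_def)
      then have "f (p r) - p r * f1 (p r) > 0"
        unfolding f_minus_pf1 using p_pos[of r] r by (intro mult_pos_pos) auto
      then show "- (\<sigma> r * (r * (f (p r) - p r * f1 (p r)))) < 0" using before[OF r] r by simp
    next
      show "(?W \<longlongrightarrow> 0) (at_right 0)"
        by (rule tendsto_eq_intros p1_at_0 p_at_0 \<sigma>_at_0 \<sigma>1_at_0 refl | simp)+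
    qed
    then have "0 < \<sigma>1 r0 * (r0 * p r0)" using r0 by simp
    moreover have "\<sigma>1 r0 * (r0 * p r0) < 0"
      using \<sigma>1_r0 r0 p_pos[OF r0(1)] by (intro mult_neg_pos) auto
    ultimately show False by simp
  qed
  \<comment> \<open>With this c, L v vanishes at r0 if the quotient is nonnegative there.  If it is negative then f(p(r0)) < 0,
     and v = r p' alone works beyond r0.\<close>
  define c where "c = max 0 (g q0 / (q0 * (1 - 2 * q0)))"
  let ?v = "\<lambda>r. r\<^sup>2 * p1 r + c * (r * p r)"
  let ?h = "\<lambda>r. r * (2 * f (p r) + c * (f (p r) - p r * f1 (p r)))"
  let ?W = "\<lambda>r. \<sigma> r * (- r\<^sup>2 * f (p r) + c * (p r + r * p1 r)) - \<sigma>1 r * (r\<^sup>2 * p1 r + c * (r * p r))"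
  have c0: "0 \<le> c" by (simp add: c_def)
  have h_eq: "?h r = 2 * r * p r * (g q - c * q * (1 - 2 * q))" if "q = (p r)\<^sup>2" for q r
    unfolding f_minus_pf1 unfolding f_g that by (simp add: algebra_simps power_numeral_reduce)
  have q0d: "0 < q0 * (1 - 2 * q0)" using q0 q0_half by simp
  have cge: "g q0 \<le> c * q0 * (1 - 2 * q0)"
  proof -
    have "g q0 / (q0 * (1 - 2 * q0)) \<le> c" by (simp add: c_def)
    then show ?thesis using q0d by (simp only: pos_divide_le_eq mult.assoc)
  qed
  \<comment> \<open>For a + b > 1/2 the second factor below is at least its value (1/2 - a)(1/2 - b) for \<omega> = 1/4.\<close>
  have ratio: "0 < g b * (a * (1 - 2*a)) - g a * (b * (1 - 2*b))" if "0 < a" "a < b" "b < 1/2" for a b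
  proof -
    have "g b * (a * (1 - 2*a)) - g a * (b * (1 - 2*b)) = (b - a) * (a * b + \<omega> * (1 - 2 * a - 2 * b))"
      unfolding g_def by (simp add: algebra_simps power_numeral_reduce)
    moreover have "a * b + \<omega> * (1 - 2 * a - 2 * b) > 0"
    proof (cases "1 - 2*a - 2*b \<ge> 0")
      case True then show ?thesis using that \<omega> by (intro add_pos_nonneg) auto
    next
      case False
      then have "\<omega> * (1 - 2*a - 2*b) \<ge> 1/4 * (1 - 2*a - 2*b)"
        using \<omega> by (intro mult_right_mono_neg) auto
      moreover have "(1/2 - a) * (1/2 - b) > 0" using that by (intro mult_pos_pos) auto
      ultimately show ?thesis by (simp add: algebra_simps)
    qed
    ultimately show ?thesis using that by simp
  qed
  have h_neg: "?h r < 0" if r: "r0 < r" for r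
  proof -
    define q where "q = (p r)\<^sup>2"
    have q: "0 < q" "q < q0" using q_strict_antimono[of r0 r] p_pos[of r] r r0 by (auto simp: q_def q0_def)
    have "g q * (q0 * (1 - 2*q0)) < g q0 * (q * (1 - 2*q))" using ratio[of q q0] q q0_half by simp
    also have "\<dots> \<le> c * q0 * (1 - 2 * q0) * (q * (1 - 2*q))"
      using cge q q0_half by (intro mult_right_mono mult_nonneg_nonneg) auto
    also have "\<dots> = c * q * (1 - 2 * q) * (q0 * (1 - 2*q0))" by simp
    finally have "g q < c * q * (1 - 2 * q)" using q0d by (simp only: mult_less_cancel_right_pos)
    then show ?thesis unfolding h_eq[OF q_def] using r r0 p_pos[of r] by (intro mult_pos_neg) auto
  qed
  have v_r0: "?v r0 < 0"
  proof (cases "c = 0")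
    case True
    then show ?thesis using p1_neg[OF r0(1)] r0 by (simp add: mult_pos_neg)
  next
    case False
    then have c: "c > 0" "g q0 = c * q0 * (1 - 2 * q0)"
      using c0 q0d by (auto simp: c_def max_def field_simps split: if_splits)
    have "?W r0 < 0"
    proof (rule neg_of_deriv_neg[OF r0(1) wronskian_scaling _ wronskian_scaling_at_0])
      fix r assume r: "0 < r" "r < r0"
      define q where "q = (p r)\<^sup>2"
      have q: "q0 < q" using q_strict_antimono[of r r0] r by (auto simp: q_def q0_def)
      have "g q - c * q * (1 - 2 * q) > 0"
      proof (cases "q < 1/2")
        case True
        have "0 < g q * (q0 * (1 - 2*q0)) - g q0 * (q * (1 - 2*q))" using ratio[of q0 q] q q0 True by simp
        also have "\<dots> = (g q - c * q * (1 - 2 * q)) * (q0 * (1 - 2*q0))" unfolding c(2) by (simp add: algebra_simps)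
        finally show ?thesis using q0d by (simp only: zero_less_mult_pos2)
      next
        case False
        then have "g q > 0" using f_pos_top[of r] r p_pos[of r] unfolding f_g q_def by (auto simp: zero_less_mult_iff)
        moreover have "c * q * (1 - 2 * q) \<le> 0" using c q q0 False by (intro mult_nonneg_nonpos) auto
        ultimately show ?thesis by simp
      qed
      then have "?h r > 0" unfolding h_eq[OF q_def] using r p_pos[of r] by simp
      then show "- (\<sigma> r * ?h r) < 0" using before[OF r] by simp
    qed simp_all
    then have "0 < \<sigma>1 r0 * ?v r0" using r0 by simp
    then show ?thesis using \<sigma>1_r0 by (simp add: zero_less_mult_iff)
  qed
  have v_\<theta>: "?v r = r * p r * (c - \<theta> r)" if "0 < r" for r
    using p_pos[OF that] by (simp add: \<theta>_def field_simps power2_eq_square)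
  have v_neg: "?v r < 0" if r: "r0 \<le> r" for r
  proof -
    have "c < \<theta> r0" using v_r0 r0 p_pos[of r0] unfolding v_\<theta>[OF r0(1)] by (simp add: mult_less_0_iff)
    also have "\<theta> r0 \<le> \<theta> r" using \<theta>_strict_mono[of r0 r] r r0 by (cases "r = r0") auto
    finally show ?thesis unfolding v_\<theta>[OF less_le_trans[OF r0(1) r]] using r r0 p_pos[of r]
      by (intro mult_pos_neg) auto
  qed
  have W_r0: "?W r0 < 0" using mult_neg_neg[OF \<sigma>1_r0 v_r0] r0 by simp
  have W_dec: "?W b \<le> ?W r0" if b: "r0 \<le> b" and neg: "\<And>r. r0 < r \<Longrightarrow> r < b \<Longrightarrow> \<sigma> r < 0" for b
  proof (rule DERIV_nonpos_imp_decreasing_open[where f="?W", OF b])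
    fix x assume x: "r0 < x" "x < b"
    then have "0 < x" using r0 by simp
    moreover have "- (\<sigma> x * ?h x) \<le> 0" using mult_neg_neg[OF neg[OF x] h_neg[OF x(1)]] by simp
    ultimately show "\<exists>y. (?W has_real_derivative y) (at x) \<and> y \<le> 0" using wronskian_scaling by blast
  next
    show "continuous_on {r0..b} ?W"
      by (rule DERIV_at_imp_continuous_on, rule wronskian_scaling) (use r0 in auto)
  qed
  have after: "\<sigma> r < 0" if r: "r0 < r" for r
  proof (rule ccontr)
    assume nneg: "\<not> \<sigma> r < 0"
    obtain d where d: "d > 0" "\<And>h. 0 < h \<Longrightarrow> h < d \<Longrightarrow> \<sigma> (r0 + h) < 0"
      using DERIV_neg_dec_right[OF D\<sigma>[OF r0(1)] \<sigma>1_r0] r0 by auto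
    have rd: "r0 + d \<le> r" using d(2)[of "r - r0"] r nneg by force
    have "continuous_on {r0 + d/2..r} (\<lambda>t. - \<sigma> t)"
      by (intro continuous_on_minus \<sigma>_cont) (use d r0 in auto)
    then obtain z where z: "r0 + d/2 < z" "- \<sigma> z = 0" "\<And>t. r0 + d/2 \<le> t \<Longrightarrow> t < z \<Longrightarrow> 0 < - \<sigma> t"
      by (rule first_nonpos) (use d rd nneg in auto)
    then have z': "r0 < z" "\<sigma> z = 0" using d(1) by auto
    have neg: "\<sigma> t < 0" if "r0 < t" "t < z" for t
      using z(3)[of t] d(2)[of "t - r0"] d(1) that by (cases "t < r0 + d/2") auto
    have "\<sigma>1 z \<ge> 0"
    proof (rule ccontr)
      assume "\<not> \<sigma>1 z \<ge> 0"
      then obtain e where e: "e > 0" "\<And>h. 0 < h \<Longrightarrow> h < e \<Longrightarrow> \<sigma> z < \<sigma> (z - h)"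
        using DERIV_neg_dec_left[OF D\<sigma>[of z]] r0 z' by auto
      define k where "k = min (e/2) ((z - r0)/2)"
      have "0 < k" "k < e" "r0 < z - k" using e z' by (auto simp: k_def min_def field_simps)
      then show False using e(2)[of k] neg[of "z - k"] z'(2) by auto
    qed
    then have "0 \<le> ?W z" using v_neg[of z] z' by (simp add: mult_nonneg_nonpos)
    then show False using W_dec[of z] neg z' W_r0 by auto
  qed
  have W_le: "?W r \<le> ?W r0" if "r0 \<le> r" for r using W_dec[OF that] after by blast
  obtain R where R: "R > 0" "\<And>r. r \<ge> R \<Longrightarrow> \<omega>/2 \<le> - f1 (p r)" using potential_eventually_positive by blast
  have "((\<lambda>r. r * (- \<sigma> r)) \<longlongrightarrow> 0) at_top \<and> ((\<lambda>r. r * (- \<sigma>1 r)) \<longlongrightarrow> 0) at_top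
       \<or> filterlim (\<lambda>r. - \<sigma> r / r) at_top at_top"
  proof (rule growth_alternative[where V="\<lambda>r. - f1 (p r)" and k="\<omega>/2" and R="max R (r0 + 1)"])
    fix r assume r: "max R (r0 + 1) \<le> r"
    have r': "0 < r" "r0 < r" "R \<le> r" using r r0 by auto
    show "((\<lambda>a. - \<sigma> a) has_real_derivative - \<sigma>1 r) (at r)" by (intro DERIV_minus D\<sigma> r')
    show "((\<lambda>a. - \<sigma>1 a) has_real_derivative - f1 (p r) * - \<sigma> r) (at r)"
      using DERIV_minus[OF D\<sigma>1'[OF r'(1)]] by simp
    show "0 < - \<sigma> r" using after[OF r'(2)] by simp
    show "\<omega>/2 \<le> - f1 (p r)" using R r' by simp
  qed (use \<omega> in simp)
  then show ?thesis
  proof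
    assume "((\<lambda>r. r * (- \<sigma> r)) \<longlongrightarrow> 0) at_top \<and> ((\<lambda>r. r * (- \<sigma>1 r)) \<longlongrightarrow> 0) at_top"
    then have "((\<lambda>r. - \<sigma> r) \<longlongrightarrow> 0) at_top" "((\<lambda>r. - \<sigma>1 r) \<longlongrightarrow> 0) at_top" using tendsto_0_of_mult_id by auto
    then have "(\<sigma> \<longlongrightarrow> 0) at_top" "(\<sigma>1 \<longlongrightarrow> 0) at_top" using tendsto_minus_cancel_left[of _ 0] by auto
    moreover have "((\<lambda>r. - r\<^sup>2 * f (p r)) \<longlongrightarrow> 0) at_top" using tendsto_minus[OF profile_decay(3)] by simp
    ultimately have "(?W \<longlongrightarrow> 0 * (0 + c * (0 + 0)) - 0 * (0 + c * 0)) at_top"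
      by (intro tendsto_intros profile_decay p_decay)
    then have "(?W \<longlongrightarrow> 0) at_top" by simp
    then have "0 \<le> ?W r0"
      by (rule tendsto_upperbound) (rule eventually_mono[OF eventually_ge_at_top[of r0]], rule W_le, simp_all)
    then show ?thesis using W_r0 by simp
  next
    assume "filterlim (\<lambda>r. - \<sigma> r / r) at_top at_top"
    then show ?thesis by (simp add: filterlim_uminus_at_bot)
  qed
qed

end

context soliton_ode begin

abbreviation V :: "real \<Rightarrow> real" where "V r \<equiv> 5 * p r ^ 4 - 3 * p r ^ 2 + \<omega>"

lemma V_cont: "continuous_on {0..} V"
  by (intro continuous_intros p_cont)

lemma regular_solution_diverges:
  assumes D: "\<And>r. 0 < r \<Longrightarrow> (s has_real_derivative s' r) (at r)"
    and D': "\<And>r. 0 < r \<Longrightarrow> (s' has_real_derivative V r * s r) (at r)"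
    and s0: "(s \<longlongrightarrow> 0) (at_right 0)" and l: "(s' \<longlongrightarrow> l) (at_right 0)" "l \<noteq> 0"
  shows "filterlim (\<lambda>r. s r / l / r) at_bot at_top"
proof -
  interpret linearized_ode \<omega> p p1 "\<lambda>r. s r / l" "\<lambda>r. s' r / l"
  proof
    fix r :: real assume r: "0 < r"
    show "((\<lambda>r. s r / l) has_real_derivative s' r / l) (at r)" by (rule DERIV_cdivide[OF D[OF r]])
    show "((\<lambda>r. s' r / l) has_real_derivative V r * (s r / l)) (at r)"
      using DERIV_cdivide[OF D'[OF r]] by simp
  next
    show "((\<lambda>r. s r / l) \<longlongrightarrow> 0) (at_right 0)" using tendsto_divide[OF s0 tendsto_const[of l]] l(2) by simp
    show "((\<lambda>r. s' r / l) \<longlongrightarrow> 1) (at_right 0)" using tendsto_divide[OF l(1) tendsto_const[of l]] l(2) by simp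
  qed
  show ?thesis by (rule \<sigma>_over_r_at_bot)
qed

text \<open>By \<open>regular_solution_diverges\<close> a nonzero initial slope is incompatible with square
integrability, and a vanishing one forces the zero solution.\<close>

lemma square_integrable_solution_zero:
  assumes D: "\<And>r. 0 < r \<Longrightarrow> (s has_real_derivative s' r) (at r)"
    and D': "\<And>r. 0 < r \<Longrightarrow> (s' has_real_derivative V r * s r) (at r)"
    and s0: "(s \<longlongrightarrow> 0) (at_right 0)" and L2: "set_integrable lborel {0<..} (\<lambda>r. (s r)\<^sup>2)"
    and r: "0 < r"
  shows "s r = 0"
proof -
  obtain l where l: "(s' \<longlongrightarrow> l) (at_right 0)" using regular_at_0[OF D D' V_cont s0] by blast
  have "l = 0"
  proof (rule ccontr)
    assume l0: "l \<noteq> 0"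
    have "\<forall>\<^sub>F r in at_top. s r / l / r \<le> - 1"
      using regular_solution_diverges[OF D D' s0 l l0] unfolding filterlim_at_bot by blast
    moreover have "\<forall>\<^sub>F r in at_top. 1 / \<bar>l\<bar> \<le> r" "\<forall>\<^sub>F r::real in at_top. 0 < r"
      by (rule eventually_ge_at_top eventually_gt_at_top)+
    ultimately have "\<forall>\<^sub>F r in at_top. 0 < r \<and> 1 \<le> (s r)\<^sup>2"
    proof eventually_elim
      case (elim r)
      have "1 \<le> \<bar>s r / l / r\<bar>" using elim by linarith
      then have "1 \<le> \<bar>s r\<bar> / \<bar>l\<bar> / \<bar>r\<bar>" unfolding abs_divide .
      moreover have l_pos: "0 < \<bar>l\<bar>" and r_pos: "0 < \<bar>r\<bar>" using elim l0 by auto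
      ultimately have "1 * \<bar>r\<bar> * \<bar>l\<bar> \<le> \<bar>s r\<bar>" by (simp only: pos_le_divide_eq)
      moreover have "1 \<le> \<bar>r\<bar> * \<bar>l\<bar>"
        using elim(2,3) l_pos by (simp only: pos_divide_le_eq abs_of_pos)
      ultimately have "1 \<le> \<bar>s r\<bar>" by linarith
      then show ?case using elim one_le_power[of "\<bar>s r\<bar>" 2] by simp
    qed
    then obtain R where R: "\<And>r. R \<le> r \<Longrightarrow> 0 < r \<and> 1 \<le> (s r)\<^sup>2" unfolding eventually_at_top_linorder by blast
    have "1 \<le> set_lebesgue_integral lborel {x..} (\<lambda>r. (s r)\<^sup>2)" if x: "R \<le> x" for x
      using tail_integral_lower_bound[OF L2, of x x "x+1" 1] R x by auto
    then have "\<forall>\<^sub>F x in at_top. 1 \<le> set_lebesgue_integral lborel {x..} (\<lambda>r. (s r)\<^sup>2)"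
      by (rule eventually_mono[OF eventually_ge_at_top[of R]])
    from tendsto_lowerbound[OF tail_integral_tendsto_0[OF L2] this] show False by simp
  qed
  then show ?thesis using linear_ode_unique_at_0[OF D D' V_cont s0 _ r] l by simp
qed

end

section \<open>From the soliton to its profile, and the theorem\<close>

text \<open>The continuous representative agrees with s(|x|) / |x| everywhere off the origin, since two
continuous functions that agree almost everywhere on an open set agree on it.\<close>

lemma soliton_profile_ode:
  assumes "0 < \<omega>" "\<omega> < 3/16" "is_soliton \<omega> P"
  obtains p p1 where "soliton_ode \<omega> p p1" "\<And>x. P x = p (norm x)"
proof -
  define p where "p = radial_profile P"
  have P: "continuous_on UNIV P" "\<And>x y. norm x = norm y \<Longrightarrow> P x = P y" "\<And>x. 0 \<le> P x" "\<exists>x. P x \<noteq> 0"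
    "has_weak_laplacian P (\<lambda>x. P x ^ 5 - P x ^ 3 + \<omega> * P x)" "sobolev 1 P"
    using assms(3) unfolding is_soliton_def by blast+
  have Pp: "P x = p (norm x)" for x
    unfolding p_def radial_profile_def by (rule P(2)) simp
  have p_cont: "continuous_on UNIV p"
    unfolding p_def radial_profile_def[abs_def]
    by (rule continuous_on_compose2[OF P(1)]) (auto intro!: continuous_intros)
  let ?c = "\<lambda>r. p r ^ 4 - p r ^ 2 + \<omega>"
  obtain s s' where s: "\<And>r. 0 < r \<Longrightarrow> (s has_real_derivative s' r) (at r)"
    "\<And>r. 0 < r \<Longrightarrow> (s' has_real_derivative ?c r * s r) (at r)"
    "(s \<longlongrightarrow> 0) (at_right 0)" "AE x in lborel. P x = s (norm x) / norm x"
  proof (rule radial_weak_solution[OF P(5), of p ?c])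
    show "AE x in lborel. P x = p (norm x)" using Pp by simp
    show "continuous_on {0..} ?c" by (intro continuous_intros continuous_on_subset[OF p_cont]) auto
    show "AE x in lborel. P x ^ 5 - P x ^ 3 + \<omega> * P x = (p (norm x) ^ 4 - (p (norm x))\<^sup>2 + \<omega>) * P x"
      by (simp add: Pp algebra_simps power_numeral_reduce)
  qed blast
  have s_cont: "continuous_on {0<..} s"
    by (rule DERIV_at_imp_continuous_on, rule s(1)) auto
  have ps: "p r = s r / r" if r: "0 < r" for r
  proof -
    let ?D = "\<lambda>x::real^3. P x - s (norm x) / norm x"
    have cont: "continuous_on (- {0}) ?D"
      by (intro continuous_intros continuous_on_subset[OF P(1)] continuous_on_compose2[OF s_cont]) auto
    \<comment> \<open>The set of disagreement is open and null, hence empty.\<close>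
    define S where "S = {x \<in> - {0::real^3}. ?D x \<noteq> 0}"
    have "S = (- {0}) \<inter> ?D -` (- {0})" by (auto simp: S_def)
    then have "open S" using continuous_open_preimage[OF cont, of "- {0}"] by (simp add: open_Compl)
    moreover have "emeasure lborel S = 0"
    proof -
      have "AE x in lborel. x \<notin> S" using s(4) by eventually_elim (auto simp: S_def)
      then show ?thesis using AE_iff_measurable[of S lborel "\<lambda>x. x \<notin> S"] \<open>open S\<close> by auto
    qed
    ultimately have "S = {}" using open_not_negligible[of S] by (auto simp: negligible_iff_null_sets null_sets_def emeasure_completion)
    moreover define x where "x = r *\<^sub>R (axis 1 1 :: real^3)"
    moreover have nx: "norm x = r" using r by (simp add: x_def)
    then have "x \<noteq> 0" using r by auto
    ultimately have "?D x = 0" unfolding S_def by blast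
    then show ?thesis using Pp[of x] nx by simp
  qed
  define p1 where "p1 r = (s' r - p r) / r" for r
  have Dp: "(p has_real_derivative p1 r) (at r)" if r: "0 < r" for r
  proof -
    have "((\<lambda>r. s r / r) has_real_derivative p1 r) (at r)"
      by (rule DERIV_cong[OF DERIV_divide[OF s(1)[OF r] DERIV_ident]])
         (use r in \<open>auto simp: p1_def ps field_simps\<close>)
    then show ?thesis
      by (rule has_field_derivative_transform_within_open[where S="{0<..}"]) (use r ps in auto)
  qed
  have p_at_0: "(p \<longlongrightarrow> p 0) (at_right 0)"
    using p_cont by (auto simp: continuous_on_def intro: tendsto_within_subset)
  have Ds: "s' r = p r + r * p1 r" if "0 < r" for r
    using that by (simp add: p1_def)
  have flux: "((\<lambda>r. r\<^sup>2 * p1 r) \<longlongrightarrow> 0) (at_right 0)"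
  proof -
    have "continuous_on {0..} ?c" by (intro continuous_intros continuous_on_subset[OF p_cont]) auto
    from regular_at_0[OF s(1,2) this s(3)] obtain l where l: "(s' \<longlongrightarrow> l) (at_right 0)" by blast
    have "((\<lambda>r. r * s' r - r * p r) \<longlongrightarrow> 0 * l - 0 * p 0) (at_right 0)"
      by (intro tendsto_intros l p_at_0)
    then have "((\<lambda>r. r * s' r - r * p r) \<longlongrightarrow> 0) (at_right 0)" by simp
    then show ?thesis
      by (rule Lim_transform_eventually)
         (rule eventually_mono[OF eventually_at_right_less],
          simp add: p1_def power2_eq_square field_simps)
  qed
  have "soliton_ode \<omega> p p1"
  proof
    show "0 < \<omega>" "\<omega> < 1/4" using assms by auto
    show "(p has_real_derivative p1 r) (at r)" if "0 < r" for r by (rule Dp[OF that])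
    show "(p1 has_real_derivative - 2 / r * p1 r - (p r ^ 3 - p r ^ 5 - \<omega> * p r)) (at r)" if r: "0 < r" for r
    proof -
      have "s r = r * p r" using ps[OF r] r by simp
      then show ?thesis
        unfolding p1_def[abs_def]
        by (intro DERIV_cong[OF DERIV_divide[OF DERIV_diff[OF s(2)[OF r] Dp[OF r]] DERIV_ident]])
           (use r in \<open>auto simp: p1_def field_simps power_numeral_reduce\<close>)
    qed
    show "(p \<longlongrightarrow> p 0) (at_right 0)" "((\<lambda>r. r\<^sup>2 * p1 r) \<longlongrightarrow> 0) (at_right 0)" by fact+
    show "0 \<le> p r" for r unfolding p_def radial_profile_def by (rule P(3))
    show "\<exists>r>0. p r \<noteq> 0"
    proof (rule ccontr)
      assume "\<not> (\<exists>r>0. p r \<noteq> 0)"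
      then have z: "p r = 0" if "0 < r" for r using that by auto
      have "(p \<longlongrightarrow> 0) (at_right 0)"
        by (rule tendsto_eventually) (rule eventually_mono[OF eventually_at_right_less], rule z)
      then have "p 0 = 0" using tendsto_unique[OF _ p_at_0] by simp
      then have "P x = 0" for x using z[of "norm x"] Pp[of x] by (cases "x = 0") auto
      then show False using P(4) by simp
    qed
    have sq: "integrable lborel (\<lambda>x. (P x)\<^sup>2)"
      using P(6) by (simp add: square_integrable_def)
    have [measurable]: "p \<in> borel_measurable borel" by (rule borel_measurable_continuous_onI[OF p_cont])
    have "integrable lborel (\<lambda>r. radial_weight r * (p r)\<^sup>2)"
      using sq unfolding Pp by (subst (asm) integrable_radial) auto
    from integrable_mult_right[OF this, of "1 / (4 * pi)"]
    show "set_integrable lborel {0<..} (\<lambda>r. (r * p r)\<^sup>2)"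
      unfolding set_integrable_def
      by (rule Bochner_Integration.integrable_cong[THEN iffD1, rotated 2])
         (auto simp: radial_weight_def indicator_def power_mult_distrib)
  qed
  then show ?thesis using that Pp by blast
qed

lemma (in soliton_ode) radial_kernel_trivial:
  fixes v w :: "real^3 \<Rightarrow> real"
  assumes weak: "has_weak_laplacian v w" and rad: "AE x in lborel. v x = g0 (norm x)"
    and w: "AE x in lborel. w x = V (norm x) * v x" and L2: "square_integrable v"
  shows "AE x in lborel. v x = 0"
proof -
  obtain s s' where s: "\<And>r. 0 < r \<Longrightarrow> (s has_real_derivative s' r) (at r)"
    "\<And>r. 0 < r \<Longrightarrow> (s' has_real_derivative V r * s r) (at r)"
    "(s \<longlongrightarrow> 0) (at_right 0)" "AE x in lborel. v x = s (norm x) / norm x"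
    using radial_weak_solution[OF weak rad V_cont w] by blast
  have s_cont: "continuous_on {0<..} s"
    by (rule DERIV_at_imp_continuous_on, rule s(1)) auto
  have [measurable]: "v \<in> borel_measurable borel" and v2: "integrable lborel (\<lambda>x. (v x)\<^sup>2)"
    using L2 by (auto simp: square_integrable_def)
  let ?q = "\<lambda>r. (indicator {0<..} r *\<^sub>R s r / r)\<^sup>2"
  have "(\<lambda>r. indicator {0<..} r *\<^sub>R s r) \<in> borel_measurable borel"
    by (rule borel_measurable_continuous_on_indicator[OF _ s_cont]) simp
  then have q [measurable]: "?q \<in> borel_measurable borel" by measurable
  have "AE x in lborel. (v x)\<^sup>2 = ?q (norm x)"
    using s(4) AE_lborel_singleton[of 0] by eventually_elim simp
  moreover have "(\<lambda>x::real^3. ?q (norm x)) \<in> borel_measurable lborel"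
    by (rule measurable_compose[OF _ q]) simp
  ultimately have "integrable lborel (\<lambda>x::real^3. ?q (norm x))"
    using integrable_cong_AE[of "\<lambda>x. (v x)\<^sup>2" lborel "\<lambda>x::real^3. ?q (norm x)"] v2 by simp
  then have "integrable lborel (\<lambda>r. radial_weight r * ?q r)" by (rule integrable_radial[OF q, THEN iffD1])
  from integrable_mult_right[OF this, of "1 / (4 * pi)"]
  have "set_integrable lborel {0<..} (\<lambda>r. (s r)\<^sup>2)"
    unfolding set_integrable_def
    by (rule Bochner_Integration.integrable_cong[THEN iffD1, rotated 2])
       (auto simp: radial_weight_def indicator_def power_divide)
  then have z: "s r = 0" if "0 < r" for r using square_integrable_solution_zero[OF s(1-3) _ that] by blast
  show ?thesis using s(4) AE_lborel_singleton[of 0] by eventually_elim (simp add: z)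
qed

theorem proposition2p5:
  fixes \<omega> :: real and P :: "real^3 \<Rightarrow> real"
  assumes "0 < \<omega>" and "\<omega> < 3/16"
    and "is_soliton \<omega> P"
  shows "(\<forall>\<delta>. is_regular_radial_solution (radial_profile (linearized_potential \<omega> P)) \<delta>
                \<longrightarrow> filterlim \<delta> at_bot at_top)
         \<and> \<not> is_radial_eigenvalue (linearized_potential \<omega> P) 0"
proof -
  obtain p p1 where ode: "soliton_ode \<omega> p p1" and Pp: "\<And>x. P x = p (norm x)"
    using soliton_profile_ode[OF assms] by blast
  interpret soliton_ode \<omega> p p1 by fact
  have pot: "linearized_potential \<omega> P x = V (norm x)" for x
    by (simp add: linearized_potential_def Pp)
  have prof: "radial_profile (linearized_potential \<omega> P) r = V r" if "0 < r" for r
    using that by (simp add: radial_profile_def pot)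
  have "filterlim \<delta> at_bot at_top"
    if reg: "is_regular_radial_solution (radial_profile (linearized_potential \<omega> P)) \<delta>" for \<delta>
  proof -
    obtain \<delta>' \<delta>'' where \<delta>: "(\<delta> \<longlongrightarrow> 1) (at_right 0)"
      "\<And>r. 0 < r \<Longrightarrow> (\<delta> has_real_derivative \<delta>' r) (at r)"
      "\<And>r. 0 < r \<Longrightarrow> (\<delta>' has_real_derivative \<delta>'' r) (at r)"
      "\<And>r. 0 < r \<Longrightarrow> - \<delta>'' r - 2 / r * \<delta>' r + V r * \<delta> r = 0"
      using reg prof unfolding is_regular_radial_solution_def by auto
    let ?s = "\<lambda>r. r * \<delta> r" and ?s' = "\<lambda>r. \<delta> r + r * \<delta>' r"
    have D: "(?s has_real_derivative ?s' r) (at r)" if "0 < r" for r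
      using DERIV_mult[OF DERIV_ident \<delta>(2)[OF that]] by (simp add: algebra_simps)
    have D': "(?s' has_real_derivative V r * ?s r) (at r)" if r: "0 < r" for r
    proof -
      have "\<delta>'' r = V r * \<delta> r - 2 / r * \<delta>' r" using \<delta>(4)[OF r] by linarith
      then have "\<delta>' r + (1 * \<delta>' r + \<delta>'' r * r) = V r * ?s r" using r by (simp add: field_simps)
      then show ?thesis
        by (rule DERIV_cong[OF DERIV_add[OF \<delta>(2)[OF r] DERIV_mult[OF DERIV_ident \<delta>(3)[OF r]]]])
    qed
    have s0: "(?s \<longlongrightarrow> 0) (at_right 0)" by (auto intro!: tendsto_eq_intros \<delta>(1))
    obtain l where l: "(?s' \<longlongrightarrow> l) (at_right 0)" "((\<lambda>r. ?s r / r) \<longlongrightarrow> l) (at_right 0)"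
      using regular_at_0[OF D D' V_cont s0] by blast
    have "(\<delta> \<longlongrightarrow> l) (at_right 0)"
      by (rule Lim_transform_eventually[OF l(2)]) (rule eventually_mono[OF eventually_at_right_less], simp)
    then have "l = 1" using tendsto_unique[OF _ \<delta>(1)] by simp
    then have lim: "filterlim (\<lambda>r. ?s r / 1 / r) at_bot at_top"
      using regular_solution_diverges[OF D D' s0 l(1)] by simp
    have ev: "\<forall>\<^sub>F r in at_top. ?s r / 1 / r = \<delta> r"
      by (rule eventually_mono[OF eventually_gt_at_top[of 0]]) simp
    show ?thesis by (rule filterlim_cong[OF refl refl ev, THEN iffD1, OF lim])
  qed
  moreover have "\<not> is_radial_eigenvalue (linearized_potential \<omega> P) 0"
  proof
    assume "is_radial_eigenvalue (linearized_potential \<omega> P) 0"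
    then obtain u where rad: "radial_ae u" and nz: "\<not> (AE x in lborel. u x = 0)"
      and graph: "schroedinger_graph (linearized_potential \<omega> P) u (\<lambda>x. 0 * u x)"
      unfolding is_radial_eigenvalue_def by blast
    obtain g where g: "AE x in lborel. u x = g (norm x)" using rad unfolding radial_ae_def by (rule exE)
    have H2: "sobolev 2 u" using graph unfolding schroedinger_graph_def by (rule conjunct1)
    have "\<exists>w. has_weak_laplacian u w \<and> (AE x in lborel. 0 * u x = - w x + linearized_potential \<omega> P x *\<^sub>R u x)"
      using graph unfolding schroedinger_graph_def by (elim conjE)
    then obtain w where weak: "has_weak_laplacian u w"
      and eq: "AE x in lborel. 0 * u x = - w x + linearized_potential \<omega> P x *\<^sub>R u x" by (elim exE conjE)
    have sq: "square_integrable u" using H2 by (simp add: numeral_2_eq_2)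
    have part: "AE x in lborel. T (u x) = 0"
      if T: "bounded_linear T" "\<And>z. \<bar>T z\<bar> \<le> norm z" for T :: "complex \<Rightarrow> real"
    proof (rule radial_kernel_trivial[OF has_weak_laplacian_bounded_linear[OF T(1) weak]])
      interpret T: bounded_linear T by (rule T(1))
      show "AE x in lborel. T (u x) = (T \<circ> g) (norm x)" using g by eventually_elim simp
      show "AE x in lborel. T (w x) = V (norm x) * T (u x)"
        using eq
      proof eventually_elim
        case (elim x)
        then have "w x = V (norm x) *\<^sub>R u x" by (simp add: pot)
        then show ?case by (simp only: T.scaleR real_scaleR_def)
      qed
      have um: "u \<in> borel_measurable lborel" and ui: "integrable lborel (\<lambda>x. (norm (u x))\<^sup>2)"
        using sq by (auto simp: square_integrable_def)
      have Tm: "(\<lambda>x. T (u x)) \<in> borel_measurable lborel"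
        by (rule measurable_compose[OF um]) (rule borel_measurable_continuous_onI, rule T.continuous_on, rule continuous_on_id)
      moreover have "integrable lborel (\<lambda>x. (norm (T (u x)))\<^sup>2)"
      proof (rule Bochner_Integration.integrable_bound[OF ui])
        show "AE x in lborel. norm ((norm (T (u x)))\<^sup>2) \<le> norm ((norm (u x))\<^sup>2)"
        proof (rule AE_I2)
          fix x
          show "norm ((norm (T (u x)))\<^sup>2) \<le> norm ((norm (u x))\<^sup>2)"
            using power_mono[OF T(2)[of "u x"], of 2] by simp
        qed
      qed (use Tm in measurable)
      ultimately show "square_integrable (\<lambda>x. T (u x))" by (simp add: square_integrable_def)
    qed
    have "AE x in lborel. u x = 0"
      using part[OF bounded_linear_Re abs_Re_le_cmod] part[OF bounded_linear_Im abs_Im_le_cmod]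
      by eventually_elim (simp add: complex_eq_iff)
    then show False using nz by blast
  qed
  ultimately show ?thesis by blast
qed

end
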